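(* Let $1\leq m<n$ be integers, let $s\in(0,m)$ and $\theta\in(0,1)$. For a non-empty set $F\subseteq\mathbb{R}^n$ write $$\Delta_s(F)=\max\big\{0,\ \overline{\dim}_{\mathrm A}^{\theta}F-s,\ (\dim_{\mathrm A}F-s)(1-\theta)\big\}.$$ (a) If $F\subseteq\mathbb{R}^n$ is bounded then $$\dim_{\mathrm H}\big\{V\in G(n,m):\overline{\dim}_{\mathrm B}\,\pi_VF<\overline{\dim}_{\mathrm B}F-\Delta_s(F)\big\}\ \leq\ m(n-m)-(m-s),$$ and likewise $$\dim_{\mathrm H}\big\{V\in G(n,m):\underline{\dim}_{\mathrm B}\,\pi_VF<\underline{\dim}_{\mathrm B}F-\Delta_s(F)\big\}\ \leq\ m(n-m)-(m-s).$$ (b) If $F\subseteq\mathbb{R}^n$ is Borel then $$\dim_{\mathrm H}\big\{V\in G(n,m):\dim_{\mathrm P}\pi_VF<\dim_{\mathrm P}F-\Delta_s(F)\big\}\ \leq\ m(n-m)-(m-s).$$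
   Context: All sets $F$ are non-empty. $G(n,m)$ is the Grassmannian of $m$-dimensional linear subspaces of $\mathbb{R}^n$ (a compact manifold of dimension $m(n-m)$, with its usual metric, e.g. $d(V,W)=\|\pi_V-\pi_W\|$), $\pi_V:\mathbb{R}^n\to V$ is orthogonal projection onto $V$, and $\dim_{\mathrm H}$ is Hausdorff dimension. For non-empty bounded $E\subseteq\mathbb{R}^n$ and $r>0$, $N_r(E)$ is the minimum number of sets of diameter $r$ (using diameter at most $r$ gives the same dimensions) that can cover $E$. The lower and upper box dimensions are $\underline{\dim}_{\mathrm B}E=\liminf_{r\to0}\frac{\log N_r(E)}{-\log r}$ and $\overline{\dim}_{\mathrm B}E=\limsup_{r\to0}\frac{\log N_r(E)}{-\log r}$. The packing dimension of a (not necessarily bounded) set $F$ is $\dim_{\mathrm P}F=\inf\{\sup_j\overline{\dim}_{\mathrm B}F_j: F\subseteq\bigcup_{j=1}^\infty F_j,\ F_j\text{ compact}\}$. The Assouad dimension $\dim_{\mathrm A}F$ is the infimum of $\alpha$ for which there is a constant $C>0$ such that $N_r(B(x,R)\cap F)\leq C(R/r)^\alpha$ for all $0<r<R$ and $x\in F$. For $\theta\in(0,1)$ the upper Assouad spectrum $\overline{\dim}_{\mathrm A}^{\theta}F$ is the infimum of $\alpha$ for which there is a constant $C>0$ such that $N_r(B(x,R)\cap F)\leq C(R/r)^\alpha$ for all $0<r\leq R^{1/\theta}<R<1$ and $x\in F$. *)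

theory Defs
  imports "HOL-Analysis.Analysis"
begin

section \<open>Hausdorff dimension\<close>

text \<open>
  The summand \<open>|U|^\<alpha>\<close> of the Hausdorff measure. The case distinction is needed because
  \<open>0 powr 0 = 0\<close> in HOL, whereas a non-empty set must have weight 1 when \<open>\<alpha> = 0\<close>.
\<close>
definition diam_weight :: "real \<Rightarrow> 'a::metric_space set \<Rightarrow> ennreal" where
  "diam_weight \<alpha> U =
     (if U = {} then 0 else if \<alpha> = 0 then 1 else ennreal (diameter U powr \<alpha>))"

text \<open>
  Boundedness is explicit, here and below, because \<^const>\<open>diameter\<close> is real-valued and only
  meaningful for bounded sets. The members of a cover may be empty, so finite covers are included.
\<close>
definition hausdorff_premeasure :: "real \<Rightarrow> real \<Rightarrow> 'a::metric_space set \<Rightarrow> ennreal" where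
  "hausdorff_premeasure \<delta> \<alpha> E =
     (INF U \<in> {U :: nat \<Rightarrow> 'a set. E \<subseteq> (\<Union>i. U i) \<and> (\<forall>i. bounded (U i) \<and> diameter (U i) \<le> \<delta>)}.
        \<Sum>i. diam_weight \<alpha> (U i))"

definition hausdorff_measure :: "real \<Rightarrow> 'a::metric_space set \<Rightarrow> ennreal" where
  "hausdorff_measure \<alpha> E = (SUP \<delta> \<in> {0<..}. hausdorff_premeasure \<delta> \<alpha> E)"

text \<open>In particular the empty set has Hausdorff dimension 0.\<close>
definition hausdorff_dim :: "'a::metric_space set \<Rightarrow> ereal" where
  "hausdorff_dim E = Inf {ereal \<alpha> |\<alpha>. 0 \<le> \<alpha> \<and> hausdorff_measure \<alpha> E = 0}"


section \<open>Box, packing and Assouad dimensions\<close>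

text \<open>
  The least number of sets of diameter at most \<open>r\<close> covering \<open>E\<close>. It is used only for \<open>r > 0\<close> and
  bounded subsets of Euclidean space, for which a finite cover exists.
\<close>
definition covering_number :: "real \<Rightarrow> 'a::metric_space set \<Rightarrow> nat" where
  "covering_number r E =
     (LEAST k. \<exists>C. finite C \<and> card C = k \<and> E \<subseteq> \<Union>C \<and> (\<forall>U\<in>C. bounded U \<and> diameter U \<le> r))"

definition lower_box_dim :: "'a::metric_space set \<Rightarrow> ereal" where
  "lower_box_dim E =
     Liminf (at_right 0) (\<lambda>r. ereal (ln (real (covering_number r E)) / (- ln r)))"

definition upper_box_dim :: "'a::metric_space set \<Rightarrow> ereal" where
  "upper_box_dim E =
     Limsup (at_right 0) (\<lambda>r. ereal (ln (real (covering_number r E)) / (- ln r)))"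

text \<open>
  Some of the \<open>K j\<close> may be empty: since \<open>ln 0 = 0\<close> in HOL, the empty set has upper box dimension 0,
  so it does not affect the supremum when \<open>F\<close> is non-empty.
\<close>
definition packing_dim :: "'a::metric_space set \<Rightarrow> ereal" where
  "packing_dim F =
     Inf {(SUP j. upper_box_dim (K j)) |K :: nat \<Rightarrow> 'a set. F \<subseteq> (\<Union>j. K j) \<and> (\<forall>j. compact (K j))}"

definition assouad_dim :: "'a::metric_space set \<Rightarrow> ereal" where
  "assouad_dim F =
     Inf {ereal \<alpha> |\<alpha>. \<exists>C>0. \<forall>r R. \<forall>x\<in>F. 0 < r \<and> r < R \<longrightarrow>
            real (covering_number r (cball x R \<inter> F)) \<le> C * (R / r) powr \<alpha>}"

definition upper_assouad_spectrum :: "real \<Rightarrow> 'a::metric_space set \<Rightarrow> ereal" where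
  "upper_assouad_spectrum \<theta> F =
     Inf {ereal \<alpha> |\<alpha>. \<exists>C>0. \<forall>r R. \<forall>x\<in>F.
            0 < r \<and> r \<le> R powr (1 / \<theta>) \<and> R powr (1 / \<theta>) < R \<and> R < 1 \<longrightarrow>
            real (covering_number r (cball x R \<inter> F)) \<le> C * (R / r) powr \<alpha>}"

definition assouad_defect :: "real \<Rightarrow> real \<Rightarrow> 'a::metric_space set \<Rightarrow> ereal" where
  "assouad_defect \<theta> s F =
     Max {0, upper_assouad_spectrum \<theta> F - ereal s, (assouad_dim F - ereal s) * ereal (1 - \<theta>)}"


section \<open>The Grassmannian\<close>

definition grassmannian :: "nat \<Rightarrow> 'a::euclidean_space set set" where
  "grassmannian m = {V. subspace V \<and> dim V = m}"

definition orth_proj :: "'a::euclidean_space set \<Rightarrow> 'a \<Rightarrow> 'a" where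
  "orth_proj V x = (THE y. y \<in> V \<and> (\<forall>v\<in>V. orthogonal (x - y) v))"

lemma orth_proj_unique:
  assumes "subspace V" "y \<in> V" "\<And>v. v \<in> V \<Longrightarrow> orthogonal (x - y) v"
  shows "orth_proj V x = y"
  unfolding orth_proj_def
proof (rule the_equality)
  fix z assume z: "z \<in> V \<and> (\<forall>v\<in>V. orthogonal (x - z) v)"
  then have "y - z \<in> V" using assms by (simp add: subspace_diff)
  then have "orthogonal (x - z) (y - z)" "orthogonal (x - y) (y - z)"
    using z assms by auto
  then have "(y - z) \<bullet> (y - z) = 0"
    by (simp add: orthogonal_def inner_diff_left)
  then show "z = y" by simp
qed (use assms in auto)

lemma orth_proj:
  assumes "subspace V"
  shows "orth_proj V x \<in> V" and "v \<in> V \<Longrightarrow> orthogonal (x - orth_proj V x) v"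
proof -
  obtain y z where yz: "y \<in> span V" "\<And>w. w \<in> span V \<Longrightarrow> orthogonal z w" "x = y + z"
    using orthogonal_subspace_decomp_exists[of V x] by blast
  have "span V = V" using assms by (simp add: span_eq_iff)
  with yz have y: "y \<in> V" "\<And>w. w \<in> V \<Longrightarrow> orthogonal (x - y) w" by auto
  then have "orth_proj V x = y" by (rule orth_proj_unique[OF assms])
  with y show "orth_proj V x \<in> V" and "v \<in> V \<Longrightarrow> orthogonal (x - orth_proj V x) v"
    by auto
qed

lemma bounded_linear_orth_proj:
  assumes "subspace V"
  shows "bounded_linear (orth_proj V)"
proof -
  have "linear (orth_proj V)"
  proof (rule linearI)
    fix x y :: 'a
    show "orth_proj V (x + y) = orth_proj V x + orth_proj V y"
    proof (rule orth_proj_unique[OF assms])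
      fix v assume "v \<in> V"
      with orth_proj(2)[OF assms, of v x] orth_proj(2)[OF assms, of v y]
      show "orthogonal (x + y - (orth_proj V x + orth_proj V y)) v"
        by (simp add: orthogonal_def inner_diff_left inner_add_left)
    qed (simp add: assms orth_proj subspace_add)
  next
    fix c :: real and x :: 'a
    show "orth_proj V (c *\<^sub>R x) = c *\<^sub>R orth_proj V x"
    proof (rule orth_proj_unique[OF assms])
      fix v assume "v \<in> V"
      with orth_proj(2)[OF assms, of v x]
      show "orthogonal (c *\<^sub>R x - c *\<^sub>R orth_proj V x) v"
        by (simp add: orthogonal_def inner_diff_left)
    qed (simp add: assms orth_proj subspace_scale)
  qed
  then show ?thesis by (simp add: linear_conv_bounded_linear)
qed

text \<open>
  The metric of the Grassmannian is the operator norm distance of the projections, so the Hausdorff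
  dimension of a set of subspaces is that of its image under the isometric embedding
  \<open>V \<mapsto> \<pi>\<^sub>V\<close> into the bounded linear operators.
\<close>
definition proj_op :: "'a::euclidean_space set \<Rightarrow> 'a \<Rightarrow>\<^sub>L 'a" where
  "proj_op V = Blinfun (orth_proj V)"

definition grassmannian_hausdorff_dim :: "'a::euclidean_space set set \<Rightarrow> ereal" where
  "grassmannian_hausdorff_dim \<V> = hausdorff_dim (proj_op ` \<V>)"

lemma dist_proj_op:
  assumes "subspace V" "subspace W"
  shows "dist (proj_op V) (proj_op W) = onorm (\<lambda>x. orth_proj V x - orth_proj W x)"
  using assms
  by (simp add: dist_norm norm_blinfun.rep_eq minus_blinfun.rep_eq proj_op_def
      bounded_linear_Blinfun_apply bounded_linear_orth_proj)

lemma inj_on_proj_op: "inj_on proj_op {V :: 'a::euclidean_space set. subspace V}"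
proof (rule inj_onI, clarify)
  fix V W :: "'a set"
  assume VW: "subspace V" "subspace W" and eq: "proj_op V = proj_op W"
  have range: "range (orth_proj U) = U" if "subspace U" for U :: "'a set"
  proof
    show "U \<subseteq> range (orth_proj U)"
      using orth_proj_unique[OF that] by (metis diff_self orthogonal_clauses(6) rangeI subsetI)
  qed (use orth_proj(1)[OF that] in auto)
  have "orth_proj V = orth_proj W"
    using arg_cong[OF eq, of blinfun_apply] VW
    by (simp add: proj_op_def bounded_linear_Blinfun_apply bounded_linear_orth_proj)
  then show "V = W" using range VW by metis
qed

end

theory Submission
  imports Defs
begin

text \<open>
  Let \<open>t = m (n - m) - (m - s) = m (n - 1 - m) + s\<close>. The planes \<open>V\<close> with \<open>|\<pi>\<^sub>V x| \<le> r\<close> lie within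
  \<open>O(r / |x|)\<close> of those orthogonal to \<open>x\<close>, a family of dimension \<open>m (n - 1 - m)\<close>. Hence a measure on
  the Grassmannian with \<open>\<mu>(B(V, \<rho>)) \<le> \<rho>\<^sup>t\<close> gives them mass at most a constant times \<open>(r / |x|)\<^sup>s\<close>.
  For an \<open>r\<close>-separated \<open>E \<subseteq> F\<close> with \<open>|E| \<approx> N\<^sub>r(F)\<close>, each \<open>V\<close> with \<open>N\<^sub>r(\<pi>\<^sub>V F) \<le> M\<close> has, by
  Cauchy-Schwarz, at least \<open>|E|\<^sup>2 / M\<close> pairs \<open>x, y \<in> E\<close> with \<open>|\<pi>\<^sub>V (x - y)| \<le> r\<close>. Integrating over \<open>V\<close>
  bounds the mass of such \<open>V\<close> by \<open>M / |E|\<close> times the largest potential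
  \<open>\<Sum>\<^sub>y min(1, (r / |x - y|)\<^sup>s)\<close>. The Assouad dimension controls the count of \<open>E \<inter> B(x, R)\<close> for
  \<open>r \<le> R \<le> r\<^sup>\<theta>\<close> and the Assouad spectrum for \<open>r\<^sup>\<theta> \<le> R < 1\<close>, so the potential is at most
  \<open>r\<close> to a power slightly below \<open>-\<Delta>\<^sub>s(F)\<close>.

  The measure is built only at a finite scale, by a finite version of Frostman's lemma on the dyadic
  tree. That works for arbitrary sets, so no measurability of the exceptional set is needed.

  For packing dimension, a Borel set is the projection of a closed subset of \<open>\<real>\<^sup>n \<times> \<nat>\<^sup>\<nat>\<close>. After
  removing the pieces of small packing dimension, Baire's theorem there puts each exceptional \<open>V\<close> into
  the exceptional set for upper box dimension of one of countably many pieces.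
\<close>

subsection \<open>Covering numbers\<close>

text \<open>The bound is obtained at the exponent t itself, without exponents decreasing to it. A
  strict inequality between dimensions leaves room for numbers with p + \<delta> < q, and this gap
  yields a factor \<open>r powr \<gamma>\<close> with \<gamma> > 0. Hence at every rational level
  the exceptional set has t-dimensional content exactly 0.

  Content takes the place of measure because it is what the finite Frostman construction bounds: it
  is countably subadditive on arbitrary sets, and content 0 forces measure 0 when t > 0.

  The weights change with r and no limit measure is formed. This suffices because F is bounded:
  differences of its points have norm at most some 2 D, so only slabs of relative width at least r /
  (2 D) occur, and no constant depends on the depth N of the tree.

  For packing dimension the obstacle is that a Borel set need not be a Baire space, whereas a closed
  set projecting onto it is completely metrizable. Passing to pieces of F costs nothing, since the
  defect is monotone under inclusion and the same \<delta> serves every piece.\<close>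

lemma finite_cover_exists:
  fixes E :: "'a::euclidean_space set"
  assumes "bounded E" "r > 0"
  shows "\<exists>C. finite C \<and> E \<subseteq> \<Union>C \<and> (\<forall>U\<in>C. bounded U \<and> diameter U \<le> r)"
proof -
  have "compact (closure E)" using assms by (simp add: compact_closure)
  then obtain k where k: "finite k" "closure E \<subseteq> (\<Union>x\<in>k. ball x (r/2))"
    using compact_eq_totally_bounded[of "closure E"] assms(2) by (meson half_gt_zero)
  show ?thesis
    using k assms(2) closure_subset[of E]
    by (intro exI[of _ "(\<lambda>x. ball x (r/2)) ` k"]) auto
qed

lemma covering_number_le:
  assumes "finite C" "E \<subseteq> \<Union>C" "\<forall>U\<in>C. bounded U \<and> diameter U \<le> r"
  shows "covering_number r E \<le> card C"
  unfolding covering_number_def using assms by (intro Least_le) blast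

lemma covering_number_attained:
  fixes E :: "'a::euclidean_space set"
  assumes "bounded E" "r > 0"
  obtains C where "finite C" "card C = covering_number r E" "E \<subseteq> \<Union>C"
    "\<forall>U\<in>C. bounded U \<and> diameter U \<le> r"
proof -
  have "\<exists>k C. finite C \<and> card C = k \<and> E \<subseteq> \<Union>C \<and> (\<forall>U\<in>C. bounded U \<and> diameter U \<le> r)"
    using finite_cover_exists[OF assms] by blast
  from LeastI_ex[OF this] show ?thesis
    unfolding covering_number_def[symmetric] using that by blast
qed

lemma covering_number_mono:
  fixes E F :: "'a::euclidean_space set"
  assumes "E \<subseteq> F" "bounded F" "r > 0"
  shows "covering_number r E \<le> covering_number r F"
proof -
  obtain C where "finite C" "card C = covering_number r F" "F \<subseteq> \<Union>C"
    "\<forall>U\<in>C. bounded U \<and> diameter U \<le> r"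
    using covering_number_attained[OF assms(2,3)] by metis
  then show ?thesis using covering_number_le[of C E r] assms(1) by (metis subset_trans)
qed

lemma covering_number_antimono:
  fixes E :: "'a::euclidean_space set"
  assumes "bounded E" "0 < r" "r \<le> r'"
  shows "covering_number r' E \<le> covering_number r E"
proof -
  obtain C where "finite C" "card C = covering_number r E" "E \<subseteq> \<Union>C"
    "\<forall>U\<in>C. bounded U \<and> diameter U \<le> r"
    using covering_number_attained[OF assms(1,2)] by metis
  then show ?thesis using covering_number_le[of C E r'] assms(3) by fastforce
qed

lemma covering_number_pos:
  fixes E :: "'a::euclidean_space set"
  assumes "bounded E" "r > 0" "E \<noteq> {}"
  shows "covering_number r E > 0"
proof -
  obtain C where "finite C" "card C = covering_number r E" "E \<subseteq> \<Union>C"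
    using covering_number_attained[OF assms(1,2)] by metis
  with assms(3) show ?thesis by (metis Sup_empty card_gt_0_iff subset_empty)
qed

lemma separated_card_le:
  fixes E :: "'a::euclidean_space set"
  assumes "bounded E" "r > 0" "P \<subseteq> E"
    and sep: "\<And>x y. x \<in> P \<Longrightarrow> y \<in> P \<Longrightarrow> x \<noteq> y \<Longrightarrow> r < dist x y"
  shows "finite P" "card P \<le> covering_number r E"
proof -
  obtain C where C: "finite C" "card C = covering_number r E" "E \<subseteq> \<Union>C"
    "\<forall>U\<in>C. bounded U \<and> diameter U \<le> r"
    using covering_number_attained[OF assms(1,2)] by metis
  have "\<forall>x\<in>P. \<exists>U. U \<in> C \<and> x \<in> U" using C(3) assms(3) by blast
  from bchoice[OF this] obtain g where g: "\<And>x. x \<in> P \<Longrightarrow> g x \<in> C \<and> x \<in> g x" by blast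
  have "inj_on g P"
  proof (rule inj_onI, rule ccontr)
    fix x y assume xy: "x \<in> P" "y \<in> P" "g x = g y" "x \<noteq> y"
    then have "dist x y \<le> diameter (g x)"
      using g[OF xy(1)] g[OF xy(2)] C(4) diameter_bounded_bound[of "g x" x y] by simp
    moreover have "diameter (g x) \<le> r" using g C(4) xy(1) by blast
    ultimately show False using sep[OF xy(1,2,4)] by linarith
  qed
  moreover have "g ` P \<subseteq> C" using g by auto
  ultimately show "finite P" "card P \<le> covering_number r E"
    using C(1,2) inj_on_finite[of g P C] card_inj_on_le[of g P C] by simp_all
qed

text \<open>Cardinalities of separated subsets are bounded by a covering number, so one of greatest
  cardinality exists; a point left uncovered by its balls could be added to it.\<close>

lemma maximal_separated_subset:
  fixes F :: "'a::euclidean_space set"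
  assumes "bounded F" "r > 0"
  obtains E where "finite E" "E \<subseteq> F" "\<And>x y. x \<in> E \<Longrightarrow> y \<in> E \<Longrightarrow> x \<noteq> y \<Longrightarrow> r < dist x y"
    "F \<subseteq> (\<Union>x\<in>E. cball x r)"
proof -
  define S where "S = {E. E \<subseteq> F \<and> (\<forall>x\<in>E. \<forall>y\<in>E. x \<noteq> y \<longrightarrow> r < dist x y)}"
  have bnd: "finite E \<and> card E \<le> covering_number r F" if "E \<in> S" for E
    using separated_card_le[OF assms, of E] that unfolding S_def by blast
  have "{} \<in> S" by (simp add: S_def)
  moreover have "\<forall>E. E \<in> S \<longrightarrow> card E < Suc (covering_number r F)"
    using bnd le_imp_less_Suc by blast
  ultimately obtain E where E: "E \<in> S" "\<And>E'. E' \<in> S \<Longrightarrow> card E' \<le> card E"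
    using ex_has_greatest_nat[of "\<lambda>E. E \<in> S" "{}" card "Suc (covering_number r F)"]
    by blast
  have "F \<subseteq> (\<Union>x\<in>E. cball x r)"
  proof (rule ccontr)
    assume "\<not> ?thesis"
    then obtain z where z: "z \<in> F" "\<And>x. x \<in> E \<Longrightarrow> r < dist x z" by fastforce
    then have "z \<notin> E" using assms(2) by force
    have "insert z E \<in> S" using E(1) z unfolding S_def by (auto simp: dist_commute)
    then have "card (insert z E) \<le> card E" by (rule E(2))
    with \<open>z \<notin> E\<close> bnd[OF E(1)] show False by simp
  qed
  with E(1) bnd[OF E(1)] show ?thesis by (intro that[of E]) (auto simp: S_def)
qed

subsection \<open>Hausdorff content\<close>

text \<open>Without a bound on the diameters, the cells chosen by the finite Frostman construction
  form an admissible cover however coarse they are.\<close>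

definition hausdorff_content :: "real \<Rightarrow> 'a::metric_space set \<Rightarrow> ennreal" where
  "hausdorff_content t E =
     (INF U \<in> {U :: nat \<Rightarrow> 'a set. E \<subseteq> (\<Union>i. U i) \<and> (\<forall>i. bounded (U i))}.
        \<Sum>i. diam_weight t (U i))"

lemma hausdorff_content_le:
  assumes "E \<subseteq> (\<Union>i. U i)" "\<And>i. bounded (U i)"
  shows "hausdorff_content t E \<le> (\<Sum>i::nat. diam_weight t (U i))"
  unfolding hausdorff_content_def using assms by (intro INF_lower) auto

lemma hausdorff_content_mono: "E \<subseteq> F \<Longrightarrow> hausdorff_content t E \<le> hausdorff_content t F"
  unfolding hausdorff_content_def by (intro INF_superset_mono) auto

lemma hausdorff_content_UN_le:
  fixes E :: "nat \<Rightarrow> 'a::metric_space set"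
  shows "hausdorff_content t (\<Union>n. E n) \<le> (\<Sum>n. hausdorff_content t (E n))"
proof (rule ennreal_le_epsilon)
  fix e :: real assume fin: "(\<Sum>n. hausdorff_content t (E n)) < top" and e: "0 < e"
  have "\<exists>U :: nat \<Rightarrow> 'a set. E n \<subseteq> (\<Union>i. U i) \<and> (\<forall>i. bounded (U i)) \<and>
      (\<Sum>i. diam_weight t (U i)) \<le> hausdorff_content t (E n) + ennreal (e * (1/2)^Suc n)" for n
  proof -
    have "hausdorff_content t (E n) < top"
      using ennreal_suminf_lessD[OF fin] by simp
    then have "hausdorff_content t (E n) < hausdorff_content t (E n) + ennreal (e * (1/2)^Suc n)"
      using e by (simp add: ennreal_zero_less_mult_iff)
    then show ?thesis
      unfolding hausdorff_content_def INF_less_iff by (auto intro: less_imp_le)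
  qed
  then obtain U :: "nat \<Rightarrow> nat \<Rightarrow> 'a set" where U: "\<And>n. E n \<subseteq> (\<Union>i. U n i)" "\<And>n i. bounded (U n i)"
     "\<And>n. (\<Sum>i. diam_weight t (U n i)) \<le> hausdorff_content t (E n) + ennreal (e * (1/2)^Suc n)"
    by metis
  define W where "W = (\<lambda>(n, i). U n i) \<circ> prod_decode"
  have "(\<Union>n. E n) \<subseteq> (\<Union>k. W k)"
  proof
    fix x assume "x \<in> (\<Union>n. E n)"
    then obtain n i where "x \<in> U n i" using U(1) by blast
    then have "x \<in> W (prod_encode (n, i))" by (simp add: W_def)
    then show "x \<in> (\<Union>k. W k)" by blast
  qed
  then have "hausdorff_content t (\<Union>n. E n) \<le> (\<Sum>k. diam_weight t (W k))"
    by (rule hausdorff_content_le) (auto simp: W_def U(2) split: prod.split)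
  also have "\<dots> = (\<Sum>k. ((\<lambda>(n, i). diam_weight t (U n i)) \<circ> prod_decode) k)"
    by (simp add: W_def case_prod_unfold)
  also have "\<dots> = (\<Sum>n. \<Sum>i. diam_weight t (U n i))"
    unfolding comp_def by (rule suminf_ennreal_2dimen) simp
  also have "\<dots> \<le> (\<Sum>n. hausdorff_content t (E n) + ennreal (e * (1/2)^Suc n))"
    by (intro suminf_le U(3)) auto
  also have "\<dots> = (\<Sum>n. hausdorff_content t (E n)) + (\<Sum>n. ennreal (e * (1/2)^Suc n))"
    by (subst suminf_add) auto
  also have "(\<Sum>n. ennreal (e * (1/2)^Suc n)) = ennreal e"
    using sums_mult[OF power_half_series, of e] e
    by (intro suminf_ennreal_eq) auto
  finally show "hausdorff_content t (\<Union>n. E n) \<le> (\<Sum>n. hausdorff_content t (E n)) + ennreal e" .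
qed

lemma hausdorff_content_countable_UN_eq_0:
  assumes "countable I" "\<And>i. i \<in> I \<Longrightarrow> hausdorff_content t (E i) = 0" "t > 0"
  shows "hausdorff_content t (\<Union>i\<in>I. E i) = 0"
proof (cases "I = {}")
  case True
  have "hausdorff_content t ({} :: 'b set) \<le> (\<Sum>i::nat. diam_weight t ({} :: 'b set))"
    by (rule hausdorff_content_le) auto
  then show ?thesis using True by (simp add: diam_weight_def)
next
  case False
  have "(\<Union>i\<in>I. E i) = (\<Union>n. E (from_nat_into I n))"
    using range_from_nat_into[OF False assms(1)] by (metis image_image)
  moreover have "(\<Sum>n. hausdorff_content t (E (from_nat_into I n))) = 0"
    using assms(2) from_nat_into[OF False] by simp
  ultimately show ?thesis
    using hausdorff_content_UN_le[of t "\<lambda>n. E (from_nat_into I n)"] by simp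
qed

text \<open>In a cover of total weight below \<open>\<delta> powr t\<close> every single member has
  diameter below \<delta>. Covers of small weight are thus automatically fine.\<close>

lemma hausdorff_content_0_imp_measure_0:
  assumes "hausdorff_content t E = 0" "t > 0"
  shows "hausdorff_measure t E = 0"
proof -
  have "hausdorff_premeasure \<delta> t E = 0" if "\<delta> > 0" for \<delta>
  proof -
    have "hausdorff_premeasure \<delta> t E \<le> 0 + ennreal e" if e: "e > 0" for e
    proof -
      have "0 < ennreal (min e (\<delta> powr t))" using e \<open>\<delta> > 0\<close> by simp
      then have "hausdorff_content t E < ennreal (min e (\<delta> powr t))" using assms(1) by simp
      then obtain U :: "nat \<Rightarrow> 'a set" where U: "E \<subseteq> (\<Union>i. U i)" "\<And>i. bounded (U i)"
          "(\<Sum>i. diam_weight t (U i)) < ennreal (min e (\<delta> powr t))"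
        unfolding hausdorff_content_def INF_less_iff by auto
      have "diameter (U i) \<le> \<delta>" for i
      proof (cases "U i = {}")
        case False
        have "diam_weight t (U i) < ennreal (min e (\<delta> powr t))"
          by (rule ennreal_suminf_lessD[OF U(3)])
        then have "diameter (U i) powr t < \<delta> powr t"
          using False assms(2) by (simp add: diam_weight_def ennreal_less_iff)
        then show ?thesis
          using assms(2) that powr_mono2[of t \<delta> "diameter (U i)"] \<open>\<delta> > 0\<close> by fastforce
      qed (use that \<open>\<delta> > 0\<close> in simp)
      then have "hausdorff_premeasure \<delta> t E \<le> (\<Sum>i. diam_weight t (U i))"
        unfolding hausdorff_premeasure_def using U by (intro INF_lower) auto
      also have "\<dots> \<le> ennreal (min e (\<delta> powr t))" using U(3) by (rule less_imp_le)
      also have "\<dots> \<le> ennreal e" by (rule ennreal_leI) simp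
      finally show ?thesis by simp
    qed
    then have "hausdorff_premeasure \<delta> t E \<le> 0" by (rule ennreal_le_epsilon)
    then show ?thesis by simp
  qed
  then have "hausdorff_measure t E \<le> 0" unfolding hausdorff_measure_def by (intro SUP_least) simp
  then show ?thesis by simp
qed

lemma hausdorff_dim_le:
  assumes "hausdorff_content t E = 0" "t > 0"
  shows "hausdorff_dim E \<le> ereal t"
  unfolding hausdorff_dim_def
  using assms hausdorff_content_0_imp_measure_0[OF assms] by (intro Inf_lower) auto

lemma hausdorff_content_finite_cover:
  assumes "finite \<C>" "E \<subseteq> (\<Union>c\<in>\<C>. U c)" "t > 0"
    and "\<And>c. c \<in> \<C> \<Longrightarrow> bounded (U c) \<and> diameter (U c) \<le> d c"
  shows "hausdorff_content t E \<le> ennreal (\<Sum>c\<in>\<C>. d c powr t)"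
proof -
  obtain h where h: "bij_betw h {..<card \<C>} \<C>"
    using ex_bij_betw_nat_finite[OF assms(1)] by (auto simp: atLeast0LessThan)
  define W where "W i = (if i < card \<C> then U (h i) else {})" for i
  have "E \<subseteq> (\<Union>i. W i)"
  proof
    fix x assume "x \<in> E"
    then obtain c where c: "c \<in> \<C>" "x \<in> U c" using assms(2) by blast
    then have "c \<in> h ` {..<card \<C>}" using h by (simp add: bij_betw_def)
    then obtain i where "i < card \<C>" "h i = c" by auto
    with c have "x \<in> W i" by (simp add: W_def)
    then show "x \<in> (\<Union>i. W i)" by blast
  qed
  moreover have hC: "h i \<in> \<C>" if "i < card \<C>" for i using h that by (auto simp: bij_betw_def)
  then have "\<And>i. bounded (W i)" using assms(4) by (simp add: W_def)
  ultimately have "hausdorff_content t E \<le> (\<Sum>i. diam_weight t (W i))"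
    by (rule hausdorff_content_le)
  also have "\<dots> = (\<Sum>i<card \<C>. diam_weight t (W i))"
    by (rule suminf_finite) (auto simp: W_def diam_weight_def)
  also have "\<dots> \<le> (\<Sum>i<card \<C>. ennreal (d (h i) powr t))"
  proof (rule sum_mono)
    fix i assume "i \<in> {..<card \<C>}"
    then have i: "i < card \<C>" by simp
    show "diam_weight t (W i) \<le> ennreal (d (h i) powr t)"
    proof (cases "W i = {}")
      case True then show ?thesis by (simp add: diam_weight_def)
    next
      case False
      have "bounded (U (h i)) \<and> diameter (U (h i)) \<le> d (h i)" using assms(4)[OF hC[OF i]] .
      then have "diameter (U (h i)) powr t \<le> d (h i) powr t"
        using assms(3) diameter_ge_0 by (intro powr_mono2) auto
      then show ?thesis using False i assms(3) by (simp add: W_def diam_weight_def ennreal_leI)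
    qed
  qed
  also have "\<dots> = ennreal (\<Sum>i<card \<C>. d (h i) powr t)" by (rule sum_ennreal) simp
  also have "(\<Sum>i<card \<C>. d (h i) powr t) = (\<Sum>c\<in>\<C>. d c powr t)"
    by (rule sum.reindex_bij_betw[OF h])
  finally show ?thesis .
qed

subsection \<open>A finite Frostman lemma\<close>

text \<open>
  The weights are built from the finest level upwards: a cell whose mass exceeds \<open>c k\<close> is scaled down
  to mass \<open>c k\<close>, which keeps the finer bounds and makes the cell itself saturated.
\<close>
lemma discrete_frostman_tree:
  fixes Q :: "nat \<Rightarrow> 'p \<Rightarrow> 'c" and c :: "nat \<Rightarrow> real"
  assumes "finite P" "\<And>k x y. Q (Suc k) x = Q (Suc k) y \<Longrightarrow> Q k x = Q k y"
    and c: "\<And>k. c k > 0" and "k0 \<le> N"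
  shows "\<exists>w. (\<forall>x. 0 \<le> w x) \<and> (\<forall>k\<in>{k0..N}. \<forall>x\<in>P. sum w {y\<in>P. Q k y = Q k x} \<le> c k) \<and>
     (\<forall>x\<in>P. \<exists>k\<in>{k0..N}. sum w {y\<in>P. Q k y = Q k x} = c k)"
  using \<open>k0 \<le> N\<close>
proof (induction k0 rule: inc_induct)
  case base
  define w where "w x = c N / card {y\<in>P. Q N y = Q N x}" for x
  have "sum w {y\<in>P. Q N y = Q N x} = c N" if "x \<in> P" for x
  proof -
    have "card {y\<in>P. Q N y = Q N x} > 0" using that assms(1) by (auto simp: card_gt_0_iff)
    moreover have "sum w {y\<in>P. Q N y = Q N x} = (\<Sum>y\<in>{y\<in>P. Q N y = Q N x}. c N / card {y\<in>P. Q N y = Q N x})"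
      by (rule sum.cong) (auto simp: w_def)
    ultimately show ?thesis by simp
  qed
  then show ?case using c[of N] by (intro exI[of _ w]) (auto simp: w_def)
next
  case (step n)
  then obtain w where w: "\<And>x. 0 \<le> w x"
     "\<And>k x. k \<in> {Suc n..N} \<Longrightarrow> x \<in> P \<Longrightarrow> sum w {y\<in>P. Q k y = Q k x} \<le> c k"
     "\<And>x. x \<in> P \<Longrightarrow> \<exists>k\<in>{Suc n..N}. sum w {y\<in>P. Q k y = Q k x} = c k"
    by blast
  have refine: "Q n x = Q n y" if "Q k x = Q k y" "n \<le> k" for k x y
    using that(2,1) by (induction k rule: dec_induct) (auto dest: assms(2))
  define S where "S x = sum w {y\<in>P. Q n y = Q n x}" for x
  define w' where "w' x = (if S x \<le> c n then w x else w x * (c n / S x))" for x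
  have S0: "S x \<ge> 0" for x unfolding S_def using w(1) by (simp add: sum_nonneg)
  have w'w: "w' x \<le> w x" for x
  proof (cases "S x \<le> c n")
    case False
    then have "c n / S x \<le> 1" using c[of n] by simp
    then have "w x * (c n / S x) \<le> w x" using w(1)[of x] by (rule mult_left_le)
    then show ?thesis using False by (simp add: w'_def)
  qed (simp add: w'_def)
  have w'0: "0 \<le> w' x" for x
    using w(1)[of x] S0[of x] c[of n] by (simp add: w'_def)
  have S_eq: "S y = S x" if "Q n y = Q n x" for x y using that by (simp add: S_def)
  have small: "w' y = w y" if "Q n y = Q n x" "S x \<le> c n" for x y
    using S_eq[OF that(1)] that(2) by (simp add: w'_def)
  have big: "sum w' {y\<in>P. Q n y = Q n x} = c n" if "S x > c n" for x
  proof -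
    have "sum w' {y\<in>P. Q n y = Q n x} = (\<Sum>y\<in>{y\<in>P. Q n y = Q n x}. w y * (c n / S x))"
    proof (rule sum.cong)
      fix y assume "y \<in> {y\<in>P. Q n y = Q n x}"
      then have "S y = S x" by (intro S_eq) simp
      then show "w' y = w y * (c n / S x)" using that by (simp add: w'_def)
    qed simp
    also have "\<dots> = S x * (c n / S x)" by (simp only: S_def sum_distrib_right)
    also have "\<dots> = c n" using that c[of n] by simp
    finally show ?thesis .
  qed
  have "sum w' {y\<in>P. Q k y = Q k x} \<le> c k" if "k \<in> {n..N}" "x \<in> P" for k x
  proof (cases "k = n")
    case True
    show ?thesis
    proof (cases "S x \<le> c n")
      case True
      have "sum w' {y\<in>P. Q n y = Q n x} \<le> S x" unfolding S_def by (intro sum_mono w'w)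
      with True \<open>k = n\<close> show ?thesis by simp
    qed (use big \<open>k = n\<close> in force)
  next
    case False
    have "sum w' {y\<in>P. Q k y = Q k x} \<le> sum w {y\<in>P. Q k y = Q k x}" by (intro sum_mono w'w)
    with w(2)[of k x] that False show ?thesis by fastforce
  qed
  \<comment> \<open>If the level-\<open>n\<close> cell of \<open>x\<close> is not scaled, then by
    \<open>refine\<close> all finer cells of \<open>x\<close> lie inside it and keep their masses,
    so the old saturated one survives. If it is scaled, it is itself saturated.\<close>
  moreover have "\<exists>k\<in>{n..N}. sum w' {y\<in>P. Q k y = Q k x} = c k" if xP: "x \<in> P" for x
  proof (cases "S x \<le> c n")
    case True
    obtain k where k: "k \<in> {Suc n..N}" "sum w {y\<in>P. Q k y = Q k x} = c k"
      using w(3)[OF xP] by blast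
    have "sum w' {y\<in>P. Q k y = Q k x} = sum w {y\<in>P. Q k y = Q k x}"
      using k(1) refine True by (intro sum.cong refl small) auto
    with k show ?thesis by (intro bexI[of _ k]) auto
  qed (use big step.hyps in force)
  ultimately show ?case using w'0 by (intro exI[of _ w']) blast
qed

text \<open>The coarsest saturated cells of the points partition \<open>P\<close>. Adding their
  masses gives the equality of cost and mass, which is the half of Frostman's lemma that bounds
  content by mass.\<close>

lemma discrete_frostman_tree_cover:
  fixes Q :: "nat \<Rightarrow> 'p \<Rightarrow> 'c" and c :: "nat \<Rightarrow> real"
  assumes P: "finite P" and nest: "\<And>k x y. Q (Suc k) x = Q (Suc k) y \<Longrightarrow> Q k x = Q k y"
    and c: "\<And>k. c k > 0"
  shows "\<exists>w X \<kappa>. (\<forall>x. 0 \<le> w x) \<and>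
    (\<forall>k\<le>N. \<forall>x\<in>P. sum w {y\<in>P. Q k y = Q k x} \<le> c k) \<and>
    X \<subseteq> P \<and> (\<forall>x\<in>P. \<kappa> x \<le> N) \<and> (\<forall>y\<in>P. \<exists>x\<in>X. Q (\<kappa> x) y = Q (\<kappa> x) x) \<and>
    (\<Sum>x\<in>X. c (\<kappa> x)) = sum w P"
proof -
  obtain w where w: "\<And>x. 0 \<le> w x"
     "\<And>k x. k \<in> {0..N} \<Longrightarrow> x \<in> P \<Longrightarrow> sum w {y\<in>P. Q k y = Q k x} \<le> c k"
     "\<And>x. x \<in> P \<Longrightarrow> \<exists>k\<in>{0..N}. sum w {y\<in>P. Q k y = Q k x} = c k"
    using discrete_frostman_tree[of P Q c 0 N, OF P nest c] by blast
  \<comment> \<open>Small \<open>k\<close> means a large cell; minimality is what makes the selected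
    cells pairwise equal or disjoint.\<close>
  define \<kappa> where "\<kappa> x = (LEAST k. k \<le> N \<and> sum w {y\<in>P. Q k y = Q k x} = c k)" for x
  have \<kappa>: "\<kappa> x \<le> N \<and> sum w {y\<in>P. Q (\<kappa> x) y = Q (\<kappa> x) x} = c (\<kappa> x)" if "x \<in> P" for x
  proof -
    have "\<exists>k. k \<le> N \<and> sum w {y\<in>P. Q k y = Q k x} = c k" using w(3)[OF that] by auto
    from LeastI_ex[OF this] show ?thesis unfolding \<kappa>_def .
  qed
  have \<kappa>_le: "\<kappa> x \<le> k" if "k \<le> N" "sum w {y\<in>P. Q k y = Q k x} = c k" for k x
    unfolding \<kappa>_def using that by (intro Least_le) auto
  have refine: "Q l x = Q l y" if "Q k x = Q k y" "l \<le> k" for k l x y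
    using that(2,1) by (induction k rule: dec_induct) (auto dest: nest)
  define cell where "cell x = {y\<in>P. Q (\<kappa> x) y = Q (\<kappa> x) x}" for x
  \<comment> \<open>If two selected cells meet, \<open>y\<close> lies in the coarser one, which is
    therefore also a saturated cell of \<open>y\<close>; minimality of \<open>\<kappa> y\<close>
    forces the levels to agree.\<close>
  have one: "cell y = cell x" if "x \<in> P" "y \<in> P" "z \<in> cell x" "z \<in> cell y" "\<kappa> x \<le> \<kappa> y" for x y z
  proof -
    have zx: "Q (\<kappa> x) z = Q (\<kappa> x) x" and zy: "Q (\<kappa> y) z = Q (\<kappa> y) y" using that by (auto simp: cell_def)
    have eq: "Q (\<kappa> x) y = Q (\<kappa> x) x" using refine[OF zy that(5)] zx by simp
    then have "sum w {v\<in>P. Q (\<kappa> x) v = Q (\<kappa> x) y} = c (\<kappa> x)" using \<kappa>[OF that(1)] by simp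
    then have "\<kappa> y \<le> \<kappa> x" using \<kappa>[OF that(1)] by (intro \<kappa>_le[of "\<kappa> x" y]) auto
    then have "\<kappa> y = \<kappa> x" using that(5) by simp
    then show ?thesis using eq by (simp add: cell_def)
  qed
  have disj: "cell x = cell y \<or> cell x \<inter> cell y = {}" if "x \<in> P" "y \<in> P" for x y
  proof (rule ccontr)
    assume neq: "\<not> ?thesis"
    then obtain z where "z \<in> cell x" "z \<in> cell y" by blast
    then show False using one[of x y z] one[of y x z] that neq by (metis nat_le_linear)
  qed
  \<comment> \<open>One representative for each distinct cell, so that the sum over \<open>X\<close>
    counts no cell twice.\<close>
  define rep where "rep C = (SOME x. x \<in> P \<and> cell x = C)" for C
  have rep: "rep (cell x) \<in> P \<and> cell (rep (cell x)) = cell x" if "x \<in> P" for x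
    unfolding rep_def by (rule someI[of _ x]) (use that in auto)
  define X where "X = rep ` (cell ` P)"
  have XP: "X \<subseteq> P" using rep by (auto simp: X_def)
  have cov: "\<exists>x\<in>X. Q (\<kappa> x) y = Q (\<kappa> x) x" if "y \<in> P" for y
  proof (intro bexI)
    have "y \<in> cell (rep (cell y))" using rep[OF that] that by (auto simp: cell_def)
    then show "Q (\<kappa> (rep (cell y))) y = Q (\<kappa> (rep (cell y))) (rep (cell y))" by (simp add: cell_def)
  qed (use that in \<open>auto simp: X_def\<close>)
  have Xinj: "x = y" if "x \<in> X" "y \<in> X" "cell x = cell y" for x y
  proof -
    have "z = rep (cell z)" if "z \<in> X" for z
      using that rep unfolding X_def by (elim imageE) simp
    then show ?thesis using that by metis
  qed
  have "sum w P = sum w (\<Union>x\<in>X. cell x)"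
  proof -
    have "P \<subseteq> (\<Union>x\<in>X. cell x)" using cov by (fastforce simp: cell_def)
    then have "(\<Union>x\<in>X. cell x) = P" by (auto simp: cell_def)
    then show ?thesis by simp
  qed
  also have "\<dots> = (\<Sum>x\<in>X. sum w (cell x))"
  proof (rule sum.UNION_disjoint)
    show "\<forall>x\<in>X. \<forall>y\<in>X. x \<noteq> y \<longrightarrow> cell x \<inter> cell y = {}"
      using disj Xinj XP by (meson subsetD)
    show "finite X" "\<forall>x\<in>X. finite (cell x)" using P XP by (auto simp: cell_def finite_subset)
  qed
  also have "\<dots> = (\<Sum>x\<in>X. c (\<kappa> x))" using \<kappa> XP by (intro sum.cong) (auto simp: cell_def)
  finally have "(\<Sum>x\<in>X. c (\<kappa> x)) = sum w P" by simp
  then show ?thesis using w \<kappa> XP cov by (intro exI[of _ w] exI[of _ X] exI[of _ \<kappa>]) auto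
qed

lemma floor_diff_le_1:
  fixes x y :: real
  assumes "\<bar>x - y\<bar> \<le> 1"
  shows "\<lfloor>x\<rfloor> \<in> {\<lfloor>y\<rfloor> - 1..\<lfloor>y\<rfloor> + 1}"
  using assms by (simp add: abs_le_iff) linarith

lemma floor_double_eq:
  fixes x y :: real
  assumes "\<lfloor>2 * x\<rfloor> = \<lfloor>2 * y\<rfloor>"
  shows "\<lfloor>x\<rfloor> = \<lfloor>y\<rfloor>"
proof -
  have "\<lfloor>z\<rfloor> = \<lfloor>2 * z\<rfloor> div 2" for z :: real by linarith
  then show ?thesis using assms by metis
qed

lemma finite_representatives:
  assumes "finite (q ` E)"
  obtains P where "finite P" "P \<subseteq> E" "\<And>x. x \<in> E \<Longrightarrow> \<exists>y\<in>P. q x = q y"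
proof -
  define P where "P = (\<lambda>c. SOME x. x \<in> E \<and> q x = c) ` (q ` E)"
  have *: "(SOME y. y \<in> E \<and> q y = q x) \<in> E \<and> q (SOME y. y \<in> E \<and> q y = q x) = q x" if "x \<in> E" for x
    by (rule someI[of _ x]) (use that in auto)
  show ?thesis
  proof
    show "finite P" using assms by (simp add: P_def)
    show "P \<subseteq> E" using * by (auto simp: P_def)
    show "\<exists>y\<in>P. q x = q y" if "x \<in> E" for x
      using *[OF that] that unfolding P_def by (intro bexI[of _ "SOME y. y \<in> E \<and> q y = q x"]) auto
  qed
qed

text \<open>The functions \<open>f x i\<close> serve as coordinates and \<open>Q k\<close> labels
  dyadic cubes of side \<open>(1/2)^k\<close>. \<open>P\<close> keeps one point of \<open>E\<close>
  per occupied cube of level \<open>N\<close>, so \<open>E\<close> may be any set. Cubes of level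
  \<open>\<kappa> z \<le> N\<close> that cover \<open>P\<close> cover \<open>E\<close>, because a
  level-\<open>N\<close> cube lies in one cube of each coarser level. The factor
  \<open>3 ^ card I\<close> arises because a set of spread \<rho> meets at most three intervals of
  comparable length in each coordinate.\<close>

lemma discrete_frostman:
  fixes f :: "'p \<Rightarrow> 'i \<Rightarrow> real" and N :: nat and t :: real
  assumes I: "finite I" and t: "t \<ge> 0"
    and f1: "\<forall>x\<in>E. \<forall>i\<in>I. \<bar>f x i\<bar> \<le> 1"
  shows "\<exists>P w X \<kappa>. finite P \<and> P \<subseteq> E \<and> (\<forall>x. 0 \<le> w x) \<and>
    (\<forall>A \<rho>. A \<subseteq> P \<longrightarrow> (1/2)^N \<le> \<rho> \<longrightarrow> (\<forall>x\<in>A. \<forall>y\<in>A. \<forall>i\<in>I. \<bar>f x i - f y i\<bar> \<le> \<rho>)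
       \<longrightarrow> sum w A \<le> 3 ^ card I * (2 * \<rho>) powr t) \<and>
    X \<subseteq> P \<and>
    (\<forall>x\<in>E. \<exists>z\<in>X. \<forall>i\<in>I. \<lfloor>2 ^ \<kappa> z * f x i\<rfloor> = \<lfloor>2 ^ \<kappa> z * f z i\<rfloor>) \<and>
    (\<Sum>z\<in>X. ((1/2) ^ \<kappa> z) powr t) = sum w P"
proof -
  have f: "\<bar>f x i\<bar> \<le> 1" if "x \<in> E" "i \<in> I" for x i using f1 that by blast
  define Q where "Q k x = restrict (\<lambda>i. \<lfloor>2 ^ k * f x i\<rfloor>) I" for k :: nat and x
  have Q_eq: "Q k x = Q k y \<longleftrightarrow> (\<forall>i\<in>I. \<lfloor>2 ^ k * f x i\<rfloor> = \<lfloor>2 ^ k * f y i\<rfloor>)" for k x y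
    unfolding Q_def fun_eq_iff restrict_def by auto
  have nest: "Q k x = Q k y" if "Q (Suc k) x = Q (Suc k) y" for k x y
    using that floor_double_eq unfolding Q_eq power_Suc mult.assoc by blast
  have "Q k ` E \<subseteq> (\<Pi>\<^sub>E i\<in>I. {-(2^k)..2^k})" for k
  proof
    fix q assume "q \<in> Q k ` E"
    then obtain x where x: "x \<in> E" "q = Q k x" by blast
    have "\<lfloor>2 ^ k * f x i\<rfloor> \<in> {-(2^k)..2^k}" if "i \<in> I" for i
    proof -
      have "\<bar>2 ^ k * f x i\<bar> \<le> 2 ^ k" using f[OF x(1) that] by (simp add: abs_mult)
      then have "-(2^k) \<le> 2 ^ k * f x i" "2 ^ k * f x i \<le> 2 ^ k" by linarith+
      then have "real_of_int (-(2^k)) \<le> 2 ^ k * f x i" "2 ^ k * f x i < real_of_int (2 ^ k) + 1"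
        unfolding of_int_minus of_int_power of_int_numeral by linarith+
      then show ?thesis by (simp only: atLeastAtMost_iff le_floor_iff floor_le_iff)
    qed
    then show "q \<in> (\<Pi>\<^sub>E i\<in>I. {-(2^k)..2^k})" using x by (auto simp: Q_def)
  qed
  then have finQ: "finite (Q k ` E)" for k
    by (rule finite_subset) (intro finite_PiE I, simp)
  obtain P where P: "finite P" "P \<subseteq> E" "\<And>x. x \<in> E \<Longrightarrow> \<exists>y\<in>P. Q N x = Q N y"
    using finite_representatives[OF finQ[of N]] by metis
  have refine: "Q l x = Q l y" if "Q k x = Q k y" "l \<le> k" for k l x y
    using that(2,1) by (induction k rule: dec_induct) (auto dest: nest)
  define c where "c k = ((1/2) ^ k) powr t" for k :: nat
  have c: "c k > 0" for k by (simp add: c_def)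
  obtain w X \<kappa> where w: "\<And>x. 0 \<le> w x"
    and bal: "\<And>k x. k \<le> N \<Longrightarrow> x \<in> P \<Longrightarrow> sum w {y\<in>P. Q k y = Q k x} \<le> c k"
    and X: "X \<subseteq> P" and \<kappa>: "\<And>x. x \<in> P \<Longrightarrow> \<kappa> x \<le> N"
    and cov: "\<And>y. y \<in> P \<Longrightarrow> \<exists>x\<in>X. Q (\<kappa> x) y = Q (\<kappa> x) x"
    and total: "(\<Sum>x\<in>X. c (\<kappa> x)) = sum w P"
    using discrete_frostman_tree_cover[of P Q c N, OF P(1) nest c] by blast
  have mass: "sum w A \<le> 3 ^ card I * (2 * \<rho>) powr t"
    if A: "A \<subseteq> P" and \<rho>: "(1/2)^N \<le> \<rho>"
      and diam: "\<And>x y i. x \<in> A \<Longrightarrow> y \<in> A \<Longrightarrow> i \<in> I \<Longrightarrow> \<bar>f x i - f y i\<bar> \<le> \<rho>" for A \<rho>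
  proof -
    have \<rho>0: "\<rho> > 0" using \<rho> by (smt (verit) half_gt_zero_iff zero_less_power)
    \<comment> \<open>The coarsest level with side at most 2 \<rho>. Unless it is level 0, the
      preceding level has side above 2 \<rho>, so this one has side above \<rho>.\<close>
    have "\<exists>k\<le>N. (1/2)^k \<le> 2 * \<rho> \<and> (\<forall>x\<in>A. \<forall>y\<in>A. \<forall>i\<in>I. \<bar>2 ^ k * f x i - 2 ^ k * f y i\<bar> \<le> 1 \<or> k = 0)"
    proof -
      define k where "k = (LEAST k. (1/2)^k \<le> 2 * \<rho>)"
      have kN: "k \<le> N" unfolding k_def using \<rho> \<rho>0 by (intro Least_le) linarith
      have k1: "(1/2)^k \<le> 2 * \<rho>" unfolding k_def by (rule LeastI[of _ N]) (use \<rho> \<rho>0 in linarith)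
      have "\<bar>2 ^ k * f x i - 2 ^ k * f y i\<bar> \<le> 1" if xyi: "x \<in> A" "y \<in> A" "i \<in> I" and k0: "k \<noteq> 0" for x y i
      proof -
        obtain j where j: "k = Suc j" using k0 not0_implies_Suc by blast
        then have "\<not> (1/2)^j \<le> 2 * \<rho>" using not_less_Least[of j "\<lambda>k. (1/2)^k \<le> 2 * \<rho>"] by (simp add: k_def)
        then have "\<rho> * 2 ^ k \<le> 1" by (simp add: j field_simps)
        then have "2 ^ k * \<bar>f x i - f y i\<bar> \<le> 1" using diam[OF xyi]
          by (smt (verit) mult.commute mult_left_mono zero_less_power)
        then show ?thesis by (metis abs_mult abs_numeral power_abs right_diff_distrib)
      qed
      with kN k1 show ?thesis by (intro exI[of _ k]) blast
    qed
    then obtain k where k: "k \<le> N" "(1/2)^k \<le> 2 * \<rho>"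
      "\<And>x y i. x \<in> A \<Longrightarrow> y \<in> A \<Longrightarrow> i \<in> I \<Longrightarrow> \<bar>2 ^ k * f x i - 2 ^ k * f y i\<bar> \<le> 1 \<or> k = 0" by blast
    have "\<exists>T. \<forall>x\<in>A. \<forall>i\<in>I. \<lfloor>2 ^ k * f x i\<rfloor> \<in> {T i - 1..T i + 1 :: int}"
    proof (cases "A = {} \<or> k = 0")
      case False
      then obtain x0 where "x0 \<in> A" by blast
      then show ?thesis using k(3) False
        by (intro exI[of _ "\<lambda>i. \<lfloor>2 ^ k * f x0 i\<rfloor>"] ballI floor_diff_le_1) blast
    next
      \<comment> \<open>At level 0 the spread \<rho> may be large, but the coordinates lie between
        -1 and 1, so their floors take only the values -1, 0, 1.\<close>
      case True
      show ?thesis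
      proof (intro exI[of _ "\<lambda>_. 0"] ballI)
        fix x i assume "x \<in> A" "i \<in> I"
        then have "\<bar>f x i\<bar> \<le> 1" "k = 0" using f A P(2) True by blast+
        then show "\<lfloor>2 ^ k * f x i\<rfloor> \<in> {0 - 1..0 + 1}"
          by (auto simp: le_floor_iff floor_le_iff)
      qed
    qed
    then obtain T where T: "\<And>x i. x \<in> A \<Longrightarrow> i \<in> I \<Longrightarrow> \<lfloor>2 ^ k * f x i\<rfloor> \<in> {T i - 1..T i + 1 :: int}" by blast
    define B where "B = (\<Pi>\<^sub>E i\<in>I. {T i - 1..T i + 1 :: int})"
    have finB: "finite B" unfolding B_def by (intro finite_PiE I) simp
    have cardB: "card B = 3 ^ card I" unfolding B_def by (simp add: card_PiE[OF I])
    have QB: "Q k ` A \<subseteq> B"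
      using T unfolding Q_def B_def by (auto simp: PiE_iff)
    have Afin: "finite A" using A P(1) by (rule finite_subset)
    have "sum w A = (\<Sum>q\<in>Q k ` A. sum w {x\<in>A. Q k x = q})"
      using Afin by (rule sum.image_gen)
    also have "\<dots> \<le> (\<Sum>q\<in>Q k ` A. c k)"
    proof (rule sum_mono)
      fix q assume "q \<in> Q k ` A"
      then obtain x where x: "x \<in> A" "q = Q k x" by blast
      have "sum w {y\<in>A. Q k y = q} \<le> sum w {y\<in>P. Q k y = Q k x}"
        using A x P(1) w by (intro sum_mono2) auto
      also have "\<dots> \<le> c k" using bal[OF k(1)] x A by blast
      finally show "sum w {y\<in>A. Q k y = q} \<le> c k" .
    qed
    also have "\<dots> = card (Q k ` A) * c k" by simp
    also have "\<dots> \<le> 3 ^ card I * c k"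
      using card_mono[OF finB QB] cardB c[of k] by (intro mult_right_mono) (auto simp flip: of_nat_power)
    also have "\<dots> \<le> 3 ^ card I * (2 * \<rho>) powr t"
      unfolding c_def using k(2) t by (intro mult_left_mono powr_mono2) auto
    finally show ?thesis .
  qed
  have covE: "\<exists>z\<in>X. \<forall>i\<in>I. \<lfloor>2 ^ \<kappa> z * f x i\<rfloor> = \<lfloor>2 ^ \<kappa> z * f z i\<rfloor>" if "x \<in> E" for x
  proof -
    obtain y where y: "y \<in> P" "Q N x = Q N y" using P(3)[OF \<open>x \<in> E\<close>] by blast
    obtain z where z: "z \<in> X" "Q (\<kappa> z) y = Q (\<kappa> z) z" using cov[OF y(1)] by blast
    have "Q (\<kappa> z) x = Q (\<kappa> z) z" using refine[OF y(2) \<kappa>] z X by (metis subsetD)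
    then show ?thesis using z(1) unfolding Q_eq by blast
  qed
  show ?thesis
    using P(1,2) w mass X covE total
    by (intro exI[of _ P] exI[of _ w] exI[of _ X] exI[of _ \<kappa>]) (simp add: c_def)
qed

subsection \<open>Subspaces as graphs\<close>

lemma norm_inner_expansion:
  fixes B :: "'a::euclidean_space set"
  assumes "pairwise orthogonal B" "\<And>b. b \<in> B \<Longrightarrow> norm b = 1" "finite B" "span B = UNIV"
  shows "x = (\<Sum>b\<in>B. (x \<bullet> b) *\<^sub>R b)" and "norm x \<le> (\<Sum>b\<in>B. \<bar>x \<bullet> b\<bar>)"
proof -
  have io: "b \<bullet> c = (if b = c then 1 else 0)" if "b \<in> B" "c \<in> B" for b c
    using assms(1,2) that by (auto simp: pairwise_def orthogonal_def norm_eq_1)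
  have "x \<in> span B" using assms(4) by simp
  then obtain u where u: "x = (\<Sum>b\<in>B. u b *\<^sub>R b)" using span_finite[OF assms(3)] by auto
  have "x \<bullet> b = u b" if "b \<in> B" for b
  proof -
    have "x \<bullet> b = (\<Sum>c\<in>B. u c * (c \<bullet> b))" by (simp add: u inner_sum_left)
    also have "\<dots> = (\<Sum>c\<in>B. if c = b then u c else 0)" using io that by (intro sum.cong) auto
    also have "\<dots> = u b" using that assms(3) by simp
    finally show ?thesis .
  qed
  then show "x = (\<Sum>b\<in>B. (x \<bullet> b) *\<^sub>R b)" using u by simp
  then have "norm x \<le> (\<Sum>b\<in>B. norm ((x \<bullet> b) *\<^sub>R b))" by (metis norm_sum)
  also have "\<dots> = (\<Sum>b\<in>B. \<bar>x \<bullet> b\<bar>)" using assms(2) by (intro sum.cong) auto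
  finally show "norm x \<le> (\<Sum>b\<in>B. \<bar>x \<bullet> b\<bar>)" .
qed

text \<open>Gaussian elimination with complete pivoting keeps the entries bounded uniformly in \<open>V\<close> and \<open>B\<close>.\<close>
lemma subspace_graph_basis:
  fixes B :: "'a::euclidean_space set"
  assumes B: "finite B" "span B = UNIV"
    and "subspace V" "dim V = m"
  shows "\<exists>I v. I \<subseteq> B \<and> card I = m \<and>
     (\<forall>i\<in>I. v i \<in> V \<and> (\<forall>j\<in>I. v i \<bullet> j = (if i = j then 1 else 0)) \<and> (\<forall>b\<in>B. \<bar>v i \<bullet> b\<bar> \<le> fact m)) \<and>
     (\<forall>x\<in>V. x = (\<Sum>i\<in>I. (x \<bullet> i) *\<^sub>R v i))"
  using assms(3,4)
proof (induction m arbitrary: V)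
  case 0
  then have "V \<subseteq> {0}" by (simp add: dim_eq_0)
  then show ?case by (intro exI[of _ "{}"]) auto
next
  case (Suc m)
  have "\<not> V \<subseteq> {0}" using Suc.prems(2) by (metis dim_eq_0 nat.distinct(1))
  then obtain u0 where u0: "u0 \<in> V" "u0 \<noteq> 0" by blast
  have "B \<noteq> {}" using B(2) u0(2) by force
  then have "Max ((\<lambda>b. \<bar>u0 \<bullet> b\<bar>) ` B) \<in> (\<lambda>b. \<bar>u0 \<bullet> b\<bar>) ` B" using B(1) by (intro Max_in) auto
  then obtain j where j0: "j \<in> B" "Max ((\<lambda>b. \<bar>u0 \<bullet> b\<bar>) ` B) = \<bar>u0 \<bullet> j\<bar>" by blast
  have j: "j \<in> B" "\<And>b. b \<in> B \<Longrightarrow> \<bar>u0 \<bullet> b\<bar> \<le> \<bar>u0 \<bullet> j\<bar>"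
    using j0 B(1) Max_ge[of "(\<lambda>b. \<bar>u0 \<bullet> b\<bar>) ` B"] by auto
  have "u0 \<bullet> j \<noteq> 0"
  proof
    assume "u0 \<bullet> j = 0"
    then have "\<And>b. b \<in> B \<Longrightarrow> orthogonal u0 b" using j(2) by (force simp: orthogonal_def)
    then have "orthogonal u0 u0" using orthogonal_to_span[of u0 B u0] B(2) by (metis UNIV_I orthogonal_commute)
    then show False using u0(2) by (simp add: orthogonal_def)
  qed
  define u where "u = (1 / (u0 \<bullet> j)) *\<^sub>R u0"
  have u: "u \<in> V" "u \<bullet> j = 1" "\<And>b. b \<in> B \<Longrightarrow> \<bar>u \<bullet> b\<bar> \<le> 1"
    using u0 j(2) \<open>u0 \<bullet> j \<noteq> 0\<close> Suc.prems(1) by (auto simp: u_def subspace_scale abs_divide)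
  \<comment> \<open>Since \<open>u \<bullet> j = 1\<close>, this drops exactly one dimension, and
    every vector supplied by the induction hypothesis has entry 0 at the new pivot
    \<open>j\<close>.\<close>
  define V' where "V' = {x \<in> V. x \<bullet> j = 0}"
  have V': "subspace V'" using Suc.prems(1) unfolding V'_def subspace_def by (auto simp: inner_left_distrib)
  have red: "x - (x \<bullet> j) *\<^sub>R u \<in> V'" if "x \<in> V" for x
    using that u Suc.prems(1) by (auto simp: V'_def subspace_diff subspace_scale inner_diff_left)
  have "V = span (insert u V')"
  proof
    show "V \<subseteq> span (insert u V')"
    proof
      fix x assume "x \<in> V"
      then have "x - (x \<bullet> j) *\<^sub>R u \<in> span (insert u V')" using red by (simp add: span_base)
      moreover have "(x \<bullet> j) *\<^sub>R u \<in> span (insert u V')" by (simp add: span_base span_scale)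
      ultimately show "x \<in> span (insert u V')" by (metis diff_add_cancel span_add)
    qed
    show "span (insert u V') \<subseteq> V" using u(1) Suc.prems(1) by (intro span_minimal) (auto simp: V'_def)
  qed
  moreover have "u \<notin> span V'"
  proof -
    have "span V' = V'" using V' by (simp only: span_eq_iff)
    moreover have "u \<notin> V'" using u(2) by (simp add: V'_def)
    ultimately show ?thesis by metis
  qed
  ultimately have "Suc m = dim V' + 1" using Suc.prems(2) dim_insert[of u V'] by (metis dim_span)
  then have "dim V' = m" by simp
  from Suc.IH[OF V' this] obtain I v where I: "I \<subseteq> B" "card I = m"
    and v: "\<And>i. i \<in> I \<Longrightarrow> v i \<in> V'" "\<And>i k. i \<in> I \<Longrightarrow> k \<in> I \<Longrightarrow> v i \<bullet> k = (if i = k then 1 else 0)"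
      "\<And>i b. i \<in> I \<Longrightarrow> b \<in> B \<Longrightarrow> \<bar>v i \<bullet> b\<bar> \<le> fact m"
    and span: "\<And>x. x \<in> V' \<Longrightarrow> x = (\<Sum>i\<in>I. (x \<bullet> i) *\<^sub>R v i)"
    by blast
  have finI: "finite I" using I(1) B(1) by (rule finite_subset)
  have vj: "v i \<bullet> j = 0" if "i \<in> I" for i using v(1)[OF that] by (simp add: V'_def)
  have jI: "j \<notin> I" using v(2)[of j j] vj[of j] by auto
  \<comment> \<open>Clears the entries of \<open>u\<close> at the old pivots; the entry 1 at
    \<open>j\<close> is not disturbed because each \<open>v i\<close> vanishes there.\<close>
  define w where "w = u - (\<Sum>i\<in>I. (u \<bullet> i) *\<^sub>R v i)"
  have wV: "w \<in> V" unfolding w_def using u(1) v(1) Suc.prems(1)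
    by (intro subspace_diff subspace_sum subspace_scale) (auto simp: V'_def)
  have wj: "w \<bullet> j = 1" using u(2) vj by (simp add: w_def inner_diff_left inner_sum_left)
  have wI: "w \<bullet> k = 0" if "k \<in> I" for k
  proof -
    have "(\<Sum>i\<in>I. (u \<bullet> i) * (v i \<bullet> k)) = (\<Sum>i\<in>I. if i = k then u \<bullet> i else 0)"
      using v(2) that by (intro sum.cong) auto
    then show ?thesis using finI that by (simp add: w_def inner_diff_left inner_sum_left)
  qed
  have fact1: "(fact m :: real) \<ge> 1" by (simp add: fact_ge_1)
  have wB: "\<bar>w \<bullet> b\<bar> \<le> fact (Suc m)" if "b \<in> B" for b
  proof -
    have "\<bar>w \<bullet> b\<bar> \<le> \<bar>u \<bullet> b\<bar> + (\<Sum>i\<in>I. \<bar>u \<bullet> i\<bar> * \<bar>v i \<bullet> b\<bar>)"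
      unfolding w_def inner_diff_left inner_sum_left inner_scaleR_left
      by (rule order_trans[OF abs_triangle_ineq4]) (simp add: order_trans[OF sum_abs] abs_mult flip: abs_mult)
    \<comment> \<open>Complete pivoting bounds every entry of \<open>u\<close> by 1. The recursion 1
      + m m! \<le> (m + 1)! is the origin of the factorial bound.\<close>
    also have "\<dots> \<le> 1 + (\<Sum>i\<in>I. 1 * fact m)"
      using u(3) that v(3) I(1) by (intro add_mono sum_mono mult_mono) auto
    also have "\<dots> \<le> fact (Suc m)" using I(2) fact1 by (simp add: algebra_simps)
    finally show ?thesis .
  qed
  have fact_mono': "(fact m :: real) \<le> fact (Suc m)" by (intro fact_mono) simp
  define v' where "v' = v(j := w)"
  have "v' i \<in> V \<and> (\<forall>k\<in>insert j I. v' i \<bullet> k = (if i = k then 1 else 0)) \<and> (\<forall>b\<in>B. \<bar>v' i \<bullet> b\<bar> \<le> fact (Suc m))"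
    if "i \<in> insert j I" for i
  proof (cases "i = j")
    case True
    then show ?thesis using wV wj wI wB jI by (auto simp: v'_def simp del: fact_Suc)
  next
    case False
    then have "i \<in> I" using that by simp
    then have "\<forall>b\<in>B. \<bar>v i \<bullet> b\<bar> \<le> fact (Suc m)" using v(3) fact_mono' order_trans by blast
    then show ?thesis using \<open>i \<in> I\<close> False v(1,2) vj by (auto simp: v'_def V'_def simp del: fact_Suc)
  qed
  moreover have "x = (\<Sum>i\<in>insert j I. (x \<bullet> i) *\<^sub>R v' i)" if "x \<in> V" for x
  proof -
    let ?y = "x - (x \<bullet> j) *\<^sub>R u"
    have "?y = (\<Sum>i\<in>I. (?y \<bullet> i) *\<^sub>R v i)" using span[OF red[OF that]] .
    also have "\<dots> = (\<Sum>i\<in>I. (x \<bullet> i) *\<^sub>R v i) - (x \<bullet> j) *\<^sub>R (\<Sum>i\<in>I. (u \<bullet> i) *\<^sub>R v i)"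
      by (simp add: inner_diff_left scaleR_diff_left sum_subtractf scaleR_sum_right)
    finally have "x = (x \<bullet> j) *\<^sub>R w + (\<Sum>i\<in>I. (x \<bullet> i) *\<^sub>R v i)"
      by (simp add: w_def scaleR_diff_right algebra_simps)
    also have "(\<Sum>i\<in>I. (x \<bullet> i) *\<^sub>R v i) = (\<Sum>i\<in>I. (x \<bullet> i) *\<^sub>R v' i)"
      using jI by (intro sum.cong) (auto simp: v'_def)
    finally show ?thesis using jI finI by (simp add: v'_def)
  qed
  moreover have "insert j I \<subseteq> B" "card (insert j I) = Suc m" using j(1) I jI finI by auto
  ultimately show ?case by (intro exI[of _ "insert j I"] exI[of _ v']) blast
qed

lemma norm_orth_proj_le:
  fixes V :: "'a::euclidean_space set"
  assumes "subspace V" shows "norm (orth_proj V x) \<le> norm x"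
proof -
  have "(x - orth_proj V x) \<bullet> orth_proj V x = 0"
    using orth_proj[OF assms] by (simp add: orthogonal_def)
  then have "(norm (orth_proj V x))\<^sup>2 = x \<bullet> orth_proj V x" by (simp add: inner_diff_left power2_norm_eq_inner)
  also have "\<dots> \<le> norm x * norm (orth_proj V x)" by (rule norm_cauchy_schwarz)
  finally show ?thesis by (simp add: power2_eq_square) (metis mult_right_le_imp_le norm_le_zero_iff norm_ge_zero order_le_less)
qed

lemma norm_diff_orth_proj_le:
  fixes V :: "'a::euclidean_space set"
  assumes "subspace V" "y \<in> V"
  shows "norm (x - orth_proj V x) \<le> norm (x - y)"
proof -
  have "orthogonal (x - orth_proj V x) (orth_proj V x - y)"
    using orth_proj[OF assms(1)] assms(2) by (simp add: assms(1) subspace_diff)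
  then have "(norm (x - y))\<^sup>2 = (norm (x - orth_proj V x))\<^sup>2 + (norm (orth_proj V x - y))\<^sup>2"
    using norm_add_Pythagorean[of "x - orth_proj V x" "orth_proj V x - y"] by simp
  then show ?thesis by (metis norm_ge_zero power2_le_imp_le le_add_same_cancel1 zero_le_power2)
qed

text \<open>Split x into p in V and z orthogonal to V. The first approximation hypothesis says that
  projecting p onto W moves it little. The second makes the projection q of z onto W short, because
  q is close to a vector of V and z is orthogonal to V. Each half contributes one \<eta>.\<close>

lemma orth_proj_close:
  fixes V W :: "'a::euclidean_space set"
  assumes V: "subspace V" and W: "subspace W"
    and "\<eta> \<ge> 0"
    and VW: "\<And>v. v \<in> V \<Longrightarrow> \<exists>w\<in>W. norm (v - w) \<le> \<eta> * norm v"
    and WV: "\<And>w. w \<in> W \<Longrightarrow> \<exists>v\<in>V. norm (w - v) \<le> \<eta> * norm w"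
  shows "norm (orth_proj V x - orth_proj W x) \<le> 2 * \<eta> * norm x"
proof -
  have lin: "linear (orth_proj U)" if "subspace U" for U :: "'a set"
    using bounded_linear_orth_proj[OF that] by (rule bounded_linear.linear)
  let ?p = "orth_proj V x" let ?z = "x - orth_proj V x"
  obtain w where "w \<in> W" "norm (?p - w) \<le> \<eta> * norm ?p" using VW orth_proj(1)[OF V] by blast
  then have 1: "norm (?p - orth_proj W ?p) \<le> \<eta> * norm ?p"
    using norm_diff_orth_proj_le[OF W] order_trans by blast
  let ?q = "orth_proj W ?z"
  obtain v where v: "v \<in> V" "norm (?q - v) \<le> \<eta> * norm ?q" using WV orth_proj(1)[OF W] by blast
  have "?z \<bullet> v = 0" "(?z - ?q) \<bullet> ?q = 0" using orth_proj[OF V] orth_proj[OF W] v(1) by (auto simp: orthogonal_def)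
  then have "(norm ?q)\<^sup>2 = ?z \<bullet> (?q - v)" by (simp add: inner_diff_left inner_diff_right power2_norm_eq_inner)
  also have "\<dots> \<le> norm ?z * (\<eta> * norm ?q)"
    using norm_cauchy_schwarz[of ?z "?q - v"] v(2) by (meson mult_left_mono norm_ge_zero order_trans)
  finally have "norm ?q * norm ?q \<le> (\<eta> * norm ?z) * norm ?q" by (simp add: power2_eq_square mult_ac)
  then have 2: "norm ?q \<le> \<eta> * norm ?z"
    using assms(3) by (metis mult_nonneg_nonneg mult_right_le_imp_le norm_ge_zero order_le_less)
  have "norm ?z \<le> norm x" using norm_diff_orth_proj_le[OF V, of 0 x] subspace_0[OF V] by simp
  then have "norm (?p - orth_proj W ?p) \<le> \<eta> * norm x" "norm ?q \<le> \<eta> * norm x"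
    using 1 2 assms(3) norm_orth_proj_le[OF V, of x] by (meson mult_left_mono order_trans)+
  moreover have "orth_proj W x = orth_proj W ?p + ?q"
    by (simp flip: linear_add[OF lin[OF W]])
  then have "orth_proj V x - orth_proj W x = (?p - orth_proj W ?p) - ?q" by simp
  then have "norm (orth_proj V x - orth_proj W x) \<le> norm (?p - orth_proj W ?p) + norm ?q"
    by (metis norm_triangle_ineq4)
  ultimately show ?thesis by linarith
qed

text \<open>Both subspaces are graphs over the same pivots \<open>I\<close>, so a vector of one has
  a partner in the other with the same pivot coordinates. The partners differ by at most
  \<open>card I \<le> n\<close> terms, each containing some \<open>v i - w i\<close> of norm at most
  \<open>n * \<sigma>\<close>; this gives the factor \<open>n ^ 2\<close>.\<close>

lemma graph_basis_orth_proj_close: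
  fixes V W B :: "'a::euclidean_space set" and v w :: "'a \<Rightarrow> 'a"
  assumes B: "pairwise orthogonal B" "\<And>b. b \<in> B \<Longrightarrow> norm b = 1" "finite B" "span B = UNIV"
    and card: "card B = n" and "I \<subseteq> B" "\<sigma> \<ge> 0" and sub: "subspace V" "subspace W"
    and v: "\<And>i. i \<in> I \<Longrightarrow> v i \<in> V" "\<And>i j. i \<in> I \<Longrightarrow> j \<in> I \<Longrightarrow> v i \<bullet> j = (if i = j then 1 else 0)"
      "\<And>x. x \<in> V \<Longrightarrow> x = (\<Sum>i\<in>I. (x \<bullet> i) *\<^sub>R v i)"
    and w: "\<And>i. i \<in> I \<Longrightarrow> w i \<in> W" "\<And>i j. i \<in> I \<Longrightarrow> j \<in> I \<Longrightarrow> w i \<bullet> j = (if i = j then 1 else 0)"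
      "\<And>x. x \<in> W \<Longrightarrow> x = (\<Sum>i\<in>I. (x \<bullet> i) *\<^sub>R w i)"
    and close: "\<And>i b. i \<in> I \<Longrightarrow> b \<in> B - I \<Longrightarrow> \<bar>v i \<bullet> b - w i \<bullet> b\<bar> \<le> \<sigma>"
  shows "norm (orth_proj V x - orth_proj W x) \<le> 2 * (real n ^ 2 * \<sigma>) * norm x"
proof -
  have cardI: "card I \<le> n" using assms card_mono by metis
  have vw: "norm (v i - w i) \<le> n * \<sigma>" if "i \<in> I" for i
  proof -
    have "norm (v i - w i) \<le> (\<Sum>b\<in>B. \<bar>(v i - w i) \<bullet> b\<bar>)"
      by (rule norm_inner_expansion(2)[OF B])
    also have "\<dots> \<le> (\<Sum>b\<in>B. \<sigma>)"
      using close[OF that] v(2)[OF that] w(2)[OF that] \<open>\<sigma> \<ge> 0\<close>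
      by (intro sum_mono) (force simp: inner_diff_left)
    finally show ?thesis by (simp add: card)
  qed
  \<comment> \<open>Stated for arbitrary \<open>v\<close>, \<open>w\<close> and \<open>W\<close>
    because it is applied in both directions.\<close>
  have key: "\<exists>y'\<in>W. norm (y - y') \<le> (real n ^ 2 * \<sigma>) * norm y"
    if "y = (\<Sum>i\<in>I. (y \<bullet> i) *\<^sub>R v i)" "\<And>i. i \<in> I \<Longrightarrow> w i \<in> W"
       "\<And>i. i \<in> I \<Longrightarrow> norm (v i - w i) \<le> n * \<sigma>" "subspace W"
    for y v w and W :: "'a set"
  proof (rule bexI[of _ "\<Sum>i\<in>I. (y \<bullet> i) *\<^sub>R w i"])
    have "y - (\<Sum>i\<in>I. (y \<bullet> i) *\<^sub>R w i) = (\<Sum>i\<in>I. (y \<bullet> i) *\<^sub>R (v i - w i))"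
      using that(1) by (simp add: scaleR_diff_right sum_subtractf)
    then have "norm (y - (\<Sum>i\<in>I. (y \<bullet> i) *\<^sub>R w i)) \<le> (\<Sum>i\<in>I. norm ((y \<bullet> i) *\<^sub>R (v i - w i)))"
      by (metis norm_sum)
    also have "\<dots> \<le> (\<Sum>i\<in>I. norm y * (n * \<sigma>))"
    proof (rule sum_mono)
      fix i assume i: "i \<in> I"
      have "\<bar>y \<bullet> i\<bar> \<le> norm y" using Cauchy_Schwarz_ineq2[of y i] B(2)[of i] i \<open>I \<subseteq> B\<close> by auto
      then show "norm ((y \<bullet> i) *\<^sub>R (v i - w i)) \<le> norm y * (n * \<sigma>)"
        using that(3)[OF i] by (simp add: mult_mono)
    qed
    also have "\<dots> = card I * (norm y * (n * \<sigma>))" by simp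
    also have "\<dots> \<le> n * (norm y * (n * \<sigma>))"
      using cardI \<open>\<sigma> \<ge> 0\<close> by (intro mult_right_mono) auto
    finally show "norm (y - (\<Sum>i\<in>I. (y \<bullet> i) *\<^sub>R w i)) \<le> (real n ^ 2 * \<sigma>) * norm y"
      by (simp add: power2_eq_square mult_ac)
    show "(\<Sum>i\<in>I. (y \<bullet> i) *\<^sub>R w i) \<in> W"
      using that(2,4) by (intro subspace_sum subspace_scale) auto
  qed
  show ?thesis
  proof (rule orth_proj_close[OF sub])
    show "0 \<le> (real n)\<^sup>2 * \<sigma>" using \<open>\<sigma> \<ge> 0\<close> by simp
    show "\<exists>y'\<in>W. norm (y - y') \<le> (real n)\<^sup>2 * \<sigma> * norm y" if "y \<in> V" for y
      using v(3)[OF that] w(1) vw sub(2) by (rule key)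
    show "\<exists>y'\<in>V. norm (y - y') \<le> (real n)\<^sup>2 * \<sigma> * norm y" if "y \<in> W" for y
      using w(3)[OF that] v(1) vw sub(1) by (intro key[of y w v V]) (simp_all add: norm_minus_commute)
  qed
qed

text \<open>A label holds one row for each of the m pivots. A row has n - m free entries: the one at
  \<open>e\<close>, with 2 J + 1 values, and n - 1 - m others with 2 L + 1 values. As
  \<open>J\<close> will be independent of the scale while \<open>L\<close> grows like 1 / \<rho>,
  the exponent m (n - 1 - m) comes from here.\<close>

lemma card_graph_labels:
  fixes B :: "'b set" and J L :: nat
  assumes B: "finite B" "card B = n" "e \<in> B" and I: "I \<subseteq> B - {e}" "card I = m" and "m < n"
  shows "card (\<Pi>\<^sub>E p\<in>I \<times> (B - I). if snd p = e then {-int J..int J} else {-int L..int L})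
     = ((2 * J + 1) * (2 * L + 1) ^ (n - 1 - m)) ^ m"
proof -
  have fin: "finite I" "finite (B - I)" using I(1) B(1) by (auto intro: finite_subset)
  have BI: "B - I = insert e (B - I - {e})" using B(3) I(1) by auto
  have "I \<subseteq> B" using I(1) by blast
  then have cBI: "card (B - I - {e}) = n - 1 - m"
    using B I fin by (subst card_Diff_singleton) (auto simp: card_Diff_subset)
  have "card (\<Pi>\<^sub>E p\<in>I \<times> (B - I). if snd p = e then {-int J..int J} else {-int L..int L})
     = (\<Prod>p\<in>I \<times> (B - I). card (if snd p = e then {-int J..int J} else {-int L..int L}))"
    using fin by (intro card_PiE) auto
  also have "\<dots> = (\<Prod>i\<in>I. \<Prod>b\<in>B - I. card (if b = e then {-int J..int J} else {-int L..int L}))"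
    by (simp add: prod.cartesian_product')
  also have "(\<Prod>b\<in>B - I. card (if b = e then {-int J..int J} else {-int L..int L}))
     = (2 * J + 1) * (\<Prod>b\<in>B - I - {e}. card (if b = e then {-int J..int J} else {-int L..int L}))"
    by (subst BI, subst prod.insert) (use fin in \<open>auto simp: nat_add_distrib nat_mult_distrib\<close>)
  also have "(\<Prod>b\<in>B - I - {e}. card (if b = e then {-int J..int J} else {-int L..int L}))
     = (\<Prod>b\<in>B - I - {e}. 2 * L + 1)"
    by (intro prod.cong) auto
  also have "\<dots> = (2 * L + 1) ^ (n - 1 - m)" by (simp add: cBI)
  finally show ?thesis by (simp add: I(2))
qed

text \<open>In an orthonormal basis containing e, the planes are sorted by their pivot set and by
  their graph entries rounded to a mesh \<sigma> proportional to \<rho>. Near-orthogonality to e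
  confines the e-entries to an interval of length comparable to \<rho>, hence to boundedly many mesh
  values. The other entries are only bounded by \<open>K\<close>. The factor \<open>2 ^ n\<close> in
  \<open>C\<close> counts pivot sets.\<close>

lemma grassmannian_slab_cover:
  assumes "m < DIM('a::euclidean_space)"
  shows "\<exists>C>0. \<exists>\<rho>0>0. \<forall>(e::'a) \<rho>. norm e = 1 \<longrightarrow> 0 < \<rho> \<longrightarrow> \<rho> < \<rho>0 \<longrightarrow>
    (\<exists>\<A>. finite \<A> \<and> real (card \<A>) \<le> C * (1 / \<rho>) ^ (m * (DIM('a) - 1 - m)) \<and>
       {V \<in> grassmannian m. norm (orth_proj V e) \<le> \<rho>} \<subseteq> \<Union>\<A> \<and>
       (\<forall>A\<in>\<A>. \<forall>V\<in>A. \<forall>W\<in>A. \<forall>x. norm (orth_proj V x - orth_proj W x) \<le> \<rho> * norm x))"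
proof -
  define n where "n = DIM('a)"
  define K :: real where "K = fact m"
  \<comment> \<open>This is (n K \<rho>) / \<sigma>, the bound on an e-entry measured in mesh
    widths; \<rho> cancels.\<close>
  define J where "J = nat \<lceil>2 * real n ^ 3 * K\<rceil>"
  define C1 where "C1 = 4 * real n ^ 2 * K + 3"
  define C where "C = 2 ^ n * (real (2 * J + 1) * C1 ^ (n - 1 - m)) ^ m"
  \<comment> \<open>Below this width e cannot be a pivot: a pivot entry equals 1, but e-entries are
    at most n K \<rho> < 1.\<close>
  define \<rho>0 where "\<rho>0 = 1 / (real n * K)"
  have n0: "n > 0" using assms n_def by simp
  have K1: "K \<ge> 1" by (simp add: K_def fact_ge_1)
  have nK: "real n * K \<ge> 1" using n0 K1 mult_mono[of 1 "real n" 1 K] by simp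
  have C1: "C1 > 0" using K1 by (simp add: C1_def add_nonneg_pos)
  have "C > 0" using C1 by (simp add: C_def)
  moreover have "\<rho>0 > 0" using nK by (simp add: \<rho>0_def)
  moreover have "\<exists>\<A>. finite \<A> \<and> real (card \<A>) \<le> C * (1 / \<rho>) ^ (m * (n - 1 - m)) \<and>
       {V \<in> grassmannian m. norm (orth_proj V e) \<le> \<rho>} \<subseteq> \<Union>\<A> \<and>
       (\<forall>A\<in>\<A>. \<forall>V\<in>A. \<forall>W\<in>A. \<forall>x. norm (orth_proj V x - orth_proj W x) \<le> \<rho> * norm x)"
    if e: "norm e = 1" and \<rho>: "0 < \<rho>" "\<rho> < \<rho>0" for e :: 'a and \<rho>
  proof -
    have \<rho>1: "\<rho> < 1" "real n * K * \<rho> < 1" 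
    proof -
      have "\<rho>0 \<le> 1" using nK by (simp add: \<rho>0_def divide_le_eq)
      then show "\<rho> < 1" using \<rho> by simp
      have "real n * K * \<rho> < real n * K * \<rho>0" using \<rho> nK by (intro mult_strict_left_mono) auto
      then show "real n * K * \<rho> < 1" using n0 K1 by (simp add: \<rho>0_def)
    qed
    obtain B where B: "pairwise orthogonal B" "\<And>b. b \<in> B \<Longrightarrow> norm b = 1" "span B = UNIV" "card B = n" "e \<in> B"
      "finite B"
      using vector_in_orthonormal_basis[OF e] unfolding n_def
      by (metis card.infinite n_def n0 less_irrefl)
    define S where "S = {V :: 'a set. V \<in> grassmannian m \<and> norm (orth_proj V e) \<le> \<rho>}"
    have "\<forall>V\<in>S. \<exists>Iv. fst Iv \<subseteq> B \<and> card (fst Iv) = m \<and>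
     (\<forall>i\<in>fst Iv. snd Iv i \<in> V \<and> (\<forall>j\<in>fst Iv. snd Iv i \<bullet> j = (if i = j then 1 else 0)) \<and> (\<forall>b\<in>B. \<bar>snd Iv i \<bullet> b\<bar> \<le> K)) \<and>
     (\<forall>x\<in>V. x = (\<Sum>i\<in>fst Iv. (x \<bullet> i) *\<^sub>R snd Iv i))"
    proof
      fix V assume "V \<in> S"
      then have "subspace V" "dim V = m" by (auto simp: S_def grassmannian_def)
      from subspace_graph_basis[OF B(6,3) this] show "\<exists>Iv. fst Iv \<subseteq> B \<and> card (fst Iv) = m \<and>
         (\<forall>i\<in>fst Iv. snd Iv i \<in> V \<and> (\<forall>j\<in>fst Iv. snd Iv i \<bullet> j = (if i = j then 1 else 0)) \<and> (\<forall>b\<in>B. \<bar>snd Iv i \<bullet> b\<bar> \<le> K)) \<and>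
         (\<forall>x\<in>V. x = (\<Sum>i\<in>fst Iv. (x \<bullet> i) *\<^sub>R snd Iv i))"
        unfolding K_def by auto
    qed
    from bchoice[OF this] obtain g where g: "\<forall>V\<in>S. fst (g V) \<subseteq> B \<and> card (fst (g V)) = m \<and>
     (\<forall>i\<in>fst (g V). snd (g V) i \<in> V \<and> (\<forall>j\<in>fst (g V). snd (g V) i \<bullet> j = (if i = j then 1 else 0)) \<and> (\<forall>b\<in>B. \<bar>snd (g V) i \<bullet> b\<bar> \<le> K)) \<and>
     (\<forall>x\<in>V. x = (\<Sum>i\<in>fst (g V). (x \<bullet> i) *\<^sub>R snd (g V) i))" ..
    define I v where "I V = fst (g V)" and "v V = snd (g V)" for V
    have I: "I V \<subseteq> B" "card (I V) = m" if "V \<in> S" for V using g that by (auto simp: I_def)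
    have v: "v V i \<in> V" "j \<in> I V \<Longrightarrow> v V i \<bullet> j = (if i = j then 1 else 0)" "b \<in> B \<Longrightarrow> \<bar>v V i \<bullet> b\<bar> \<le> K"
      if "V \<in> S" "i \<in> I V" for V i j b using g that by (auto simp: I_def v_def)
    have vspan: "x = (\<Sum>i\<in>I V. (x \<bullet> i) *\<^sub>R v V i)" if "V \<in> S" "x \<in> V" for V x
      using g that unfolding I_def v_def by blast
    \<comment> \<open>A vector of \<open>V\<close> has the same inner product with e as with the
      projection of e, whose norm is at most \<rho>.\<close>
    have small: "\<bar>v V i \<bullet> e\<bar> \<le> n * K * \<rho>" if "V \<in> S" "i \<in> I V" for V i
    proof -
      have sV: "subspace V" using that(1) by (simp add: S_def grassmannian_def)
      have "v V i \<bullet> (e - orth_proj V e) = 0"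
        using orth_proj(2)[OF sV v(1)[OF that]] by (simp add: orthogonal_def inner_commute)
      then have "\<bar>v V i \<bullet> e\<bar> = \<bar>v V i \<bullet> orth_proj V e\<bar>" by (simp add: inner_diff_right)
      also have "\<dots> \<le> norm (v V i) * norm (orth_proj V e)" by (rule Cauchy_Schwarz_ineq2)
      also have "\<dots> \<le> (n * K) * \<rho>"
      proof (intro mult_mono)
        have "norm (v V i) \<le> (\<Sum>b\<in>B. \<bar>v V i \<bullet> b\<bar>)" by (rule norm_inner_expansion(2)[OF B(1,2,6,3)])
        also have "\<dots> \<le> (\<Sum>b\<in>B. K)" using v(3)[OF that] by (intro sum_mono)
        finally show "norm (v V i) \<le> n * K" by (simp add: B(4))
      qed (use that(1) nK in \<open>auto simp: S_def\<close>)
      finally show ?thesis .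
    qed
    have eI: "e \<notin> I V" if "V \<in> S" for V
    proof
      assume "e \<in> I V"
      then have "v V e \<bullet> e = 1" using v(2)[OF that] by simp
      then show False using small[OF that \<open>e \<in> I V\<close>] \<rho>1 by simp
    qed
    \<comment> \<open>Chosen so that the graph comparison, with its constant 2 n^2, returns exactly
      \<rho>.\<close>
    define \<sigma> where "\<sigma> = \<rho> / (2 * real n ^ 2)"
    have \<sigma>: "\<sigma> > 0" using \<rho> n0 by (simp add: \<sigma>_def)
    define L where "L = nat \<lceil>K / \<sigma>\<rceil>"
    define T where "T p = (if snd p = e then {-int J..int J} else {-int L..int L})" for p :: "'a \<times> 'a"
    define lab where "lab V = (I V, restrict (\<lambda>p. \<lfloor>(v V (fst p) \<bullet> snd p) / \<sigma>\<rfloor>) (I V \<times> (B - I V)))" for V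
    define \<L> where "\<L> = (SIGMA I:{I. I \<subseteq> B - {e} \<and> card I = m}. \<Pi>\<^sub>E p\<in>I \<times> (B - I). T p)"
    have floor_in: "\<lfloor>z / \<sigma>\<rfloor> \<in> {-int M..int M}" if "\<bar>z\<bar> \<le> y" "M = nat \<lceil>y / \<sigma>\<rceil>" for z y M
    proof -
      have "\<bar>z / \<sigma>\<bar> \<le> y / \<sigma>" using that(1) \<sigma> by (simp add: abs_divide divide_right_mono)
      then have "\<bar>z / \<sigma>\<bar> \<le> real M" unfolding that(2) by linarith
      then have "real_of_int (- int M) \<le> z / \<sigma>" "z / \<sigma> < real_of_int (int M) + 1" by linarith+
      then show ?thesis by (simp only: atLeastAtMost_iff le_floor_iff floor_le_iff)
    qed
    have J_eq: "J = nat \<lceil>(n * K * \<rho>) / \<sigma>\<rceil>"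
    proof -
      have "(n * K * \<rho>) / \<sigma> = 2 * real n ^ 3 * K" using \<rho>(1) n0 by (simp add: \<sigma>_def field_simps power3_eq_cube power2_eq_square)
      then show ?thesis by (simp add: J_def)
    qed
    have lab: "lab ` S \<subseteq> \<L>"
    proof
      fix q assume "q \<in> lab ` S"
      then obtain V where V: "V \<in> S" "q = lab V" by blast
      have "\<lfloor>(v V i \<bullet> b) / \<sigma>\<rfloor> \<in> T (i, b)" if "i \<in> I V" "b \<in> B - I V" for i b
        using floor_in[OF small[OF V(1) that(1)] J_eq] floor_in[OF v(3)[OF V(1) that(1), of b] L_def] that
        by (auto simp: T_def)
      then show "q \<in> \<L>" using I[OF V(1)] eI[OF V(1)] V(2)
        by (auto simp: \<L>_def lab_def)
    qed
    have finI: "finite {I. I \<subseteq> B - {e} \<and> card I = m}" using B(6) by simp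
    have fibre: "card (\<Pi>\<^sub>E p\<in>I \<times> (B - I). T p) = ((2 * J + 1) * (2 * L + 1) ^ (n - 1 - m)) ^ m"
      "finite (\<Pi>\<^sub>E p\<in>I \<times> (B - I). T p)"
      if "I \<in> {I. I \<subseteq> B - {e} \<and> card I = m}" for I
      using card_graph_labels[OF B(6,4,5), of I m J L] that assms B(6)
      unfolding T_def n_def[symmetric] by (auto intro!: finite_PiE intro: finite_subset)
    have fin\<L>: "finite \<L>" unfolding \<L>_def using finI fibre(2) by (intro finite_SigmaI) auto
    have "card \<L> = (\<Sum>I\<in>{I. I \<subseteq> B - {e} \<and> card I = m}. card (\<Pi>\<^sub>E p\<in>I \<times> (B - I). T p))"
      unfolding \<L>_def using finI fibre(2) by (intro card_SigmaI) auto
    also have "\<dots> = card {I. I \<subseteq> B - {e} \<and> card I = m} * ((2 * J + 1) * (2 * L + 1) ^ (n - 1 - m)) ^ m"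
      using fibre(1) by simp
    also have "\<dots> \<le> 2 ^ n * ((2 * J + 1) * (2 * L + 1) ^ (n - 1 - m)) ^ m"
    proof (rule mult_right_mono)
      have "card {I. I \<subseteq> B - {e} \<and> card I = m} \<le> card (Pow B)"
        using B(6) by (intro card_mono) auto
      then show "card {I. I \<subseteq> B - {e} \<and> card I = m} \<le> 2 ^ n" using B(4,6) by (simp add: card_Pow)
    qed simp
    finally have "real (card \<L>) \<le> real (2 ^ n * ((2 * J + 1) * (2 * L + 1) ^ (n - 1 - m)) ^ m)"
      by (rule of_nat_mono)
    also have "\<dots> = 2 ^ n * (real (2 * J + 1) * real (2 * L + 1) ^ (n - 1 - m)) ^ m"
      by (simp only: of_nat_mult of_nat_power of_nat_numeral)
    also have "\<dots> \<le> 2 ^ n * (real (2 * J + 1) * (C1 * (1 / \<rho>)) ^ (n - 1 - m)) ^ m"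
    proof (intro mult_left_mono power_mono)
      have "real L \<le> K / \<sigma> + 1" unfolding L_def using K1 \<sigma> by (simp add: of_nat_nat)
      also have "K / \<sigma> = 2 * real n ^ 2 * K / \<rho>" using n0 \<rho> by (simp add: \<sigma>_def)
      finally have "real (2 * L + 1) \<le> 4 * real n ^ 2 * K / \<rho> + 3" by simp
      also have "\<dots> \<le> C1 * (1 / \<rho>)" using \<rho>(1) \<rho>1(1) by (simp add: C1_def field_simps)
      finally show "real (2 * L + 1) \<le> C1 * (1 / \<rho>)" .
    qed auto
    also have "\<dots> = C * (1 / \<rho>) ^ (m * (n - 1 - m))"
    proof -
      have "(1 / \<rho>) ^ (m * (n - 1 - m)) = ((1 / \<rho>) ^ (n - 1 - m)) ^ m" by (metis power_mult mult.commute)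
      then show ?thesis by (simp only: C_def power_mult_distrib mult.assoc)
    qed
    finally have card\<L>: "real (card \<L>) \<le> C * (1 / \<rho>) ^ (m * (n - 1 - m))" .
    define \<A> where "\<A> = (\<lambda>q. {V \<in> S. lab V = q}) ` (lab ` S)"
    have "finite (lab ` S)" using lab fin\<L> by (rule finite_subset)
    then have "finite \<A>" "card \<A> \<le> card \<L>"
      unfolding \<A>_def using card_image_le[of "lab ` S" "\<lambda>q. {V \<in> S. lab V = q}"] card_mono[OF fin\<L> lab] by auto
    moreover have "S \<subseteq> \<Union>\<A>" by (auto simp: \<A>_def)
    moreover have "norm (orth_proj V x - orth_proj W x) \<le> \<rho> * norm x"
      if A: "A \<in> \<A>" and VA: "V \<in> A" and WA: "W \<in> A" for A V W x
    proof -
      have VW: "V \<in> S" "W \<in> S" "lab V = lab W" using A VA WA by (auto simp: \<A>_def)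
      have IVW: "I W = I V" using VW(3) by (simp add: lab_def)
      have fl: "\<lfloor>(v V i \<bullet> b) / \<sigma>\<rfloor> = \<lfloor>(v W i \<bullet> b) / \<sigma>\<rfloor>" if "i \<in> I V" "b \<in> B - I V" for i b
      proof -
        have "restrict (\<lambda>p. \<lfloor>(v V (fst p) \<bullet> snd p) / \<sigma>\<rfloor>) (I V \<times> (B - I V)) (i, b)
            = restrict (\<lambda>p. \<lfloor>(v W (fst p) \<bullet> snd p) / \<sigma>\<rfloor>) (I V \<times> (B - I V)) (i, b)"
          using VW(3) by (simp add: lab_def IVW)
        then show ?thesis using that by simp
      qed
      have close: "\<bar>v V i \<bullet> b - v W i \<bullet> b\<bar> \<le> \<sigma>" if "i \<in> I V" "b \<in> B - I V" for i b
      proof -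
        have "\<bar>(v V i \<bullet> b) / \<sigma> - (v W i \<bullet> b) / \<sigma>\<bar> \<le> 1" using fl[OF that] by linarith
        then have "\<bar>v V i \<bullet> b - v W i \<bullet> b\<bar> / \<sigma> \<le> 1" using \<sigma> by (simp add: diff_divide_distrib abs_divide flip: diff_divide_distrib)
        then show ?thesis using \<sigma> by simp
      qed
      have "norm (orth_proj V x - orth_proj W x) \<le> 2 * (real n ^ 2 * \<sigma>) * norm x"
      proof (rule graph_basis_orth_proj_close[OF B(1,2,6,3,4) I(1)[OF VW(1)]])
        show "subspace V" "subspace W" using VW by (auto simp: S_def grassmannian_def)
        show "0 \<le> \<sigma>" using \<sigma> by simp
        fix i assume i: "i \<in> I V"
        then have i': "i \<in> I W" by (simp add: IVW)
        show "v V i \<in> V" "v W i \<in> W" using v(1)[OF VW(1) i] v(1)[OF VW(2) i'] .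
        show "v V i \<bullet> j = (if i = j then 1 else 0)" "v W i \<bullet> j = (if i = j then 1 else 0)" if "j \<in> I V" for j
          using v(2)[OF VW(1) i that] v(2)[OF VW(2) i', of j] that by (simp_all only: IVW)
        show "\<bar>v V i \<bullet> b - v W i \<bullet> b\<bar> \<le> \<sigma>" if "b \<in> B - I V" for b using close[OF i that] .
      next
        show "x = (\<Sum>i\<in>I V. (x \<bullet> i) *\<^sub>R v V i)" if "x \<in> V" for x using vspan[OF VW(1) that] .
        show "x = (\<Sum>i\<in>I V. (x \<bullet> i) *\<^sub>R v W i)" if "x \<in> W" for x using vspan[OF VW(2) that] by (simp only: IVW)
      qed
      also have "2 * (real n ^ 2 * \<sigma>) = \<rho>" using n0 by (simp add: \<sigma>_def)
      finally show ?thesis .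
    qed
    ultimately show ?thesis using card\<L> unfolding S_def[symmetric]
      by (intro exI[of _ \<A>]) (auto simp: S_def)
  qed
  ultimately show ?thesis unfolding n_def by blast
qed

subsection \<open>Frostman weights on the Grassmannian\<close>

text \<open>At \<open>x = 0\<close> the kernel is 1, whereas \<open>(r / 0) powr s\<close> would be 0.\<close>
definition riesz_kernel :: "real \<Rightarrow> real \<Rightarrow> 'a::real_normed_vector \<Rightarrow> real" where
  "riesz_kernel s r x = (if norm x \<le> r then 1 else (r / norm x) powr s)"

text \<open>Links the matrix entries, which the dyadic tree controls, to the operator norm, in which
  the dimension is measured.\<close>

lemma dist_proj_op_le:
  fixes V W :: "'a::euclidean_space set"
  assumes "subspace V" "subspace W"
    and "\<And>b c. b \<in> Basis \<Longrightarrow> c \<in> Basis \<Longrightarrow> \<bar>orth_proj V b \<bullet> c - orth_proj W b \<bullet> c\<bar> \<le> \<eta>"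
  shows "dist (proj_op V) (proj_op W) \<le> real DIM('a) ^ 2 * \<eta>"
proof -
  have lin: "linear (\<lambda>x. orth_proj V x - orth_proj W x)"
    using bounded_linear_orth_proj[OF assms(1)] bounded_linear_orth_proj[OF assms(2)]
    by (intro linear_compose_sub bounded_linear.linear)
  have "norm (orth_proj V x - orth_proj W x) \<le> (real DIM('a) ^ 2 * \<eta>) * norm x" for x
  proof -
    have "orth_proj V x - orth_proj W x = (\<Sum>b\<in>Basis. (x \<bullet> b) *\<^sub>R (orth_proj V b - orth_proj W b))"
      using linear_sum[OF lin, of "\<lambda>b. (x \<bullet> b) *\<^sub>R b" Basis] linear_cmul[OF lin]
      by (simp add: euclidean_representation)
    then have "norm (orth_proj V x - orth_proj W x) \<le> (\<Sum>b\<in>Basis. norm ((x \<bullet> b) *\<^sub>R (orth_proj V b - orth_proj W b)))"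
      by (metis norm_sum)
    also have "\<dots> \<le> (\<Sum>b\<in>(Basis::'a set). norm x * (real DIM('a) * \<eta>))"
    proof (rule sum_mono)
      fix b :: 'a assume b: "b \<in> Basis"
      have "norm (orth_proj V b - orth_proj W b) \<le> (\<Sum>c\<in>Basis. \<bar>(orth_proj V b - orth_proj W b) \<bullet> c\<bar>)"
        by (rule norm_le_l1)
      also have "\<dots> \<le> (\<Sum>c\<in>(Basis::'a set). \<eta>)" using assms(3)[OF b] by (intro sum_mono) (simp add: inner_diff_left)
      finally have "norm (orth_proj V b - orth_proj W b) \<le> real DIM('a) * \<eta>" by simp
      then show "norm ((x \<bullet> b) *\<^sub>R (orth_proj V b - orth_proj W b)) \<le> norm x * (real DIM('a) * \<eta>)"
        using Basis_le_norm[OF b, of x] by (simp add: mult_mono)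
    qed
    also have "\<dots> = (real DIM('a) ^ 2 * \<eta>) * norm x" by (simp add: power2_eq_square)
    finally show ?thesis .
  qed
  then show ?thesis using assms(1,2) by (simp add: dist_proj_op onorm_le)
qed

lemma sum_UN_le:
  fixes w :: "'b \<Rightarrow> real"
  assumes "finite I" "\<And>i. i \<in> I \<Longrightarrow> finite (A i)" "\<And>x. 0 \<le> w x"
  shows "sum w (\<Union>i\<in>I. A i) \<le> (\<Sum>i\<in>I. sum w (A i))"
  using assms(1,2)
proof (induction I rule: finite_induct)
  case (insert i I)
  have "sum w (\<Union>j\<in>insert i I. A j) = sum w (A i \<union> (\<Union>j\<in>I. A j))" by simp
  also have "\<dots> \<le> sum w (A i) + sum w (\<Union>j\<in>I. A j)"
    using insert.hyps(1) insert.prems assms(3) by (subst sum_Un) (auto intro: sum_nonneg)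
  also have "\<dots> \<le> sum w (A i) + (\<Sum>j\<in>I. sum w (A j))" using insert by simp
  finally show ?case using insert.hyps by simp
qed simp

text \<open>The coordinates fed to the dyadic tree are the matrix entries of the projections, all of
  modulus at most 1. A slab of relative width \<rho> is covered by about
  \<open>\<rho> powr (- m * (n - 1 - m))\<close> classes, each of mass at most a constant times
  \<open>\<rho> powr t\<close>, and the exponents leave s. \<open>C\<close> depends neither on \<V>
  nor on the depth \<open>N\<close>; the depth only limits how thin a slab may be.\<close>

lemma frostman_grassmannian:
  fixes m :: nat and s t :: real
  assumes m: "m < DIM('a::euclidean_space)" and s: "s > 0"
    and t: "t = real (m * (DIM('a) - 1 - m)) + s"
  shows "\<exists>C>0. \<forall>(\<V> :: 'a set set) N. \<V> \<subseteq> grassmannian m \<longrightarrow>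
    (\<exists>P w. finite P \<and> P \<subseteq> \<V> \<and> (\<forall>V. 0 \<le> w V) \<and>
      (\<forall>x r. 0 < r \<longrightarrow> (1/2)^N * norm x \<le> r \<longrightarrow>
         sum w {V\<in>P. norm (orth_proj V x) \<le> r} \<le> C * riesz_kernel s r x) \<and>
      hausdorff_content t (proj_op ` \<V>) \<le> ennreal (C * sum w P))"
proof -
  define n where "n = DIM('a)"
  obtain C0 \<rho>0 where C0: "C0 > 0" and \<rho>0: "\<rho>0 > 0" and cover0: "\<forall>(e::'a) \<rho>. norm e = 1 \<longrightarrow> 0 < \<rho> \<longrightarrow> \<rho> < \<rho>0 \<longrightarrow>
    (\<exists>\<A>. finite \<A> \<and> real (card \<A>) \<le> C0 * (1 / \<rho>) ^ (m * (n - 1 - m)) \<and>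
       {V \<in> grassmannian m. norm (orth_proj V e) \<le> \<rho>} \<subseteq> \<Union>\<A> \<and>
       (\<forall>A\<in>\<A>. \<forall>V\<in>A. \<forall>W\<in>A. \<forall>x. norm (orth_proj V x - orth_proj W x) \<le> \<rho> * norm x))"
    using grassmannian_slab_cover[OF m] unfolding n_def[symmetric] by (elim exE conjE) (rule that; assumption)
  note cover = cover0[rule_format]
  define I where "I = (Basis :: 'a set) \<times> (Basis :: 'a set)"
  have I: "finite I" by (simp add: I_def)
  define f where "f V p = orth_proj V (fst p) \<bullet> snd p" for V :: "'a set" and p
  define M where "M = (3::real) ^ card I"
  have M: "M > 0" by (simp add: M_def)
  have t0: "t > 0" using t s by (simp add: add_nonneg_pos)
  \<comment> \<open>One summand per case: short x, relative width at least \<rho>0, thinner slabs,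
    and the conversion of dyadic side lengths into operator-norm diameters.\<close>
  define C where "C = M * 4 powr t + M * 4 powr t * (1 / \<rho>0) powr s + C0 * M * 2 powr t + (real n ^ 2) powr t"
  have Cge: "M * 4 powr t \<le> C" "M * 4 powr t * (1 / \<rho>0) powr s \<le> C" "C0 * M * 2 powr t \<le> C" "(real n ^ 2) powr t \<le> C"
  proof -
    have "0 \<le> M * 4 powr t" "0 \<le> M * 4 powr t * (1 / \<rho>0) powr s" "0 \<le> C0 * M * 2 powr t" "0 \<le> (real n ^ 2) powr t"
      using M C0 by auto
    then show "M * 4 powr t \<le> C" "M * 4 powr t * (1 / \<rho>0) powr s \<le> C" "C0 * M * 2 powr t \<le> C" "(real n ^ 2) powr t \<le> C"
      unfolding C_def by linarith+
  qed
  have "0 < M * 4 powr t" using M by simp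
  then have "C > 0" using Cge(1) by linarith
  moreover have "\<exists>P w. finite P \<and> P \<subseteq> \<V> \<and> (\<forall>V. 0 \<le> w V) \<and>
      (\<forall>x r. 0 < r \<longrightarrow> (1/2)^N * norm x \<le> r \<longrightarrow>
         sum w {V\<in>P. norm (orth_proj V x) \<le> r} \<le> C * riesz_kernel s r x) \<and>
      hausdorff_content t (proj_op ` \<V>) \<le> ennreal (C * sum w P)"
    if \<V>: "\<V> \<subseteq> grassmannian m" for \<V> :: "'a set set" and N
  proof -
    have sub: "subspace V" if "V \<in> \<V>" for V using \<V> that by (auto simp: grassmannian_def)
    have f1: "\<bar>f V p\<bar> \<le> 1" if "V \<in> \<V>" "p \<in> I" for V p
    proof -
      have p: "norm (fst p) = 1" "norm (snd p) = 1" using that(2) by (auto simp: I_def)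
      have "\<bar>f V p\<bar> \<le> norm (orth_proj V (fst p)) * norm (snd p)" unfolding f_def by (rule Cauchy_Schwarz_ineq2)
      also have "\<dots> \<le> 1" using norm_orth_proj_le[OF sub[OF that(1)], of "fst p"] p by simp
      finally show ?thesis .
    qed
    have "\<forall>V\<in>\<V>. \<forall>i\<in>I. \<bar>f V i\<bar> \<le> 1" using f1 by blast
    from discrete_frostman[OF I less_imp_le[OF t0] this, where N = N, folded M_def]
    obtain P w X \<kappa> where P: "finite P" "P \<subseteq> \<V>" and w0: "\<forall>V. 0 \<le> w V"
      and mass0: "\<forall>A \<rho>. A \<subseteq> P \<longrightarrow> (1/2)^N \<le> \<rho> \<longrightarrow> (\<forall>x\<in>A. \<forall>y\<in>A. \<forall>i\<in>I. \<bar>f x i - f y i\<bar> \<le> \<rho>)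
         \<longrightarrow> sum w A \<le> M * (2 * \<rho>) powr t"
      and X: "X \<subseteq> P" and cov0: "\<forall>V\<in>\<V>. \<exists>z\<in>X. \<forall>i\<in>I. \<lfloor>2 ^ \<kappa> z * f V i\<rfloor> = \<lfloor>2 ^ \<kappa> z * f z i\<rfloor>"
      and total: "(\<Sum>z\<in>X. ((1/2) ^ \<kappa> z) powr t) = sum w P"
      by (elim exE conjE) (rule that; assumption)
    note w = w0[rule_format]
    have mass: "sum w A \<le> M * (2 * \<rho>) powr t"
      if "A \<subseteq> P" "(1/2)^N \<le> \<rho>" "\<forall>x\<in>A. \<forall>y\<in>A. \<forall>i\<in>I. \<bar>f x i - f y i\<bar> \<le> \<rho>" for A \<rho>
      using mass0 that by blast
    have cov: "\<exists>z\<in>X. \<forall>i\<in>I. \<lfloor>2 ^ \<kappa> z * f V i\<rfloor> = \<lfloor>2 ^ \<kappa> z * f z i\<rfloor>" if "V \<in> \<V>" for V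
      using cov0 that by blast
    have all: "sum w P \<le> M * 4 powr t"
    proof -
      have "(1/2::real)^N \<le> 1" by (simp add: power_le_one)
      moreover have "\<forall>x\<in>P. \<forall>y\<in>P. \<forall>i\<in>I. \<bar>f x i - f y i\<bar> \<le> 2"
      proof (intro ballI)
        fix x y i assume "x \<in> P" "y \<in> P" "i \<in> I"
        then have "\<bar>f x i\<bar> \<le> 1" "\<bar>f y i\<bar> \<le> 1" using f1 P(2) by blast+
        then show "\<bar>f x i - f y i\<bar> \<le> 2" by linarith
      qed
      ultimately show ?thesis using mass[of P 2] by simp
    qed
    have slab: "sum w {V\<in>P. norm (orth_proj V x) \<le> r} \<le> C * riesz_kernel s r x"
      if r: "0 < r" "(1/2)^N * norm x \<le> r" for x r
    proof -
      let ?S = "{V\<in>P. norm (orth_proj V x) \<le> r}"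
      have le_all: "sum w ?S \<le> sum w P" using P(1) w by (intro sum_mono2) auto
      show ?thesis
      proof (cases "norm x \<le> r")
        case True
        then show ?thesis using le_all all Cge(1) by (simp add: riesz_kernel_def)
      next
        case False
        define \<rho> where "\<rho> = r / norm x"
        have x0: "norm x > 0" using False r by linarith
        have \<rho>: "\<rho> > 0" "(1/2)^N \<le> \<rho>" using r x0 by (auto simp: \<rho>_def field_simps)
        have ker: "riesz_kernel s r x = \<rho> powr s" using False by (simp add: riesz_kernel_def \<rho>_def)
        show ?thesis
        proof (cases "\<rho> < \<rho>0")
          case False
          have "1 \<le> (\<rho> / \<rho>0) powr s" using False \<rho>0 s by (intro ge_one_powr_ge_zero) auto
          also have "\<dots> = (1 / \<rho>0) powr s * \<rho> powr s" using \<rho> \<rho>0 by (simp add: powr_divide)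
          finally have "M * 4 powr t * 1 \<le> M * 4 powr t * ((1 / \<rho>0) powr s * \<rho> powr s)"
            using M by (intro mult_left_mono) auto
          also have "\<dots> \<le> C * \<rho> powr s" using mult_right_mono[OF Cge(2), of "\<rho> powr s"] by (simp add: mult.assoc)
          finally show ?thesis using le_all all ker by simp
        next
          case True
          define e where "e = (1 / norm x) *\<^sub>R x"
          have "norm e = 1" using x0 by (simp add: e_def)
          from cover[OF this \<rho>(1) True] obtain \<A> where \<A>: "finite \<A>" "real (card \<A>) \<le> C0 * (1 / \<rho>) ^ (m * (n - 1 - m))"
            "{V \<in> grassmannian m. norm (orth_proj V e) \<le> \<rho>} \<subseteq> \<Union>\<A>"
            "\<forall>A\<in>\<A>. \<forall>V\<in>A. \<forall>W\<in>A. \<forall>x. norm (orth_proj V x - orth_proj W x) \<le> \<rho> * norm x" by blast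
          have "?S \<subseteq> (\<Union>A\<in>\<A>. A \<inter> P)"
          proof
            fix V assume V: "V \<in> ?S"
            then have VG: "V \<in> \<V>" using P(2) by blast
            have "orth_proj V e = (1 / norm x) *\<^sub>R orth_proj V x"
              unfolding e_def using bounded_linear_orth_proj[OF sub[OF VG]]
              by (simp add: bounded_linear.linear linear_cmul)
            then have "norm (orth_proj V e) \<le> \<rho>" using V x0 by (simp add: \<rho>_def divide_right_mono)
            then have "V \<in> \<Union>\<A>" using \<A>(3) VG \<V> by blast
            then show "V \<in> (\<Union>A\<in>\<A>. A \<inter> P)" using V by blast
          qed
          then have "sum w ?S \<le> sum w (\<Union>A\<in>\<A>. A \<inter> P)"
            using \<A>(1) P(1) w by (intro sum_mono2) auto
          also have "\<dots> \<le> (\<Sum>A\<in>\<A>. sum w (A \<inter> P))"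
            using \<A>(1) P(1) w by (intro sum_UN_le) auto
          also have "\<dots> \<le> (\<Sum>A\<in>\<A>. M * (2 * \<rho>) powr t)"
          proof (rule sum_mono, rule mass[OF _ \<rho>(2)], blast, intro ballI)
            fix A V W p assume A: "A \<in> \<A>" "V \<in> A \<inter> P" "W \<in> A \<inter> P" "p \<in> I"
            have p: "norm (fst p) = 1" "norm (snd p) = 1" using A(4) by (auto simp: I_def)
            have "\<bar>f V p - f W p\<bar> = \<bar>(orth_proj V (fst p) - orth_proj W (fst p)) \<bullet> snd p\<bar>"
              by (simp add: f_def inner_diff_left)
            also have "\<dots> \<le> norm (orth_proj V (fst p) - orth_proj W (fst p)) * norm (snd p)"
              by (rule Cauchy_Schwarz_ineq2)
            also have "\<dots> \<le> \<rho>" using \<A>(4) A p by (metis IntD1 mult.right_neutral)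
            finally show "\<bar>f V p - f W p\<bar> \<le> \<rho>" .
          qed
          also have "\<dots> = card \<A> * (M * (2 * \<rho>) powr t)" by simp
          also have "\<dots> \<le> (C0 * (1 / \<rho>) ^ (m * (n - 1 - m))) * (M * (2 * \<rho>) powr t)"
            using \<A>(2) M by (intro mult_right_mono) auto
          also have "\<dots> = C0 * M * 2 powr t * \<rho> powr s"
          proof -
            have "(2 * \<rho>) powr t = 2 powr t * (\<rho> ^ (m * (n - 1 - m)) * \<rho> powr s)"
              using \<rho>(1) by (simp add: powr_mult t powr_add powr_realpow n_def del: of_nat_mult)
            moreover have "(1 / \<rho>) ^ (m * (n - 1 - m)) * \<rho> ^ (m * (n - 1 - m)) = 1"
              using \<rho>(1) by (simp flip: power_mult_distrib)
            ultimately show ?thesis by (simp add: mult_ac)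
          qed
          also have "\<dots> \<le> C * riesz_kernel s r x" unfolding ker using Cge(3) by (intro mult_right_mono) auto
          finally show ?thesis .
        qed
      qed
    qed
    define U where "U z = proj_op ` {V\<in>\<V>. \<forall>i\<in>I. \<lfloor>2 ^ \<kappa> z * f V i\<rfloor> = \<lfloor>2 ^ \<kappa> z * f z i\<rfloor>}" for z
    have "hausdorff_content t (proj_op ` \<V>) \<le> ennreal (\<Sum>z\<in>X. (real n ^ 2 * (1/2) ^ \<kappa> z) powr t)"
    proof (rule hausdorff_content_finite_cover[where U = U])
      show "finite X" using X P(1) by (rule finite_subset)
      show "proj_op ` \<V> \<subseteq> (\<Union>z\<in>X. U z)" using cov by (fastforce simp: U_def)
      fix z assume "z \<in> X"
      have d: "dist x y \<le> real n ^ 2 * (1/2) ^ \<kappa> z" if xy: "x \<in> U z" "y \<in> U z" for x y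
      proof -
        obtain V W where VW: "V \<in> \<V>" "x = proj_op V" "W \<in> \<V>" "y = proj_op W"
          "\<forall>i\<in>I. \<lfloor>2 ^ \<kappa> z * f V i\<rfloor> = \<lfloor>2 ^ \<kappa> z * f z i\<rfloor>" "\<forall>i\<in>I. \<lfloor>2 ^ \<kappa> z * f W i\<rfloor> = \<lfloor>2 ^ \<kappa> z * f z i\<rfloor>"
          using xy unfolding U_def by blast
        have "\<bar>f V i - f W i\<bar> \<le> (1/2) ^ \<kappa> z" if "i \<in> I" for i
        proof -
          have "\<lfloor>2 ^ \<kappa> z * f V i\<rfloor> = \<lfloor>2 ^ \<kappa> z * f W i\<rfloor>" using VW(5,6) that by simp
          then have "\<bar>2 ^ \<kappa> z * f V i - 2 ^ \<kappa> z * f W i\<bar> \<le> 1" by linarith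
          then have "2 ^ \<kappa> z * \<bar>f V i - f W i\<bar> \<le> 1"
            by (metis abs_mult abs_numeral power_abs right_diff_distrib)
          then show ?thesis by (simp add: field_simps)
        qed
        then have "\<bar>orth_proj V b \<bullet> c - orth_proj W b \<bullet> c\<bar> \<le> (1/2) ^ \<kappa> z" if "b \<in> Basis" "c \<in> Basis" for b c
          using that unfolding f_def I_def by (metis SigmaI fst_conv snd_conv)
        then show ?thesis unfolding VW(2,4) n_def using sub VW(1,3) by (intro dist_proj_op_le)
      qed
      have "bounded (U z)" using d unfolding bounded_def by (metis (no_types))
      moreover have "diameter (U z) \<le> real n ^ 2 * (1/2) ^ \<kappa> z"
        using d by (intro diameter_le) (auto simp: dist_norm)
      ultimately show "bounded (U z) \<and> diameter (U z) \<le> real n ^ 2 * (1/2) ^ \<kappa> z" by simp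
    qed (rule t0)
    also have "(\<Sum>z\<in>X. (real n ^ 2 * (1/2) ^ \<kappa> z) powr t) = (real n ^ 2) powr t * sum w P"
      unfolding total[symmetric] sum_distrib_left by (intro sum.cong refl powr_mult)
    also have "ennreal \<dots> \<le> ennreal (C * sum w P)"
      using Cge(4) w by (intro ennreal_leI mult_right_mono sum_nonneg) auto
    finally show ?thesis using P w slab by (intro exI[of _ P] exI[of _ w]) blast
  qed
  ultimately show ?thesis by blast
qed

subsection \<open>Potentials and the Assouad dimensions\<close>

text \<open>Cauchy-Schwarz for the fibre sizes: they add up to \<open>card E\<close>, and their
  squares add up to the number of colliding pairs.\<close>

lemma card_sq_le_collisions:
  fixes g :: "'b \<Rightarrow> 'c"
  assumes "finite E" "g ` E \<subseteq> S" "finite S"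
  shows "(real (card E))\<^sup>2 \<le> real (card S) * real (card {(x, y). x \<in> E \<and> y \<in> E \<and> g x = g y})"
proof -
  let ?n = "\<lambda>c. real (card {x\<in>E. g x = c})"
  have "real (card E) = (\<Sum>c\<in>S. ?n c)"
    using sum.group[OF assms(1,3,2), of "\<lambda>_. 1::real"] by simp
  then have "(real (card E))\<^sup>2 \<le> (\<Sum>c\<in>S. (?n c)\<^sup>2) * card S"
    using sum_squared_le_sum_of_squares[of ?n S] assms(3) by simp
  also have "(\<Sum>c\<in>S. (?n c)\<^sup>2) = real (\<Sum>c\<in>S. card ({x\<in>E. g x = c} \<times> {x\<in>E. g x = c}))"
    by (simp add: card_cartesian_product power2_eq_square)
  also have "(\<Sum>c\<in>S. card ({x\<in>E. g x = c} \<times> {x\<in>E. g x = c})) = card (\<Union>c\<in>S. {x\<in>E. g x = c} \<times> {x\<in>E. g x = c})"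
    using assms(1,3) by (subst card_UN_disjoint) auto
  also have "(\<Union>c\<in>S. {x\<in>E. g x = c} \<times> {x\<in>E. g x = c}) = {(x, y). x \<in> E \<and> y \<in> E \<and> g x = g y}"
    using assms(2) by auto
  finally show ?thesis by (simp add: mult.commute)
qed

text \<open>A single term already dominates: the least k with norm x \<le> 2^k r. Minimality gives
  norm x > 2^(k-1) r when k > 0, and this off-by-one is the factor \<open>2 powr s\<close>. The form
  turns sums of kernels into counts of points in balls.\<close>

lemma riesz_kernel_dyadic:
  fixes x :: "'a::real_normed_vector"
  assumes "s > 0" "r > 0" "norm x \<le> 2 ^ N * r"
  shows "riesz_kernel s r x \<le> (\<Sum>k\<le>N. 2 powr s * 2 powr (- real k * s) * (if norm x \<le> 2 ^ k * r then 1 else 0))"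
proof -
  define k where "k = (LEAST k. norm x \<le> 2 ^ k * r)"
  have k: "norm x \<le> 2 ^ k * r" unfolding k_def using assms(3) by (rule LeastI)
  have kN: "k \<le> N" unfolding k_def using assms(3) by (rule Least_le)
  have "riesz_kernel s r x \<le> 2 powr s * 2 powr (- real k * s)"
  proof (cases k)
    case 0
    have "riesz_kernel s r x = 1" using k 0 by (simp add: riesz_kernel_def)
    then show ?thesis using assms(1) 0 by (simp add: ge_one_powr_ge_zero)
  next
    case (Suc j)
    have j: "norm x > 2 ^ j * r" using not_less_Least[of j "\<lambda>k. norm x \<le> 2 ^ k * r"] Suc by (simp add: k_def)
    have "2 ^ j * r \<ge> 1 * r" using assms(2) by (intro mult_right_mono) auto
    then have nx: "norm x > r" using j by simp
    have "r / norm x \<le> 2 powr (- real j)"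
    proof -
      have "0 < norm x" using assms(2) nx by linarith
      then have "r / norm x \<le> r / (2 ^ j * r)"
        using j assms(2) by (intro divide_left_mono mult_pos_pos) simp_all
      also have "\<dots> = 2 powr (- real j)" using assms(2) by (simp add: powr_minus powr_realpow field_simps)
      finally show ?thesis .
    qed
    then have "(r / norm x) powr s \<le> (2 powr (- real j)) powr s"
      using assms nx by (intro powr_mono2) auto
    also have "\<dots> = 2 powr (s + - real k * s)" by (simp add: powr_powr Suc algebra_simps)
    also have "\<dots> = 2 powr s * 2 powr (- real k * s)" by (rule powr_add)
    finally show ?thesis using nx by (simp add: riesz_kernel_def)
  qed
  also have "\<dots> = (\<Sum>l\<in>{k}. 2 powr s * 2 powr (- real l * s) * (if norm x \<le> 2 ^ l * r then 1 else 0))"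
    using k by simp
  also have "\<dots> \<le> (\<Sum>l\<le>N. 2 powr s * 2 powr (- real l * s) * (if norm x \<le> 2 ^ l * r then 1 else 0))"
    using kN by (intro sum_mono2) auto
  finally show ?thesis .
qed

text \<open>The ball of radius 2^k r contributes at most A 2^(-k s) 2^(k (s - \<eta>)) up to a
  factor \<open>2 powr s\<close>, so the levels form a geometric series of ratio
  \<open>2 powr (- \<eta>)\<close>. The loss \<eta> keeps the bound independent of the number of
  levels.\<close>

lemma sum_riesz_kernel_le:
  fixes x :: "'a::real_normed_vector"
  assumes E: "finite E" and pos: "s > 0" "r > 0" "\<eta> > 0" "A \<ge> 0"
    and count: "\<And>R. r \<le> R \<Longrightarrow> real (card (E \<inter> cball x R)) \<le> A * (R / r) powr (s - \<eta>)"
  shows "(\<Sum>y\<in>E. riesz_kernel s r (x - y)) \<le> 2 powr s * A / (1 - 2 powr (- \<eta>))"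
proof -
  have "bounded ((\<lambda>y. x - y) ` E)" using E by (simp add: finite_imp_bounded)
  then obtain D where D: "\<And>y. y \<in> E \<Longrightarrow> norm (x - y) \<le> D" unfolding bounded_iff by auto
  obtain N where "D / r < 2 ^ N" using real_arch_pow[of 2 "D / r"] by auto
  then have N: "norm (x - y) \<le> 2 ^ N * r" if "y \<in> E" for y
    using D[OF that] pos(2) by (simp add: field_simps)
  have q: "0 < 2 powr (- \<eta>)" "2 powr (- \<eta>) < (1::real)" using pos(3) by (simp_all add: powr_less_one)
  have "(\<Sum>y\<in>E. riesz_kernel s r (x - y))
     \<le> (\<Sum>y\<in>E. \<Sum>k\<le>N. 2 powr s * 2 powr (- real k * s) * (if norm (x - y) \<le> 2 ^ k * r then 1 else 0))"
    using riesz_kernel_dyadic[OF pos(1,2) N] by (intro sum_mono)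
  also have "\<dots> = (\<Sum>k\<le>N. \<Sum>y\<in>E. 2 powr s * 2 powr (- real k * s) * (if norm (x - y) \<le> 2 ^ k * r then 1 else 0))"
    by (rule sum.swap)
  also have "\<dots> \<le> (\<Sum>k\<le>N. 2 powr s * A * (2 powr (- \<eta>)) ^ k)"
  proof (rule sum_mono)
    fix k
    have R: "r \<le> 2 ^ k * r" using pos(2) by simp
    have "(\<Sum>y\<in>E. if norm (x - y) \<le> 2 ^ k * r then 1 else 0) = real (card (E \<inter> cball x (2 ^ k * r)))"
      using E by (simp add: sum.If_cases dist_norm Int_def cball_def)
    also have "\<dots> \<le> A * (2 ^ k * r / r) powr (s - \<eta>)" by (rule count[OF R])
    also have "\<dots> = A * 2 powr (real k * (s - \<eta>))" using pos(2) by (simp add: powr_powr flip: powr_realpow)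
    finally have "2 powr s * 2 powr (- real k * s) * (\<Sum>y\<in>E. if norm (x - y) \<le> 2 ^ k * r then 1 else 0)
       \<le> 2 powr s * 2 powr (- real k * s) * (A * 2 powr (real k * (s - \<eta>)))"
      by (intro mult_left_mono) auto
    also have "\<dots> = 2 powr s * A * (2 powr (- real k * s) * 2 powr (real k * (s - \<eta>)))" by simp
    also have "2 powr (- real k * s) * 2 powr (real k * (s - \<eta>)) = 2 powr (- real k * s + real k * (s - \<eta>))"
      by (simp only: powr_add)
    also have "- real k * s + real k * (s - \<eta>) = - \<eta> * real k" by (simp add: algebra_simps)
    also have "2 powr (- \<eta> * real k) = (2 powr (- \<eta>)) ^ k"
    proof -
      have "2 powr (- \<eta> * real k) = (2 powr (- \<eta>)) powr real k" by (simp only: powr_powr)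
      then show ?thesis by (simp add: powr_realpow)
    qed
    finally show "(\<Sum>y\<in>E. 2 powr s * 2 powr (- real k * s) * (if norm (x - y) \<le> 2 ^ k * r then 1 else 0))
       \<le> 2 powr s * A * (2 powr (- \<eta>)) ^ k" by (simp only: sum_distrib_left)
  qed
  also have "\<dots> = 2 powr s * A * (\<Sum>k\<le>N. (2 powr (- \<eta>)) ^ k)" by (simp add: sum_distrib_left)
  also have "\<dots> \<le> 2 powr s * A * (1 / (1 - 2 powr (- \<eta>)))"
  proof (intro mult_left_mono)
    have "(\<Sum>k\<le>N. (2 powr (- \<eta>)) ^ k) \<le> (\<Sum>k. (2 powr (- \<eta>) :: real) ^ k)"
      using q by (intro sum_le_suminf summable_geometric) auto
    then show "(\<Sum>k\<le>N. (2 powr (- \<eta>)) ^ k) \<le> 1 / (1 - 2 powr (- \<eta>))"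
      using q by (simp add: suminf_geometric)
  qed (use pos in auto)
  finally show ?thesis by simp
qed

text \<open>Each entry of the maximum is solved for its dimension; the factor 1 - \<theta> becomes
  the division in the Assouad exponent. The strict inequalities provide admissible exponents below
  the stated ones, and these may be raised because R / r \<ge> 1.\<close>

lemma assouad_defect_less_imp:
  assumes "assouad_defect \<theta> s F < ereal \<delta>" "\<theta> < 1"
  shows "\<delta> > 0"
    "\<exists>C>0. \<forall>r R. \<forall>x\<in>F. 0 < r \<and> r < R \<longrightarrow>
        real (covering_number r (cball x R \<inter> F)) \<le> C * (R / r) powr (s + \<delta> / (1 - \<theta>))"
    "\<exists>C>0. \<forall>r R. \<forall>x\<in>F. 0 < r \<and> r \<le> R powr (1 / \<theta>) \<and> R powr (1 / \<theta>) < R \<and> R < 1 \<longrightarrow>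
        real (covering_number r (cball x R \<inter> F)) \<le> C * (R / r) powr (s + \<delta>)"
proof -
  have lt: "0 < ereal \<delta>" "upper_assouad_spectrum \<theta> F - ereal s < ereal \<delta>"
    "(assouad_dim F - ereal s) * ereal (1 - \<theta>) < ereal \<delta>"
    using assms(1) unfolding assouad_defect_def by (simp_all add: Max_less_iff)
  show "\<delta> > 0" using lt(1) by simp
  have "upper_assouad_spectrum \<theta> F < ereal (s + \<delta>)"
    using lt(2) by (cases "upper_assouad_spectrum \<theta> F") auto
  then obtain \<alpha> C where \<alpha>: "\<alpha> < s + \<delta>" "C > 0" "\<forall>r R. \<forall>x\<in>F.
            0 < r \<and> r \<le> R powr (1 / \<theta>) \<and> R powr (1 / \<theta>) < R \<and> R < 1 \<longrightarrow>
            real (covering_number r (cball x R \<inter> F)) \<le> C * (R / r) powr \<alpha>"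
    unfolding upper_assouad_spectrum_def Inf_less_iff by auto
  have mono: "C * y powr \<alpha> \<le> C * y powr \<beta>" if "C > 0" "y \<ge> 1" "\<alpha> < \<beta>" for C y \<alpha> \<beta> :: real
    using that by (intro mult_left_mono powr_mono) auto
  show "\<exists>C>0. \<forall>r R. \<forall>x\<in>F. 0 < r \<and> r \<le> R powr (1 / \<theta>) \<and> R powr (1 / \<theta>) < R \<and> R < 1 \<longrightarrow>
        real (covering_number r (cball x R \<inter> F)) \<le> C * (R / r) powr (s + \<delta>)"
  proof (intro exI[of _ C] conjI allI ballI impI)
    fix r R :: real and x assume "x \<in> F" and rR: "0 < r \<and> r \<le> R powr (1 / \<theta>) \<and> R powr (1 / \<theta>) < R \<and> R < 1"
    then have "real (covering_number r (cball x R \<inter> F)) \<le> C * (R / r) powr \<alpha>" using \<alpha>(3) by blast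
    also have "\<dots> \<le> C * (R / r) powr (s + \<delta>)" using rR by (intro mono \<alpha>) (simp add: field_simps)
    finally show "real (covering_number r (cball x R \<inter> F)) \<le> C * (R / r) powr (s + \<delta>)" .
  qed (rule \<alpha>(2))
  have "assouad_dim F < ereal (s + \<delta> / (1 - \<theta>))"
    using lt(3) assms(2) by (cases "assouad_dim F") (auto simp: field_simps)
  then obtain \<beta> D where \<beta>: "\<beta> < s + \<delta> / (1 - \<theta>)" "D > 0" "\<forall>r R. \<forall>x\<in>F. 0 < r \<and> r < R \<longrightarrow>
            real (covering_number r (cball x R \<inter> F)) \<le> D * (R / r) powr \<beta>"
    unfolding assouad_dim_def Inf_less_iff by auto
  show "\<exists>C>0. \<forall>r R. \<forall>x\<in>F. 0 < r \<and> r < R \<longrightarrow>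
        real (covering_number r (cball x R \<inter> F)) \<le> C * (R / r) powr (s + \<delta> / (1 - \<theta>))"
  proof (intro exI[of _ D] conjI allI ballI impI)
    fix r R :: real and x assume "x \<in> F" and rR: "0 < r \<and> r < R"
    then have "real (covering_number r (cball x R \<inter> F)) \<le> D * (R / r) powr \<beta>" using \<beta>(3) by blast
    also have "\<dots> \<le> D * (R / r) powr (s + \<delta> / (1 - \<theta>))" using rR by (intro mono \<beta>) (simp add: field_simps)
    finally show "real (covering_number r (cball x R \<inter> F)) \<le> D * (R / r) powr (s + \<delta> / (1 - \<theta>))" .
  qed (rule \<beta>(2))
qed

text \<open>The excess exponent \<open>c\<close> over the target exponent \<open>a\<close> is spent
  on the bound \<open>b\<close> for R / r. The factor 3 reflects covering at scale r / 3.\<close>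

lemma powr_base_mono_split:
  fixes R r :: real
  assumes "0 < r" "r \<le> R" "R / r \<le> b" "c \<ge> 0" "a \<ge> 0"
  shows "(3 * R / r) powr (a + c) \<le> 3 powr (a + c) * ((R / r) powr a * b powr c)"
proof -
  have "(3 * R / r) powr (a + c) = 3 powr (a + c) * (R / r) powr (a + c)"
    using assms by (simp flip: powr_mult)
  also have "(R / r) powr (a + c) = (R / r) powr a * (R / r) powr c" by (rule powr_add)
  also have "(R / r) powr a * (R / r) powr c \<le> (R / r) powr a * b powr c"
    using assms by (intro mult_left_mono powr_mono2) auto
  finally show ?thesis by simp
qed

text \<open>In the Assouad range R / r \<le> \<open>r powr (\<theta> - 1)\<close>, and in the
  spectrum range R / r \<le> 1 / r. Paying the excess exponents \<delta> / (1 - \<theta>) + \<eta>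
  and \<delta> + \<eta> at these rates costs at most \<open>r powr (-(\<delta> + \<eta>))\<close> in
  both, which is why the two terms of the defect are balanced by 1 - \<theta>. Radii R \<ge> 1 are
  reduced to finitely many balls of radius 1/2 by boundedness.\<close>

lemma assouad_count:
  fixes F :: "'a::euclidean_space set"
  assumes F: "bounded F" "F \<noteq> {}" and \<theta>: "0 < \<theta>" "\<theta> < 1" and defect: "assouad_defect \<theta> s F < ereal \<delta>"
    and \<eta>: "0 < \<eta>" "\<eta> \<le> s"
  shows "\<exists>C>0. \<exists>r0. 0 < r0 \<and> r0 < 1 \<and> (\<forall>r E x R. 0 < r \<longrightarrow> r < r0 \<longrightarrow> E \<subseteq> F \<longrightarrow>
     (\<forall>y\<in>E. \<forall>z\<in>E. y \<noteq> z \<longrightarrow> r / 2 < dist y z) \<longrightarrow> x \<in> F \<longrightarrow> r \<le> R \<longrightarrow>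
     real (card (E \<inter> cball x R)) \<le> C * r powr (-(\<delta> + \<eta>)) * (R / r) powr (s - \<eta>))"
proof -
  define \<beta> where "\<beta> = \<delta> / (1 - \<theta>)"
  note facts = assouad_defect_less_imp[OF defect \<theta>(2), folded \<beta>_def]
  have \<delta>: "\<delta> > 0" by (rule facts(1))
  have \<beta>: "\<beta> > 0" using \<delta> \<theta> by (simp add: \<beta>_def)
  obtain C1 where C1: "C1 > 0" "\<And>r R x. x \<in> F \<Longrightarrow> 0 < r \<Longrightarrow> r < R \<Longrightarrow>
        real (covering_number r (cball x R \<inter> F)) \<le> C1 * (R / r) powr (s + \<beta>)" using facts(2) by blast
  obtain C2 where C2: "C2 > 0" "\<And>r R x. x \<in> F \<Longrightarrow> 0 < r \<Longrightarrow> r \<le> R powr (1 / \<theta>) \<Longrightarrow> R powr (1 / \<theta>) < R \<Longrightarrow> R < 1 \<Longrightarrow>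
        real (covering_number r (cball x R \<inter> F)) \<le> C2 * (R / r) powr (s + \<delta>)" using facts(3) by blast
  obtain Z where Z: "finite Z" "Z \<subseteq> F" "F \<subseteq> (\<Union>z\<in>Z. cball z (1/2))"
    using maximal_separated_subset[OF F(1), of "1/2"] by (metis half_gt_zero zero_less_one)
  \<comment> \<open>Makes the spectrum bound applicable to the balls of radius 1/2 for all r <
    \<open>r0\<close>.\<close>
  define r0 where "r0 = (1/2::real) powr (1 / \<theta>)"
  have pow_less: "R powr (1 / \<theta>) < R" if "0 < R" "R < 1" for R :: real
  proof -
    have "R powr (1 / \<theta>) = R powr (1 / \<theta> - 1) * R powr 1" unfolding powr_add[symmetric] by simp
    also have "\<dots> < 1 * R" using that \<theta> powr01_less_one[OF that, of "1 / \<theta> - 1"]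
      by (intro mult_less_le_imp_less) auto
    finally show ?thesis by simp
  qed
  have r0: "0 < r0" "r0 < 1" using pow_less[of "1/2"] by (auto simp: r0_def)
  define C where "C = C1 * 3 powr (s + \<beta>) + (1 + real (card Z)) * (C2 * 3 powr (s + \<delta>))"
  have C: "C1 * 3 powr (s + \<beta>) \<le> C" "C2 * 3 powr (s + \<delta>) \<le> C" "real (card Z) * (C2 * 3 powr (s + \<delta>)) \<le> C" "C > 0"
  proof -
    have "0 < C1 * 3 powr (s + \<beta>)" "0 < C2 * 3 powr (s + \<delta>)" "0 \<le> real (card Z) * (C2 * 3 powr (s + \<delta>))" using C1(1) C2(1) by auto
    then show "C1 * 3 powr (s + \<beta>) \<le> C" "C2 * 3 powr (s + \<delta>) \<le> C" "real (card Z) * (C2 * 3 powr (s + \<delta>)) \<le> C" "C > 0"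
      unfolding C_def distrib_right by linarith+
  qed
  have "real (card (E \<inter> cball x R)) \<le> C * r powr (-(\<delta> + \<eta>)) * (R / r) powr (s - \<eta>)"
    if r: "0 < r" "r < r0" and E: "E \<subseteq> F" and sep: "\<forall>y\<in>E. \<forall>z\<in>E. y \<noteq> z \<longrightarrow> r / 2 < dist y z"
      and x: "x \<in> F" and R: "r \<le> R" for r E x R
  proof -
    have r1: "r < 1" using r r0 by simp
    \<comment> \<open>The scale r / 3 is below the separation, so a covering set holds at most one
      point; it is also strictly below R when R = r, as the Assouad bound requires.\<close>
    have count: "real (card (E \<inter> cball z T)) \<le> real (covering_number (r / 3) (cball z T \<inter> F))" for z T
    proof -
      have "card (E \<inter> cball z T) \<le> covering_number (r / 3) (cball z T \<inter> F)"
      proof (rule separated_card_le(2))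
        show "bounded (cball z T \<inter> F)" by (simp add: bounded_Int)
        fix y y' assume "y \<in> E \<inter> cball z T" "y' \<in> E \<inter> cball z T" "y \<noteq> y'"
        then have "r / 2 < dist y y'" using sep by blast
        then show "r / 3 < dist y y'" using r by simp
      qed (use r E in auto)
      then show ?thesis by simp
    qed
    have mid: "real (card (E \<inter> cball z T)) \<le> C2 * (3 * T / r) powr (s + \<delta>)"
      if "z \<in> F" "r \<le> T powr (1 / \<theta>)" "0 < T" "T < 1" for z T
    proof -
      have "real (covering_number (r / 3) (cball z T \<inter> F)) \<le> C2 * (T / (r / 3)) powr (s + \<delta>)"
        using that r by (intro C2(2) pow_less) auto
      then show ?thesis using count[of z T] by (simp add: mult.commute)
    qed
    have inv: "(1 / r) powr a = r powr (- a)" for a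
      using r by (simp add: powr_minus_divide powr_divide)
    have C_mono: "B * (u * v) \<le> C * v * u" if "B \<le> C" "0 \<le> u" "0 \<le> v" for B u v :: real
      using mult_right_mono[OF that(1), of "u * v"] that by (simp add: mult_ac)
    consider "R \<le> r powr \<theta>" | "r powr \<theta> < R" "R < 1" | "1 \<le> R" by linarith
    then show ?thesis
    proof cases
      case 1
      have "real (card (E \<inter> cball x R)) \<le> real (covering_number (r / 3) (cball x R \<inter> F))" by (rule count)
      also have "\<dots> \<le> C1 * (R / (r / 3)) powr (s + \<beta>)" using x r R by (intro C1(2)) auto
      also have "\<dots> = C1 * (3 * R / r) powr ((s - \<eta>) + (\<beta> + \<eta>))" by (simp add: mult.commute)
      also have "\<dots> \<le> C1 * (3 powr ((s - \<eta>) + (\<beta> + \<eta>)) * ((R / r) powr (s - \<eta>) * (r powr (\<theta> - 1)) powr (\<beta> + \<eta>)))"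
      proof (intro mult_left_mono powr_base_mono_split)
        show "R / r \<le> r powr (\<theta> - 1)" using 1 r(1) by (simp add: powr_diff divide_right_mono)
      qed (use r R \<eta> \<beta> C1 in auto)
      also have "\<dots> \<le> C1 * (3 powr ((s - \<eta>) + (\<beta> + \<eta>)) * ((R / r) powr (s - \<eta>) * r powr (-(\<delta> + \<eta>))))"
      proof (intro mult_left_mono)
        have "(1 - \<theta>) * \<beta> = \<delta>" using \<theta> by (simp add: \<beta>_def)
        moreover have "(1 - \<theta>) * \<eta> \<le> \<eta>" using \<theta> \<eta> by (simp add: mult_left_le_one_le)
        ultimately have "-(\<delta> + \<eta>) \<le> (\<theta> - 1) * (\<beta> + \<eta>)" by (simp add: algebra_simps)
        then show "(r powr (\<theta> - 1)) powr (\<beta> + \<eta>) \<le> r powr (-(\<delta> + \<eta>))"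
          unfolding powr_powr using r r1 by (intro powr_mono') auto
      qed (use C1 in auto)
      also have "\<dots> = C1 * 3 powr (s + \<beta>) * ((R / r) powr (s - \<eta>) * r powr (-(\<delta> + \<eta>)))" by simp
      also have "\<dots> \<le> C * r powr (-(\<delta> + \<eta>)) * (R / r) powr (s - \<eta>)" by (rule C_mono[OF C(1)]) auto
      finally show ?thesis .
    next
      case 2
      have "r = (r powr \<theta>) powr (1 / \<theta>)" using r \<theta> by (simp add: powr_powr)
      also have "\<dots> \<le> R powr (1 / \<theta>)" using 2 \<theta> by (intro powr_mono2) auto
      finally have "real (card (E \<inter> cball x R)) \<le> C2 * (3 * R / r) powr ((s - \<eta>) + (\<delta> + \<eta>))"
        using mid[OF x, of R] 2 r R by simp
      also have "\<dots> \<le> C2 * (3 powr ((s - \<eta>) + (\<delta> + \<eta>)) * ((R / r) powr (s - \<eta>) * (1 / r) powr (\<delta> + \<eta>)))"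
        using r R \<eta> \<delta> 2 C2(1) by (intro mult_left_mono powr_base_mono_split) (auto simp: divide_right_mono)
      also have "(1 / r) powr (\<delta> + \<eta>) = r powr (-(\<delta> + \<eta>))" by (rule inv)
      also have "C2 * (3 powr ((s - \<eta>) + (\<delta> + \<eta>)) * ((R / r) powr (s - \<eta>) * r powr (-(\<delta> + \<eta>))))
         = C2 * 3 powr (s + \<delta>) * ((R / r) powr (s - \<eta>) * r powr (-(\<delta> + \<eta>)))" by simp
      also have "\<dots> \<le> C * r powr (-(\<delta> + \<eta>)) * (R / r) powr (s - \<eta>)" by (rule C_mono[OF C(2)]) auto
      finally show ?thesis .
    next
      case 3
      have finE: "finite E" using separated_card_le(1)[OF F(1), of "r / 2" E] E sep r by auto
      have "card (E \<inter> cball x R) \<le> card (\<Union>z\<in>Z. E \<inter> cball z (1/2))"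
        using finE E Z by (intro card_mono) auto
      also have "\<dots> \<le> (\<Sum>z\<in>Z. card (E \<inter> cball z (1/2)))" using Z(1) by (rule card_UN_le)
      finally have "real (card (E \<inter> cball x R)) \<le> real (\<Sum>z\<in>Z. card (E \<inter> cball z (1/2)))" by (rule of_nat_mono)
      also have "\<dots> \<le> (\<Sum>z\<in>Z. C2 * (3 * (1/2) / r) powr (s + \<delta>))"
        unfolding of_nat_sum
      proof (rule sum_mono)
        fix z assume "z \<in> Z"
        then show "real (card (E \<inter> cball z (1/2))) \<le> C2 * (3 * (1/2) / r) powr (s + \<delta>)"
          using Z(2) r by (intro mid) (auto simp: r0_def)
      qed
      also have "\<dots> = real (card Z) * (C2 * (3 * (1/2) / r) powr ((s - \<eta>) + (\<delta> + \<eta>)))" by simp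
      also have "\<dots> \<le> real (card Z) * (C2 * (3 powr ((s - \<eta>) + (\<delta> + \<eta>)) * ((R / r) powr (s - \<eta>) * (1 / r) powr (\<delta> + \<eta>))))"
      proof (intro mult_left_mono)
        have "(3 * (1/2) / r) powr ((s - \<eta>) + (\<delta> + \<eta>)) \<le> (3 / r) powr ((s - \<eta>) + (\<delta> + \<eta>))"
          using r \<eta> \<delta> by (intro powr_mono2 divide_right_mono) auto
        also have "\<dots> \<le> 3 powr ((s - \<eta>) + (\<delta> + \<eta>)) * ((1 / r) powr (s - \<eta>) * (1 / r) powr (\<delta> + \<eta>))"
          using powr_base_mono_split[of r 1 "1 / r" "\<delta> + \<eta>" "s - \<eta>"] r r1 \<eta> \<delta> by simp
        also have "\<dots> \<le> 3 powr ((s - \<eta>) + (\<delta> + \<eta>)) * ((R / r) powr (s - \<eta>) * (1 / r) powr (\<delta> + \<eta>))"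
          using r 3 \<eta> by (intro mult_left_mono mult_right_mono powr_mono2 divide_right_mono) auto
        finally show "(3 * (1/2) / r) powr ((s - \<eta>) + (\<delta> + \<eta>)) \<le> 3 powr ((s - \<eta>) + (\<delta> + \<eta>)) * ((R / r) powr (s - \<eta>) * (1 / r) powr (\<delta> + \<eta>))" .
      qed (use C2 in auto)
      also have "(1 / r) powr (\<delta> + \<eta>) = r powr (-(\<delta> + \<eta>))" by (rule inv)
      also have "real (card Z) * (C2 * (3 powr ((s - \<eta>) + (\<delta> + \<eta>)) * ((R / r) powr (s - \<eta>) * r powr (-(\<delta> + \<eta>)))))
         = real (card Z) * (C2 * 3 powr (s + \<delta>)) * ((R / r) powr (s - \<eta>) * r powr (-(\<delta> + \<eta>)))" by simp
      also have "\<dots> \<le> C * r powr (-(\<delta> + \<eta>)) * (R / r) powr (s - \<eta>)" by (rule C_mono[OF C(3)]) auto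
      finally show ?thesis .
    qed
  qed
  then show ?thesis using C(4) r0 by (intro exI[of _ C] conjI exI[of _ r0] allI impI) auto
qed

text \<open>The double count bounds mass times (card E)^2 by a potential summed over
  \<open>E\<close>; one factor \<open>card E\<close> cancels. As \<open>E\<close> is r/2-separated
  and its r/2-balls have diameter at most r and cover \<open>F\<close>, \<open>card E\<close> is at
  least the covering number of \<open>F\<close> at scale r, the only comparison needed in the
  end.\<close>

lemma content_small_projections:
  fixes F :: "'a::euclidean_space set" and m :: nat
  assumes m: "m < DIM('a)" and F: "bounded F" "F \<noteq> {}" and \<theta>: "0 < \<theta>" "\<theta> < 1" and s: "s > 0"
    and defect: "assouad_defect \<theta> s F < ereal \<delta>" and "\<delta> < \<delta>'"
    and t: "t = real (m * (DIM('a) - 1 - m)) + s"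
  shows "\<exists>C>0. \<exists>r0. 0 < r0 \<and> r0 < 1 \<and> (\<forall>r M. 0 < r \<longrightarrow> r < r0 \<longrightarrow> 0 < M \<longrightarrow>
     hausdorff_content t (proj_op ` {V \<in> grassmannian m. real (covering_number r (orth_proj V ` F)) \<le> M})
       \<le> ennreal (C * M * r powr (-\<delta>') / real (covering_number r F)))"
proof -
  \<comment> \<open>The spare \<delta>' - \<delta> pays for the geometric series; the cap at
    \<open>s\<close> keeps the exponent s - \<eta> nonnegative.\<close>
  define \<eta> where "\<eta> = min (\<delta>' - \<delta>) s"
  have \<eta>: "0 < \<eta>" "\<eta> \<le> s" "\<delta> + \<eta> \<le> \<delta>'" using s \<open>\<delta> < \<delta>'\<close> by (auto simp: \<eta>_def)
  obtain C1 r0 where C1: "C1 > 0" and r0: "0 < r0" "r0 < 1"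
    and count: "\<And>r E x R. 0 < r \<Longrightarrow> r < r0 \<Longrightarrow> E \<subseteq> F \<Longrightarrow>
     (\<forall>y\<in>E. \<forall>z\<in>E. y \<noteq> z \<longrightarrow> r / 2 < dist y z) \<Longrightarrow> x \<in> F \<Longrightarrow> r \<le> R \<Longrightarrow>
     real (card (E \<inter> cball x R)) \<le> C1 * r powr (-(\<delta> + \<eta>)) * (R / r) powr (s - \<eta>)"
    using assouad_count[OF F \<theta> defect \<eta>(1,2)] by blast
  obtain C0 where C0: "C0 > 0" and frostman: "\<forall>(\<V> :: 'a set set) N. \<V> \<subseteq> grassmannian m \<longrightarrow>
    (\<exists>P w. finite P \<and> P \<subseteq> \<V> \<and> (\<forall>V. 0 \<le> w V) \<and>
      (\<forall>x r. 0 < r \<longrightarrow> (1/2)^N * norm x \<le> r \<longrightarrow>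
         sum w {V\<in>P. norm (orth_proj V x) \<le> r} \<le> C0 * riesz_kernel s r x) \<and>
      hausdorff_content t (proj_op ` \<V>) \<le> ennreal (C0 * sum w P))"
    using frostman_grassmannian[OF m s t] by blast
  define C2 where "C2 = 2 powr s / (1 - 2 powr (- \<eta>))"
  have C2: "C2 > 0" unfolding C2_def using \<eta>(1) by (intro divide_pos_pos) (auto simp: powr_less_one)
  define C where "C = C0 * C0 * C2 * C1"
  have C: "C > 0" using C0 C1 C2 by (simp add: C_def)
  have "hausdorff_content t (proj_op ` {V \<in> grassmannian m. real (covering_number r (orth_proj V ` F)) \<le> M})
       \<le> ennreal (C * M * r powr (-\<delta>') / real (covering_number r F))"
    if r: "0 < r" "r < r0" and M: "0 < M" for r M
  proof -
    define \<V> where "\<V> = {V :: 'a set. V \<in> grassmannian m \<and> real (covering_number r (orth_proj V ` F)) \<le> M}"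
    obtain E where E: "finite E" "E \<subseteq> F" "\<And>x y. x \<in> E \<Longrightarrow> y \<in> E \<Longrightarrow> x \<noteq> y \<Longrightarrow> r / 2 < dist x y"
      "F \<subseteq> (\<Union>x\<in>E. cball x (r / 2))"
      by (rule maximal_separated_subset[OF F(1), of "r / 2"]) (use r in auto)
    have NE: "covering_number r F \<le> card E"
    proof -
      have "covering_number r F \<le> card ((\<lambda>x. cball x (r / 2)) ` E)"
        using E r by (intro covering_number_le) auto
      also have "\<dots> \<le> card E" by (rule card_image_le[OF E(1)])
      finally show ?thesis .
    qed
    have Npos: "0 < covering_number r F" by (rule covering_number_pos[OF F(1) r(1) F(2)])
    have Epos: "0 < real (card E)" using NE Npos by simp
    obtain D where D: "\<And>x. x \<in> F \<Longrightarrow> norm x \<le> D" using F(1) unfolding bounded_iff by blast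
    have D2: "norm (x - y) \<le> 2 * D" if "x \<in> E" "y \<in> E" for x y
      using norm_triangle_ineq4[of x y] D[of x] D[of y] that E(2) by force
    \<comment> \<open>The depth of the tree adapted to r: every slab belonging to a difference of
      two points of \<open>E\<close> is wide enough for the mass bound.\<close>
    obtain N where N: "2 * D / r < 2 ^ N" using real_arch_pow[of 2 "2 * D / r"] by auto
    have N: "(1/2)^N * norm (x - y) \<le> r" if "x \<in> E" "y \<in> E" for x y
    proof -
      have "norm (x - y) < 2 ^ N * r" using D2[OF that] N r(1) by (simp add: field_simps)
      then show ?thesis by (simp add: field_simps)
    qed
    have "\<V> \<subseteq> grassmannian m" by (auto simp: \<V>_def)
    from frostman[rule_format, OF this, of N]
    obtain P w where P: "finite P" "P \<subseteq> \<V>" and w0: "\<forall>V. 0 \<le> w V"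
      and slab0: "\<forall>x r. 0 < r \<longrightarrow> (1/2)^N * norm x \<le> r \<longrightarrow>
         sum w {V\<in>P. norm (orth_proj V x) \<le> r} \<le> C0 * riesz_kernel s r x"
      and content: "hausdorff_content t (proj_op ` \<V>) \<le> ennreal (C0 * sum w P)"
      by (elim exE conjE) (rule that; assumption)
    note w = w0[rule_format] and slab = slab0[rule_format]
    have pairs: "(real (card E))\<^sup>2 \<le> M * (\<Sum>x\<in>E. \<Sum>y\<in>E. if norm (orth_proj V (x - y)) \<le> r then 1 else 0)"
      if V: "V \<in> P" for V
    proof -
      have VV: "subspace V" "real (covering_number r (orth_proj V ` F)) \<le> M"
        using V P(2) by (auto simp: \<V>_def grassmannian_def)
      have lin: "bounded_linear (orth_proj V)" by (rule bounded_linear_orth_proj[OF VV(1)])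
      have "bounded (orth_proj V ` F)" by (rule bounded_linear_image[OF F(1) lin])
      then obtain S where S: "finite S" "card S = covering_number r (orth_proj V ` F)" "orth_proj V ` F \<subseteq> \<Union>S"
        "\<forall>U\<in>S. bounded U \<and> diameter U \<le> r"
        using covering_number_attained[OF _ r(1)] by metis
      \<comment> \<open>Points assigned to the same covering set have projections within r, so
        collisions of \<open>g\<close> are among the pairs to be counted.\<close>
      have "\<forall>x\<in>E. \<exists>U. U \<in> S \<and> orth_proj V x \<in> U" using S(3) E(2) by blast
      from bchoice[OF this] obtain g where g: "\<forall>x\<in>E. g x \<in> S \<and> orth_proj V x \<in> g x" ..
      have "(real (card E))\<^sup>2 \<le> real (card S) * real (card {(x, y). x \<in> E \<and> y \<in> E \<and> g x = g y})"
        using g S(1) E(1) by (intro card_sq_le_collisions) auto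
      also have "\<dots> \<le> M * real (card {(x, y). x \<in> E \<and> y \<in> E \<and> norm (orth_proj V (x - y)) \<le> r})"
      proof (intro mult_mono of_nat_mono card_mono)
        have "{(x, y). x \<in> E \<and> y \<in> E \<and> norm (orth_proj V (x - y)) \<le> r} \<subseteq> E \<times> E" by auto
        then show "finite {(x, y). x \<in> E \<and> y \<in> E \<and> norm (orth_proj V (x - y)) \<le> r}"
          using E(1) by (meson finite_SigmaI finite_subset)
        have "norm (orth_proj V (x - y)) \<le> r" if xy: "x \<in> E" "y \<in> E" "g x = g y" for x y
        proof -
          have "g x \<in> S" "orth_proj V x \<in> g x" "orth_proj V y \<in> g x" using g xy by auto
          then have "dist (orth_proj V x) (orth_proj V y) \<le> r"
            using S(4) diameter_bounded_bound[of "g x"] order_trans by blast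
          then show ?thesis using lin by (simp add: dist_norm bounded_linear.linear linear_diff)
        qed
        then show "{(x, y). x \<in> E \<and> y \<in> E \<and> g x = g y} \<subseteq> {(x, y). x \<in> E \<and> y \<in> E \<and> norm (orth_proj V (x - y)) \<le> r}"
          by auto
      qed (use VV(2) S(2) M in auto)
      also have "real (card {(x, y). x \<in> E \<and> y \<in> E \<and> norm (orth_proj V (x - y)) \<le> r})
        = (\<Sum>x\<in>E. \<Sum>y\<in>E. if norm (orth_proj V (x - y)) \<le> r then 1 else 0)"
      proof -
        have "{(x, y). x \<in> E \<and> y \<in> E \<and> norm (orth_proj V (x - y)) \<le> r} = (SIGMA x:E. {y\<in>E. norm (orth_proj V (x - y)) \<le> r})"
          by auto
        then show ?thesis using E(1) by (simp add: card_SigmaI sum.If_cases Int_def)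
      qed
      finally show ?thesis .
    qed
    have "sum w P * (real (card E))\<^sup>2 = (\<Sum>V\<in>P. w V * (real (card E))\<^sup>2)" by (simp add: sum_distrib_right)
    also have "\<dots> \<le> (\<Sum>V\<in>P. w V * (M * (\<Sum>x\<in>E. \<Sum>y\<in>E. if norm (orth_proj V (x - y)) \<le> r then 1 else 0)))"
      using pairs w by (intro sum_mono mult_left_mono)
    also have "\<dots> = M * (\<Sum>V\<in>P. \<Sum>x\<in>E. \<Sum>y\<in>E. if norm (orth_proj V (x - y)) \<le> r then w V else 0)"
      by (simp add: sum_distrib_left if_distrib mult_ac cong: if_cong)
    also have "(\<Sum>V\<in>P. \<Sum>x\<in>E. \<Sum>y\<in>E. if norm (orth_proj V (x - y)) \<le> r then w V else 0)
      = (\<Sum>x\<in>E. \<Sum>y\<in>E. \<Sum>V\<in>P. if norm (orth_proj V (x - y)) \<le> r then w V else 0)"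
      by (subst sum.swap, intro sum.cong refl sum.swap)
    also have "\<dots> = (\<Sum>x\<in>E. \<Sum>y\<in>E. sum w {V\<in>P. norm (orth_proj V (x - y)) \<le> r})"
      using P(1) by (simp add: sum.If_cases Int_def)
    also have "M * \<dots> \<le> M * (\<Sum>x\<in>E. \<Sum>y\<in>E. C0 * riesz_kernel s r (x - y))"
      using M slab[OF r(1) N] by (intro mult_left_mono sum_mono) auto
    also have "\<dots> = M * C0 * (\<Sum>x\<in>E. \<Sum>y\<in>E. riesz_kernel s r (x - y))" by (simp add: sum_distrib_left mult_ac)
    also have "\<dots> \<le> M * C0 * (\<Sum>x\<in>E. C2 * C1 * r powr (-(\<delta> + \<eta>)))"
    proof (intro mult_left_mono sum_mono)
      fix x assume x: "x \<in> E"
      have "(\<Sum>y\<in>E. riesz_kernel s r (x - y)) \<le> 2 powr s * (C1 * r powr (-(\<delta> + \<eta>))) / (1 - 2 powr (- \<eta>))"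
      proof (rule sum_riesz_kernel_le[OF E(1) s r(1) \<eta>(1)])
        fix R assume "r \<le> R"
        then show "real (card (E \<inter> cball x R)) \<le> C1 * r powr (-(\<delta> + \<eta>)) * (R / r) powr (s - \<eta>)"
          using count[OF r E(2), of x R] E(2,3) x by blast
      qed (use C1 in auto)
      then show "(\<Sum>y\<in>E. riesz_kernel s r (x - y)) \<le> C2 * C1 * r powr (-(\<delta> + \<eta>))" by (simp add: C2_def mult.assoc)
    qed (use M C0 in auto)
    also have "\<dots> = (M * C0 * C2 * C1 * r powr (-(\<delta> + \<eta>))) * card E" by simp
    finally have "sum w P * real (card E) \<le> M * C0 * C2 * C1 * r powr (-(\<delta> + \<eta>))"
      using Epos by (simp add: power2_eq_square mult.assoc[symmetric])
    also have "\<dots> \<le> M * C0 * C2 * C1 * r powr (-\<delta>')"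
      using M C0 C1 C2 r r0 \<eta>(3) by (intro mult_left_mono powr_mono') auto
    finally have le: "sum w P * real (card E) \<le> M * C0 * C2 * C1 * r powr (-\<delta>')" .
    have "sum w P * real (covering_number r F) \<le> sum w P * real (card E)"
      using NE w by (intro mult_left_mono sum_nonneg) auto
    then have "sum w P * real (covering_number r F) \<le> M * C0 * C2 * C1 * r powr (-\<delta>')" using le by (rule order_trans)
    then have "sum w P \<le> M * C0 * C2 * C1 * r powr (-\<delta>') / real (covering_number r F)"
      using Npos by (simp add: field_simps)
    then have "C0 * sum w P \<le> C0 * (M * C0 * C2 * C1 * r powr (-\<delta>') / real (covering_number r F))"
      using C0 by (intro mult_left_mono) auto
    also have "\<dots> = C * M * r powr (-\<delta>') / real (covering_number r F)" by (simp add: C_def)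
    finally have "ennreal (C0 * sum w P) \<le> ennreal (C * M * r powr (-\<delta>') / real (covering_number r F))"
      by (rule ennreal_leI)
    then show ?thesis using content unfolding \<V>_def by (meson order_trans)
  qed
  then show ?thesis using C r0 by (intro exI[of _ C] conjI exI[of _ r0] allI impI) auto
qed

subsection \<open>Exceptional sets for the box dimensions\<close>

lemma ratio_le_iff:
  assumes "0 < N" "0 < r" "r < 1"
  shows "ereal (ln (real N) / - ln r) \<le> ereal p \<longleftrightarrow> real N \<le> r powr (- p)"
    and "ereal p \<le> ereal (ln (real N) / - ln r) \<longleftrightarrow> r powr (- p) \<le> real N"
proof -
  have l: "- ln r > 0" using assms by simp
  have pw: "ln (r powr (- p)) = p * (- ln r)" using assms by (simp add: ln_powr)
  have "ereal (ln (real N) / - ln r) \<le> ereal p \<longleftrightarrow> ln (real N) \<le> p * (- ln r)"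
    using l unfolding ereal_less_eq(3) by (rule pos_divide_le_eq)
  also have "\<dots> \<longleftrightarrow> real N \<le> r powr (- p)"
    unfolding pw[symmetric] using assms by (intro ln_le_cancel_iff) auto
  finally show "ereal (ln (real N) / - ln r) \<le> ereal p \<longleftrightarrow> real N \<le> r powr (- p)" .
  have "ereal p \<le> ereal (ln (real N) / - ln r) \<longleftrightarrow> p * (- ln r) \<le> ln (real N)"
    using l unfolding ereal_less_eq(3) by (rule pos_le_divide_eq)
  also have "\<dots> \<longleftrightarrow> r powr (- p) \<le> real N"
    unfolding pw[symmetric] using assms by (intro ln_le_cancel_iff) auto
  finally show "ereal p \<le> ereal (ln (real N) / - ln r) \<longleftrightarrow> r powr (- p) \<le> real N" .
qed

lemma eventually_at_right_0_lt: "(0::real) < c \<Longrightarrow> eventually (\<lambda>r. 0 < r \<and> r < c) (at_right 0)"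
  unfolding eventually_at_right_field by (intro exI[of _ c]) auto

lemma upper_box_dim_less_imp:
  fixes E :: "'a::euclidean_space set"
  assumes "bounded E" "E \<noteq> {}" "upper_box_dim E < ereal p"
  shows "eventually (\<lambda>r. real (covering_number r E) \<le> r powr (- p)) (at_right 0)"
proof -
  have "eventually (\<lambda>r. ereal (ln (real (covering_number r E)) / - ln r) < ereal p) (at_right 0)"
    using assms(3) unfolding upper_box_dim_def by (metis Limsup_le_iff order_refl)
  moreover have "eventually (\<lambda>r::real. 0 < r \<and> r < 1) (at_right 0)" by (rule eventually_at_right_0_lt) simp
  ultimately show ?thesis
    by eventually_elim (use ratio_le_iff(1) covering_number_pos[OF assms(1) _ assms(2)] less_imp_le in metis)
qed

lemma upper_box_dim_greater_imp:
  fixes E :: "'a::euclidean_space set"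
  assumes "bounded E" "E \<noteq> {}" "ereal q < upper_box_dim E"
  shows "frequently (\<lambda>r. r powr (- q) \<le> real (covering_number r E)) (at_right 0)"
proof (rule ccontr)
  assume "\<not> ?thesis"
  then have "eventually (\<lambda>r. \<not> r powr (- q) \<le> real (covering_number r E)) (at_right 0)"
    by (simp add: not_frequently)
  moreover have "eventually (\<lambda>r::real. 0 < r \<and> r < 1) (at_right 0)" by (rule eventually_at_right_0_lt) simp
  ultimately have "eventually (\<lambda>r. ereal (ln (real (covering_number r E)) / - ln r) \<le> ereal q) (at_right 0)"
    by eventually_elim (use ratio_le_iff(2) covering_number_pos[OF assms(1) _ assms(2)] linear in metis)
  then have "upper_box_dim E \<le> ereal q" unfolding upper_box_dim_def by (rule Limsup_bounded)
  with assms(3) show False by simp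
qed

lemma lower_box_dim_greater_imp:
  fixes E :: "'a::euclidean_space set"
  assumes "bounded E" "E \<noteq> {}" "ereal q < lower_box_dim E"
  shows "eventually (\<lambda>r. r powr (- q) \<le> real (covering_number r E)) (at_right 0)"
proof -
  have "eventually (\<lambda>r. ereal q < ereal (ln (real (covering_number r E)) / - ln r)) (at_right 0)"
    using assms(3) unfolding lower_box_dim_def by (metis le_Liminf_iff order_refl)
  moreover have "eventually (\<lambda>r::real. 0 < r \<and> r < 1) (at_right 0)" by (rule eventually_at_right_0_lt) simp
  ultimately show ?thesis
    by eventually_elim (use ratio_le_iff(2) covering_number_pos[OF assms(1) _ assms(2)] less_imp_le in metis)
qed

lemma lower_box_dim_less_imp:
  fixes E :: "'a::euclidean_space set"
  assumes "bounded E" "E \<noteq> {}" "lower_box_dim E < ereal p"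
  shows "frequently (\<lambda>r. real (covering_number r E) \<le> r powr (- p)) (at_right 0)"
proof (rule ccontr)
  assume "\<not> ?thesis"
  then have "eventually (\<lambda>r. \<not> real (covering_number r E) \<le> r powr (- p)) (at_right 0)"
    by (simp add: not_frequently)
  moreover have "eventually (\<lambda>r::real. 0 < r \<and> r < 1) (at_right 0)" by (rule eventually_at_right_0_lt) simp
  ultimately have "eventually (\<lambda>r. ereal p \<le> ereal (ln (real (covering_number r E)) / - ln r)) (at_right 0)"
    by eventually_elim (use ratio_le_iff(1) covering_number_pos[OF assms(1) _ assms(2)] linear in metis)
  then have "ereal p \<le> lower_box_dim E" unfolding lower_box_dim_def by (rule Liminf_bounded)
  with assms(3) show False by simp
qed

lemma ennreal_eq_0_if_le_eps:
  fixes x :: ennreal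
  assumes "\<And>e::real. e > 0 \<Longrightarrow> x \<le> ennreal e"
  shows "x = 0"
proof -
  have "x \<le> 0" by (rule ennreal_le_epsilon) (use assms in simp)
  then show ?thesis by simp
qed

lemma eventually_powr_le:
  assumes "a > 0" "C \<ge> 0" "e > 0"
  shows "eventually (\<lambda>r::real. C * r powr a \<le> e) (at_right 0)"
proof -
  have "((\<lambda>r::real. r powr a) \<longlongrightarrow> 0) (at_right 0)"
    using assms(1) by (intro tendsto_eq_intros) (auto simp: eventually_at_right_0_lt intro!: eventually_mono[OF eventually_at_right_0_lt[of 1]])
  then have "((\<lambda>r::real. C * r powr a) \<longlongrightarrow> 0) (at_right 0)" by (rule tendsto_mult_right_zero)
  then have "eventually (\<lambda>r::real. C * r powr a < e) (at_right 0)" using assms(3) by (rule order_tendstoD(2))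
  then show ?thesis by (rule eventually_mono) simp
qed

context
  fixes F :: "'a::euclidean_space set" and m :: nat and \<theta> s \<delta> t p q :: real
  assumes m: "m < DIM('a)" and F: "bounded F" "F \<noteq> {}" and \<theta>: "0 < \<theta>" "\<theta> < 1" and s: "s > 0"
    and defect: "assouad_defect \<theta> s F < ereal \<delta>"
    and t: "t = real (m * (DIM('a) - 1 - m)) + s" and pq: "p + \<delta> < q"
begin

text \<open>The gain \<gamma> is half of the gap q - p - \<delta>, the other half having gone into
  \<delta>'. The factor \<open>c\<close> leaves room for replacing arbitrary scales by dyadic
  ones.\<close>

lemma content_small_projections_ratio:
  "\<exists>C>0. \<exists>\<gamma>>0. \<exists>r0. 0 < r0 \<and> r0 < 1 \<and> (\<forall>r c. 0 < r \<longrightarrow> r < r0 \<longrightarrow> 0 < c \<longrightarrow> r powr (- q) \<le> real (covering_number r F) \<longrightarrow>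
     hausdorff_content t (proj_op ` {V \<in> grassmannian m. real (covering_number r (orth_proj V ` F)) \<le> c * r powr (- p)})
       \<le> ennreal (C * c * r powr \<gamma>))"
proof -
  define \<delta>' where "\<delta>' = (\<delta> + (q - p)) / 2"
  have \<delta>': "\<delta> < \<delta>'" "0 < q - p - \<delta>'" using pq by (auto simp: \<delta>'_def field_simps)
  obtain C r0 where C: "C > 0" and r0: "0 < r0" "r0 < 1"
    and main: "\<And>r M. 0 < r \<Longrightarrow> r < r0 \<Longrightarrow> 0 < M \<Longrightarrow>
     hausdorff_content t (proj_op ` {V \<in> grassmannian m. real (covering_number r (orth_proj V ` F)) \<le> M})
       \<le> ennreal (C * M * r powr (-\<delta>') / real (covering_number r F))"
    using content_small_projections[OF m F \<theta> s defect \<delta>'(1) t] by blast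
  have "hausdorff_content t (proj_op ` {V \<in> grassmannian m. real (covering_number r (orth_proj V ` F)) \<le> c * r powr (- p)})
       \<le> ennreal (C * c * r powr (q - p - \<delta>'))"
    if r: "0 < r" "r < r0" and c: "0 < c" and N: "r powr (- q) \<le> real (covering_number r F)" for r c
  proof -
    have "hausdorff_content t (proj_op ` {V \<in> grassmannian m. real (covering_number r (orth_proj V ` F)) \<le> c * r powr (- p)})
       \<le> ennreal (C * (c * r powr (- p)) * r powr (-\<delta>') / real (covering_number r F))"
      using r c by (intro main) auto
    also have "\<dots> \<le> ennreal (C * (c * r powr (- p)) * r powr (-\<delta>') / r powr (- q))"
      using N r c C order_less_le_trans[OF _ N, of 0] by (intro ennreal_leI divide_left_mono) auto
    also have "C * (c * r powr (- p)) * r powr (-\<delta>') / r powr (- q) = C * c * r powr (q - p - \<delta>')"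
    proof -
      have "q - p - \<delta>' = (- p + - \<delta>') - (- q)" by simp
      then have "r powr (q - p - \<delta>') = r powr (- p) * r powr (- \<delta>') / r powr (- q)"
        by (metis powr_add powr_diff)
      then show ?thesis by simp
    qed
    finally show ?thesis .
  qed
  then show ?thesis using C \<delta>'(2) r0 by (intro exI[of _ C] conjI exI[of _ "q - p - \<delta>'"] exI[of _ r0] allI impI) auto
qed

text \<open>An exceptional V has few covering sets at all scales below some 1 / (k + 1), while
  \<open>F\<close> needs many at arbitrarily small scales. For fixed k a single scale therefore
  bounds the content of all these V together, and that scale may tend to 0. No sum over scales
  arises.\<close>

lemma content_upper_box_exceptional:
  assumes q: "ereal q < upper_box_dim F"
  shows "hausdorff_content t (proj_op ` {V \<in> grassmannian m. upper_box_dim (orth_proj V ` F) < ereal p}) = 0"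
proof -
  have t0: "t > 0" using t s by (simp add: add_nonneg_pos)
  obtain C \<gamma> r0 where C: "C > 0" and \<gamma>: "\<gamma> > 0" and r0: "0 < r0" "r0 < 1"
    and main: "\<And>r c. 0 < r \<Longrightarrow> r < r0 \<Longrightarrow> 0 < c \<Longrightarrow> r powr (- q) \<le> real (covering_number r F) \<Longrightarrow>
     hausdorff_content t (proj_op ` {V \<in> grassmannian m. real (covering_number r (orth_proj V ` F)) \<le> c * r powr (- p)})
       \<le> ennreal (C * c * r powr \<gamma>)"
    using content_small_projections_ratio by blast
  define B where "B k = {V \<in> grassmannian m. \<forall>r. 0 < r \<longrightarrow> r < 1 / real (Suc k) \<longrightarrow>
      real (covering_number r (orth_proj V ` F)) \<le> r powr (- p)}" for k :: nat
  have null: "hausdorff_content t (proj_op ` B k) = 0" for k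
  proof (rule ennreal_eq_0_if_le_eps)
    fix e :: real assume e: "e > 0"
    have "frequently (\<lambda>r. r powr (- q) \<le> real (covering_number r F)) (at_right 0)"
      by (rule upper_box_dim_greater_imp[OF F q])
    moreover have "eventually (\<lambda>r. C * r powr \<gamma> \<le> e \<and> (0 < r \<and> r < min r0 (1 / real (Suc k)))) (at_right 0)"
      using C r0 e \<gamma> by (intro eventually_conj eventually_powr_le eventually_at_right_0_lt) auto
    ultimately have "frequently (\<lambda>r. (C * r powr \<gamma> \<le> e \<and> (0 < r \<and> r < min r0 (1 / real (Suc k)))) \<and>
        r powr (- q) \<le> real (covering_number r F)) (at_right 0)"
      by (rule frequently_eventually_conj)
    from frequently_ex[OF this]
    obtain r where r: "C * r powr \<gamma> \<le> e" "0 < r" "r < r0" "r < 1 / real (Suc k)" "r powr (- q) \<le> real (covering_number r F)"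
      unfolding min_less_iff_conj by blast
    have "hausdorff_content t (proj_op ` B k)
       \<le> hausdorff_content t (proj_op ` {V \<in> grassmannian m. real (covering_number r (orth_proj V ` F)) \<le> 1 * r powr (- p)})"
      using r by (intro hausdorff_content_mono image_mono) (auto simp: B_def)
    also have "\<dots> \<le> ennreal (C * 1 * r powr \<gamma>)" using r by (intro main) auto
    also have "\<dots> \<le> ennreal e" using r(1) by (intro ennreal_leI) simp
    finally show "hausdorff_content t (proj_op ` B k) \<le> ennreal e" .
  qed
  have "proj_op ` {V \<in> grassmannian m. upper_box_dim (orth_proj V ` F) < ereal p} \<subseteq> (\<Union>k\<in>UNIV. proj_op ` B k)"
  proof -
    have "\<exists>k. V \<in> B k" if V: "V \<in> grassmannian m" "upper_box_dim (orth_proj V ` F) < ereal p" for V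
    proof -
      have "bounded (orth_proj V ` F)"
        using V(1) by (intro bounded_linear_image F bounded_linear_orth_proj) (simp add: grassmannian_def)
      then have "eventually (\<lambda>r. real (covering_number r (orth_proj V ` F)) \<le> r powr (- p)) (at_right 0)"
        using V(2) F(2) by (intro upper_box_dim_less_imp) auto
      then obtain b where b: "b > 0" "\<And>r. 0 < r \<Longrightarrow> r < b \<Longrightarrow> real (covering_number r (orth_proj V ` F)) \<le> r powr (- p)"
        unfolding eventually_at_right_field by blast
      obtain k where "1 / real (Suc k) < b" using nat_approx_posE[OF b(1)] by metis
      then show ?thesis using V(1) b(2) by (intro exI[of _ k]) (auto simp: B_def)
    qed
    then show ?thesis by blast
  qed
  then have "hausdorff_content t (proj_op ` {V \<in> grassmannian m. upper_box_dim (orth_proj V ` F) < ereal p})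
      \<le> hausdorff_content t (\<Union>k\<in>UNIV. proj_op ` B k)" by (rule hausdorff_content_mono)
  also have "\<dots> = 0" by (rule hausdorff_content_countable_UN_eq_0) (auto simp: null t0)
  finally show ?thesis by simp
qed

text \<open>The quantifiers are reversed: \<open>F\<close> is large at all small scales, but the
  scales at which a projection is small depend on V. Hence the exceptional set is covered, for every
  starting level, by the sets of all later dyadic levels, and their contents form the tail of a
  geometric series.\<close>

lemma content_lower_box_exceptional:
  assumes q: "ereal q < lower_box_dim F"
  shows "hausdorff_content t (proj_op ` {V \<in> grassmannian m. lower_box_dim (orth_proj V ` F) < ereal p}) = 0"
proof (rule ennreal_eq_0_if_le_eps)
  fix e :: real assume e: "e > 0"
  obtain C \<gamma> r0 where C: "C > 0" and \<gamma>: "\<gamma> > 0" and r0: "0 < r0" "r0 < 1"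
    and main: "\<And>r c. 0 < r \<Longrightarrow> r < r0 \<Longrightarrow> 0 < c \<Longrightarrow> r powr (- q) \<le> real (covering_number r F) \<Longrightarrow>
     hausdorff_content t (proj_op ` {V \<in> grassmannian m. real (covering_number r (orth_proj V ` F)) \<le> c * r powr (- p)})
       \<le> ennreal (C * c * r powr \<gamma>)"
    using content_small_projections_ratio by blast
  have "eventually (\<lambda>r. r powr (- q) \<le> real (covering_number r F)) (at_right 0)"
    by (rule lower_box_dim_greater_imp[OF F q])
  then obtain b where b: "b > 0" "\<And>r. 0 < r \<Longrightarrow> r < b \<Longrightarrow> r powr (- q) \<le> real (covering_number r F)"
    unfolding eventually_at_right_field by blast
  \<comment> \<open>Absorbs a change of scale by a factor up to 2 in \<open>r powr (- p)\<close>,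
    for either sign of p.\<close>
  define c where "c = 2 powr \<bar>p\<bar>"
  define g where "g = (1/2::real) powr \<gamma>"
  have c: "c > 0" by (simp add: c_def)
  have g: "0 < g" "g < 1" using \<gamma> by (auto simp: g_def powr01_less_one)
  have g_pow: "((1/2)^k) powr \<gamma> = g ^ k" for k
    by (simp add: g_def powr_realpow[symmetric] powr_powr mult.commute)
  define B where "B k = {V \<in> grassmannian m. real (covering_number ((1/2)^k) (orth_proj V ` F)) \<le> c * ((1/2)^k) powr (- p)}" for k
  obtain K1 where K1: "(1/2::real) ^ K1 < min r0 b" using real_arch_pow_inv[of "min r0 b" "1/2"] r0 b(1) by auto
  have "(\<lambda>k. C * c * g ^ k / (1 - g)) \<longlonglongrightarrow> 0"
    using g by (intro tendsto_divide_zero tendsto_mult_right_zero LIMSEQ_realpow_zero) auto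
  then have "eventually (\<lambda>k. C * c * g ^ k / (1 - g) < e) sequentially" using e by (rule order_tendstoD(2))
  then obtain K2 where K2: "\<And>k. k \<ge> K2 \<Longrightarrow> C * c * g ^ k / (1 - g) < e" unfolding eventually_sequentially by blast
  define K where "K = max K1 K2"
  have Bk: "hausdorff_content t (proj_op ` B (k + K)) \<le> ennreal (C * c * g ^ K * g ^ k)" for k
  proof -
    have "(1/2::real) ^ (k + K) \<le> (1/2) ^ K1" by (intro power_decreasing) (auto simp: K_def)
    then have r: "(1/2::real) ^ (k + K) < r0" "(1/2::real) ^ (k + K) < b"
      using K1 order_le_less_trans unfolding min_less_iff_conj by blast+
    have "hausdorff_content t (proj_op ` B (k + K)) \<le> ennreal (C * c * ((1/2) ^ (k + K)) powr \<gamma>)"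
      unfolding B_def using r c b(2) by (intro main) auto
    then show ?thesis unfolding g_pow by (simp add: power_add mult_ac)
  qed
  have "proj_op ` {V \<in> grassmannian m. lower_box_dim (orth_proj V ` F) < ereal p} \<subseteq> (\<Union>k. proj_op ` B (k + K))"
  proof -
    have "\<exists>k. V \<in> B (k + K)" if V: "V \<in> grassmannian m" "lower_box_dim (orth_proj V ` F) < ereal p" for V
    proof -
      have bd: "bounded (orth_proj V ` F)"
        using V(1) by (intro bounded_linear_image F bounded_linear_orth_proj) (simp add: grassmannian_def)
      then have "frequently (\<lambda>r. real (covering_number r (orth_proj V ` F)) \<le> r powr (- p)) (at_right 0)"
        using V(2) F(2) by (intro lower_box_dim_less_imp) auto
      moreover have "eventually (\<lambda>r::real. 0 < r \<and> r < (1/2) ^ K) (at_right 0)" by (rule eventually_at_right_0_lt) simp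
      ultimately have "frequently (\<lambda>r. (0 < r \<and> r < (1/2) ^ K) \<and> real (covering_number r (orth_proj V ` F)) \<le> r powr (- p)) (at_right 0)"
        by (rule frequently_eventually_conj)
      from frequently_ex[OF this]
      obtain r where r: "0 < r" "r < (1/2) ^ K" "real (covering_number r (orth_proj V ` F)) \<le> r powr (- p)"
        by blast
      \<comment> \<open>The level just before \<open>j\<close> has scale in the interval from r to 2
        r; \<open>K < j\<close> ensures that this level exists and is at least
        \<open>K\<close>.\<close>
      define j where "j = (LEAST j. (1/2::real) ^ j < r)"
      have "\<exists>j. (1/2::real) ^ j < r" using real_arch_pow_inv[of r "1/2"] r(1) by auto
      then have j: "(1/2::real) ^ j < r" unfolding j_def by (rule LeastI_ex)
      have "K < j"
      proof (rule ccontr)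
        assume "\<not> K < j"
        then have "(1/2::real) ^ K \<le> (1/2) ^ j" by (intro power_decreasing) auto
        with j r(2) show False by simp
      qed
      then obtain k where k: "j = Suc (k + K)" by (metis add.commute less_imp_Suc_add)
      have "\<not> (1/2::real) ^ (k + K) < r" using not_less_Least[of "k + K" "\<lambda>j. (1/2::real) ^ j < r"] by (simp add: j_def[symmetric] k)
      then have lo: "r \<le> (1/2) ^ (k + K)" by simp
      let ?\<rho> = "(1/2::real) ^ (k + K)"
      have \<rho>: "?\<rho> > 0" by simp
      have ratio: "1/2 \<le> r / ?\<rho>" "r / ?\<rho> \<le> 1" using j lo k by (auto simp: field_simps)
      have "real (covering_number ?\<rho> (orth_proj V ` F)) \<le> real (covering_number r (orth_proj V ` F))"
        using covering_number_antimono[OF bd r(1) lo] by simp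
      also have "\<dots> \<le> r powr (- p)" by (rule r(3))
      also have "r powr (- p) = (r / ?\<rho> * ?\<rho>) powr (- p)" by simp
      also have "\<dots> = (r / ?\<rho>) powr (- p) * ?\<rho> powr (- p)" by (rule powr_mult)
      also have "(r / ?\<rho>) powr (- p) \<le> c"
      proof (cases "p \<ge> 0")
        case True
        have "(r / ?\<rho>) powr (- p) \<le> (1/2) powr (- p)" using True ratio by (intro powr_mono2') auto
        also have "\<dots> = c" using True by (simp add: c_def powr_minus_divide powr_divide)
        finally show ?thesis .
      next
        case False
        have "(r / ?\<rho>) powr (- p) \<le> 1 powr (- p)" using False ratio r(1) by (intro powr_mono2) auto
        also have "\<dots> \<le> c" by (simp add: c_def ge_one_powr_ge_zero)
        finally show ?thesis .
      qed
      finally show ?thesis using V(1) by (auto simp: B_def mult_right_mono)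
    qed
    then show ?thesis by blast
  qed
  then have "hausdorff_content t (proj_op ` {V \<in> grassmannian m. lower_box_dim (orth_proj V ` F) < ereal p})
      \<le> hausdorff_content t (\<Union>k. proj_op ` B (k + K))" by (rule hausdorff_content_mono)
  also have "\<dots> \<le> (\<Sum>k. hausdorff_content t (proj_op ` B (k + K)))" by (rule hausdorff_content_UN_le)
  also have "\<dots> \<le> (\<Sum>k. ennreal (C * c * g ^ K * g ^ k))" by (intro suminf_le Bk) auto
  also have "\<dots> = ennreal (C * c * g ^ K * (1 / (1 - g)))"
    using C c g by (intro suminf_ennreal_eq sums_mult geometric_sums) auto
  also have "\<dots> \<le> ennreal e" using K2[of K] by (intro ennreal_leI) (simp add: K_def)
  finally show "hausdorff_content t (proj_op ` {V \<in> grassmannian m. lower_box_dim (orth_proj V ` F) < ereal p}) \<le> ennreal e" .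
qed

end

section \<open>Finiteness and monotonicity of the Assouad defect\<close>

lemma covering_number_ball_le:
  fixes x :: "'a::euclidean_space"
  assumes "0 < r" "r \<le> R" and E: "E \<subseteq> cball x R"
  shows "real (covering_number r E) \<le> (2 * real DIM('a) + 3) ^ DIM('a) * (R / r) ^ DIM('a)"
proof -
  define n where "n = DIM('a)"
  have n: "real n > 0" by (simp add: n_def)
  \<comment> \<open>Cubes of side r / n have diameter at most r, the norm being bounded by the sum
    of the coordinates.\<close>
  define h where "h = r / real n"
  have h: "h > 0" using assms(1) n by (simp add: h_def)
  define L where "L = nat \<lceil>R / h\<rceil>"
  define lab where "lab y = restrict (\<lambda>i. \<lfloor>((y - x) \<bullet> i) / h\<rfloor>) Basis" for y
  define T where "T = (\<Pi>\<^sub>E i\<in>(Basis::'a set). {- int L..int L})"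
  have finT: "finite T" unfolding T_def by (intro finite_PiE) auto
  have cardT: "card T = (2 * L + 1) ^ n" unfolding T_def by (subst card_PiE) (auto simp: n_def nat_add_distrib nat_mult_distrib)
  have labT: "lab y \<in> T" if "y \<in> E" for y
  proof -
    have "\<lfloor>((y - x) \<bullet> i) / h\<rfloor> \<in> {- int L..int L}" if i: "i \<in> Basis" for i
    proof -
      have "norm (y - x) \<le> R" using E \<open>y \<in> E\<close> by (auto simp: dist_norm norm_minus_commute)
      then have "\<bar>(y - x) \<bullet> i\<bar> \<le> R" using Basis_le_norm[OF i, of "y - x"] by linarith
      then have "\<bar>((y - x) \<bullet> i) / h\<bar> \<le> R / h" using h by (simp add: abs_divide divide_right_mono)
      then have "\<bar>((y - x) \<bullet> i) / h\<bar> \<le> real L" unfolding L_def by linarith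
      then have "real_of_int (- int L) \<le> ((y - x) \<bullet> i) / h" "((y - x) \<bullet> i) / h < real_of_int (int L) + 1" by linarith+
      then show ?thesis by (simp only: atLeastAtMost_iff le_floor_iff floor_le_iff)
    qed
    then show ?thesis by (auto simp: lab_def T_def)
  qed
  define C where "C = (\<lambda>q. {y\<in>E. lab y = q}) ` T"
  have "covering_number r E \<le> card C"
  proof (rule covering_number_le)
    show "finite C" using finT by (simp add: C_def)
    show "E \<subseteq> \<Union>C" using labT by (auto simp: C_def)
    show "\<forall>U\<in>C. bounded U \<and> diameter U \<le> r"
    proof
      fix U assume "U \<in> C"
      then obtain q where U: "U = {y\<in>E. lab y = q}" by (auto simp: C_def)
      have d: "norm (y - z) \<le> r" if "y \<in> U" "z \<in> U" for y z
      proof -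
        have eq: "lab y = lab z" using that U by simp
        have "norm (y - z) \<le> (\<Sum>i\<in>Basis. \<bar>(y - z) \<bullet> i\<bar>)" by (rule norm_le_l1)
        also have "\<dots> \<le> (\<Sum>i\<in>(Basis::'a set). h)"
        proof (rule sum_mono)
          fix i :: 'a assume i: "i \<in> Basis"
          have "\<lfloor>((y - x) \<bullet> i) / h\<rfloor> = \<lfloor>((z - x) \<bullet> i) / h\<rfloor>"
            using fun_cong[OF eq, of i] i by (simp add: lab_def)
          then have "\<bar>((y - x) \<bullet> i) / h - ((z - x) \<bullet> i) / h\<bar> \<le> 1" by linarith
          then have "\<bar>(y - z) \<bullet> i\<bar> / h \<le> 1"
            using h by (simp add: inner_diff_left abs_divide flip: diff_divide_distrib)
          then show "\<bar>(y - z) \<bullet> i\<bar> \<le> h" using h by simp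
        qed
        also have "\<dots> = r" using n by (simp add: h_def n_def)
        finally show ?thesis .
      qed
      have "bounded U" using E U bounded_cball bounded_subset by (metis (no_types, lifting) mem_Collect_eq subset_iff)
      moreover have "diameter U \<le> r" using d assms(1) by (intro diameter_le) auto
      ultimately show "bounded U \<and> diameter U \<le> r" by simp
    qed
  qed
  also have "card C \<le> (2 * L + 1) ^ n" using card_image_le[OF finT] by (simp add: C_def cardT)
  finally have "real (covering_number r E) \<le> real ((2 * L + 1) ^ n)" by (rule of_nat_mono)
  also have "\<dots> = real (2 * L + 1) ^ n" by simp
  also have "\<dots> \<le> ((2 * real n + 3) * (R / r)) ^ n"
  proof (rule power_mono)
    have "R / h \<ge> 0" using assms h by simp
    then have "real L \<le> R / h + 1" unfolding L_def by linarith
    also have "R / h = real n * (R / r)" using n by (simp add: h_def)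
    finally have "real (2 * L + 1) \<le> 2 * (real n * (R / r)) + 3" by simp
    also have "\<dots> \<le> 2 * (real n * (R / r)) + 3 * (R / r)"
    proof -
      have "1 \<le> R / r" using assms by simp
      then show ?thesis by linarith
    qed
    also have "\<dots> = (2 * real n + 3) * (R / r)" by (simp add: algebra_simps)
    finally show "real (2 * L + 1) \<le> (2 * real n + 3) * (R / r)" .
  qed simp
  finally show ?thesis by (simp add: n_def power_mult_distrib power_divide)
qed

lemma assouad_defect_less_top:
  fixes F :: "'a::euclidean_space set"
  assumes "\<theta> < 1"
  shows "assouad_defect \<theta> s F < \<infinity>"
proof -
  define n where "n = DIM('a)"
  define C where "C = (2 * real n + 3) ^ n"
  have C: "C > 0" by (simp add: C_def)
  have b: "real (covering_number r (cball x R \<inter> F)) \<le> C * (R / r) powr (real n)" if "0 < r" "r \<le> R" for r R and x :: 'a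
    using covering_number_ball_le[of r R "cball x R \<inter> F" x] that by (simp add: C_def n_def powr_realpow)
  have "assouad_dim F \<le> ereal (real n)"
    unfolding assouad_dim_def using C b by (intro Inf_lower CollectI exI[of _ "real n"] conjI exI[of _ C]) auto
  moreover have "upper_assouad_spectrum \<theta> F \<le> ereal (real n)"
    unfolding upper_assouad_spectrum_def
  proof (rule Inf_lower, rule CollectI, rule exI[of _ "real n"], rule conjI[OF refl], rule exI[of _ C], rule conjI[OF C], intro allI ballI impI)
    fix r R :: real and x assume "0 < r \<and> r \<le> R powr (1 / \<theta>) \<and> R powr (1 / \<theta>) < R \<and> R < 1"
    then show "real (covering_number r (cball x R \<inter> F)) \<le> C * (R / r) powr (real n)" by (intro b) auto
  qed
  ultimately have "assouad_dim F < \<infinity>" "upper_assouad_spectrum \<theta> F < \<infinity>" by (auto simp: less_top[symmetric] top_ereal_def)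
  then have "upper_assouad_spectrum \<theta> F - ereal s < \<infinity>" "(assouad_dim F - ereal s) * ereal (1 - \<theta>) < \<infinity>"
    using assms by (cases "assouad_dim F"; cases "upper_assouad_spectrum \<theta> F"; simp)+
  then show ?thesis unfolding assouad_defect_def by (subst Max_less_iff) auto
qed

lemma assouad_dim_mono:
  fixes E F :: "'a::euclidean_space set"
  assumes "E \<subseteq> F"
  shows "assouad_dim E \<le> assouad_dim F"
proof -
  have N: "real (covering_number r (cball x R \<inter> E)) \<le> real (covering_number r (cball x R \<inter> F))"
    if "0 < r" for r R and x :: 'a
    using that assms by (intro of_nat_mono covering_number_mono) (auto simp: bounded_Int)
  show ?thesis unfolding assouad_dim_def
  proof (intro Inf_superset_mono Collect_mono impI)
    fix u assume "\<exists>\<alpha>. u = ereal \<alpha> \<and> (\<exists>C>0. \<forall>r R. \<forall>x\<in>F. 0 < r \<and> r < R \<longrightarrow>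
            real (covering_number r (cball x R \<inter> F)) \<le> C * (R / r) powr \<alpha>)"
    then obtain \<alpha> C where u: "u = ereal \<alpha>" "C > 0" "\<forall>r R. \<forall>x\<in>F. 0 < r \<and> r < R \<longrightarrow>
            real (covering_number r (cball x R \<inter> F)) \<le> C * (R / r) powr \<alpha>" by blast
    show "\<exists>\<alpha>. u = ereal \<alpha> \<and> (\<exists>C>0. \<forall>r R. \<forall>x\<in>E. 0 < r \<and> r < R \<longrightarrow>
            real (covering_number r (cball x R \<inter> E)) \<le> C * (R / r) powr \<alpha>)"
    proof (rule exI[of _ \<alpha>], rule conjI[OF u(1)], rule exI[of _ C], rule conjI[OF u(2)], intro allI ballI impI)
      fix r R :: real and x assume "x \<in> E" "0 < r \<and> r < R"
      then show "real (covering_number r (cball x R \<inter> E)) \<le> C * (R / r) powr \<alpha>"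
        using N[of r x R] u(3) assms by (meson order_trans subsetD)
    qed
  qed
qed

lemma upper_assouad_spectrum_mono:
  fixes E F :: "'a::euclidean_space set"
  assumes "E \<subseteq> F"
  shows "upper_assouad_spectrum \<theta> E \<le> upper_assouad_spectrum \<theta> F"
proof -
  have N: "real (covering_number r (cball x R \<inter> E)) \<le> real (covering_number r (cball x R \<inter> F))"
    if "0 < r" for r R and x :: 'a
    using that assms by (intro of_nat_mono covering_number_mono) (auto simp: bounded_Int)
  show ?thesis unfolding upper_assouad_spectrum_def
  proof (intro Inf_superset_mono Collect_mono impI)
    fix u assume "\<exists>\<alpha>. u = ereal \<alpha> \<and> (\<exists>C>0. \<forall>r R. \<forall>x\<in>F.
            0 < r \<and> r \<le> R powr (1 / \<theta>) \<and> R powr (1 / \<theta>) < R \<and> R < 1 \<longrightarrow>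
            real (covering_number r (cball x R \<inter> F)) \<le> C * (R / r) powr \<alpha>)"
    then obtain \<alpha> C where u: "u = ereal \<alpha>" "C > 0" "\<forall>r R. \<forall>x\<in>F.
            0 < r \<and> r \<le> R powr (1 / \<theta>) \<and> R powr (1 / \<theta>) < R \<and> R < 1 \<longrightarrow>
            real (covering_number r (cball x R \<inter> F)) \<le> C * (R / r) powr \<alpha>" by blast
    show "\<exists>\<alpha>. u = ereal \<alpha> \<and> (\<exists>C>0. \<forall>r R. \<forall>x\<in>E.
            0 < r \<and> r \<le> R powr (1 / \<theta>) \<and> R powr (1 / \<theta>) < R \<and> R < 1 \<longrightarrow>
            real (covering_number r (cball x R \<inter> E)) \<le> C * (R / r) powr \<alpha>)"
    proof (rule exI[of _ \<alpha>], rule conjI[OF u(1)], rule exI[of _ C], rule conjI[OF u(2)], intro allI ballI impI)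
      fix r R :: real and x
      assume "x \<in> E" "0 < r \<and> r \<le> R powr (1 / \<theta>) \<and> R powr (1 / \<theta>) < R \<and> R < 1"
      then show "real (covering_number r (cball x R \<inter> E)) \<le> C * (R / r) powr \<alpha>"
        using N[of r x R] u(3) assms by (meson order_trans subsetD)
    qed
  qed
qed

text \<open>Lets the packing argument apply the upper box result to pieces of F with the same
  \<delta>.\<close>

lemma assouad_defect_mono:
  fixes E F :: "'a::euclidean_space set"
  assumes "E \<subseteq> F" "\<theta> < 1"
  shows "assouad_defect \<theta> s E \<le> assouad_defect \<theta> s F"
proof -
  have "upper_assouad_spectrum \<theta> E - ereal s \<le> upper_assouad_spectrum \<theta> F - ereal s"
    by (intro ereal_minus_mono upper_assouad_spectrum_mono assms) simp
  moreover have "(assouad_dim E - ereal s) * ereal (1 - \<theta>) \<le> (assouad_dim F - ereal s) * ereal (1 - \<theta>)"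
    using assms by (intro ereal_mult_right_mono ereal_minus_mono assouad_dim_mono) auto
  moreover have "Max {0, a, b} = max 0 (max a b)" for a b :: ereal by simp
  ultimately show ?thesis unfolding assouad_defect_def by (metis max.mono order_refl)
qed

text \<open>Since \<open>\<infinity> - \<infinity> = \<infinity>\<close> in \<^typ>\<open>ereal\<close>, finiteness of the defect is essential here.\<close>
lemma ereal_defect_split:
  fixes u d \<Delta> :: ereal
  assumes "u < d - \<Delta>" "0 \<le> \<Delta>" "\<Delta> < \<infinity>"
  shows "\<exists>p\<in>\<rat>. \<exists>\<delta>\<in>\<rat>. u < ereal p \<and> \<Delta> < ereal \<delta> \<and> ereal (p + \<delta>) < d"
proof -
  obtain D where D: "\<Delta> = ereal D" using assms(2,3) by (cases \<Delta>) auto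
  obtain z where z: "u < ereal z" "ereal z < d - \<Delta>" using ereal_dense2[OF assms(1)] by blast
  \<comment> \<open>The interval from \<open>z\<close> to \<open>z'\<close> is shared:
    \<open>p\<close> lies inside it, and \<delta> exceeds \<open>D\<close> by less than z' - p, so
    that p + \<delta> < z' + D < d.\<close>
  obtain z' where z': "ereal z < ereal z'" "ereal z' < d - \<Delta>" using ereal_dense2[OF z(2)] by blast
  obtain p where p: "p \<in> \<rat>" "z < p" "p < z'" using Rats_dense_in_real[of z z'] z'(1) by auto
  have "ereal (z' + D) < d" using z'(2) unfolding D by (cases d) auto
  obtain \<delta> where \<delta>: "\<delta> \<in> \<rat>" "D < \<delta>" "\<delta> < D + (z' - p)" using Rats_dense_in_real[of D "D + (z' - p)"] p by auto
  have "ereal (p + \<delta>) < ereal (z' + D)" using \<delta>(3) by simp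
  then have "ereal (p + \<delta>) < d" using \<open>ereal (z' + D) < d\<close> by (rule less_trans)
  moreover have "u < ereal p" using z(1) p(2) by (meson ereal_less_eq(3) less_imp_le order_less_le_trans)
  ultimately show ?thesis using p(1) \<delta>(1,2) D by (intro bexI[of _ p] bexI[of _ \<delta>]) auto
qed

text \<open>The common reduction for the three dimensions. Sandwiching the strict inequality between
  rational p and \<delta> makes the exceptional set a countable union of level sets, and
  content-null sets are closed under such unions.\<close>

lemma content_exceptional_from_levels:
  fixes dimf :: "'b \<Rightarrow> ereal" and P :: "'b \<Rightarrow> 'c::metric_space"
  assumes \<Delta>: "0 \<le> \<Delta>" "\<Delta> < \<infinity>" and "t > 0"
    and level: "\<And>p \<delta> q. \<Delta> < ereal \<delta> \<Longrightarrow> p + \<delta> < q \<Longrightarrow> ereal q < d \<Longrightarrow>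
      hausdorff_content t (P ` {V \<in> G. dimf V < ereal p}) = 0"
  shows "hausdorff_dim (P ` {V \<in> G. dimf V < d - \<Delta>}) \<le> ereal t"
proof -
  define J where "J = {(p, \<delta>). p \<in> \<rat> \<and> \<delta> \<in> \<rat> \<and> \<Delta> < ereal \<delta> \<and> ereal (p + \<delta>) < d}"
  have "J \<subseteq> \<rat> \<times> \<rat>" by (auto simp: J_def)
  then have J: "countable J" using countable_rat by (meson countable_SIGMA countable_subset)
  have "hausdorff_content t (P ` {V \<in> G. dimf V < ereal (fst j)}) = 0" if "j \<in> J" for j
  proof -
    obtain p \<delta> where j: "j = (p, \<delta>)" "\<Delta> < ereal \<delta>" "ereal (p + \<delta>) < d" using \<open>j \<in> J\<close> by (auto simp: J_def)
    obtain q where "ereal (p + \<delta>) < ereal q" "ereal q < d" using ereal_dense2[OF j(3)] by blast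
    then show ?thesis using level[OF j(2), of p q] j(1) by simp
  qed
  then have "hausdorff_content t (\<Union>j\<in>J. P ` {V \<in> G. dimf V < ereal (fst j)}) = 0"
    by (rule hausdorff_content_countable_UN_eq_0[OF J _ \<open>t > 0\<close>])
  moreover have "P ` {V \<in> G. dimf V < d - \<Delta>} \<subseteq> (\<Union>j\<in>J. P ` {V \<in> G. dimf V < ereal (fst j)})"
  proof
    fix y assume "y \<in> P ` {V \<in> G. dimf V < d - \<Delta>}"
    then obtain V where V: "V \<in> G" "dimf V < d - \<Delta>" "y = P V" by blast
    obtain p \<delta> where "p \<in> \<rat>" "\<delta> \<in> \<rat>" "dimf V < ereal p" "\<Delta> < ereal \<delta>" "ereal (p + \<delta>) < d"
      using ereal_defect_split[OF V(2) \<Delta>] by blast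
    then show "y \<in> (\<Union>j\<in>J. P ` {V \<in> G. dimf V < ereal (fst j)})"
      using V by (intro UN_I[of "(p, \<delta>)"]) (auto simp: J_def)
  qed
  then have "hausdorff_content t (P ` {V \<in> G. dimf V < d - \<Delta>})
      \<le> hausdorff_content t (\<Union>j\<in>J. P ` {V \<in> G. dimf V < ereal (fst j)})" by (rule hausdorff_content_mono)
  ultimately have "hausdorff_content t (P ` {V \<in> G. dimf V < d - \<Delta>}) = 0" by simp
  then show ?thesis using \<open>t > 0\<close> by (rule hausdorff_dim_le)
qed

lemma assouad_defect_nonneg: "0 \<le> assouad_defect \<theta> s F"
  unfolding assouad_defect_def by (rule Max_ge) auto

subsection \<open>Packing dimension\<close>

lemma upper_box_dim_mono:
  fixes A B :: "'a::euclidean_space set"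
  assumes "A \<subseteq> B" "bounded B"
  shows "upper_box_dim A \<le> upper_box_dim B"
  unfolding upper_box_dim_def
proof (rule Limsup_mono, rule eventually_mono[OF eventually_at_right_0_lt[of 1]])
  fix r :: real assume r: "0 < r \<and> r < 1"
  have "covering_number r A \<le> covering_number r B" using assms r by (intro covering_number_mono) auto
  \<comment> \<open>A count of 0 does no harm: \<open>ln 0 = 0\<close> is at most the logarithm of
    any natural number.\<close>
  then have "ln (real (covering_number r A)) \<le> ln (real (covering_number r B))"
    by (cases "covering_number r A = 0"; cases "covering_number r B = 0") auto
  then show "ereal (ln (real (covering_number r A)) / - ln r) \<le> ereal (ln (real (covering_number r B)) / - ln r)"
    using r unfolding ereal_less_eq(3) by (intro divide_right_mono) auto
qed simp

lemma upper_box_dim_nonneg: "0 \<le> upper_box_dim (A :: 'a::euclidean_space set)"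
  unfolding upper_box_dim_def
proof (rule le_Limsup, simp, rule eventually_mono[OF eventually_at_right_0_lt[of 1]])
  fix r :: real assume r: "0 < r \<and> r < 1"
  have "0 \<le> ln (real n)" for n :: nat by (cases "n = 0") auto
  then have "0 \<le> ln (real (covering_number r A)) / - ln r" using r by (intro divide_nonneg_nonneg) auto
  then show "0 \<le> ereal (ln (real (covering_number r A)) / - ln r)" by simp
qed simp

text \<open>Closing the members of a cover preserves their diameters. Thus the compactness demanded
  of packing covers costs nothing for bounded sets.\<close>

lemma upper_box_dim_closure_le:
  fixes A :: "'a::euclidean_space set"
  assumes "bounded A"
  shows "upper_box_dim (closure A) \<le> upper_box_dim A"
proof -
  have "covering_number r (closure A) \<le> covering_number r A" if r: "r > 0" for r
  proof -
    obtain C where C: "finite C" "card C = covering_number r A" "A \<subseteq> \<Union>C" "\<forall>U\<in>C. bounded U \<and> diameter U \<le> r"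
      using covering_number_attained[OF assms r] by metis
    have "closure A \<subseteq> \<Union>(closure ` C)"
      using C(1,3) by (intro closure_minimal closed_Union) (auto intro: subsetD[OF closure_subset])
    then have "covering_number r (closure A) \<le> card (closure ` C)"
      using C(1,4) by (intro covering_number_le) (auto simp: diameter_closure bounded_closure)
    also have "\<dots> \<le> covering_number r A" using card_image_le[OF C(1)] C(2) by metis
    finally show ?thesis .
  qed
  moreover have "covering_number r A \<le> covering_number r (closure A)" if "r > 0" for r
    using that assms by (intro covering_number_mono closure_subset) auto
  ultimately have eq: "covering_number r (closure A) = covering_number r A" if "r > 0" for r
    using that by (meson le_antisym)
  have "eventually (\<lambda>r. ereal (ln (real (covering_number r (closure A))) / - ln r)
      = ereal (ln (real (covering_number r A)) / - ln r)) (at_right 0)"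
    by (rule eventually_mono[OF eventually_at_right_0_lt[of 1]]) (simp_all add: eq)
  then show ?thesis unfolding upper_box_dim_def by (intro eq_refl Limsup_eq)
qed

lemma packing_dim_le_upper_box_dim:
  fixes A :: "'a::euclidean_space set"
  assumes "bounded A"
  shows "packing_dim A \<le> upper_box_dim A"
proof -
  have "packing_dim A \<le> (SUP j::nat. upper_box_dim (closure A))"
    unfolding packing_dim_def using assms closure_subset[of A]
    by (intro Inf_lower CollectI exI[of _ "\<lambda>_. closure A"]) (auto simp: compact_closure)
  also have "\<dots> = upper_box_dim (closure A)" by simp
  also have "\<dots> \<le> upper_box_dim A" by (rule upper_box_dim_closure_le[OF assms])
  finally show ?thesis .
qed

lemma packing_dim_nonneg: "0 \<le> packing_dim (A :: 'a::euclidean_space set)"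
  unfolding packing_dim_def
proof (rule Inf_greatest)
  fix u assume "u \<in> {(SUP j. upper_box_dim (K j)) |K :: nat \<Rightarrow> 'a set. A \<subseteq> (\<Union>j. K j) \<and> (\<forall>j. compact (K j))}"
  then obtain K :: "nat \<Rightarrow> 'a set" where "u = (SUP j. upper_box_dim (K j))" by blast
  then show "0 \<le> u" using upper_box_dim_nonneg[of "K 0"] by (auto intro: SUP_upper2)
qed

text \<open>For each z > q every piece has a sequence of compact sets with supremum below z; the
  pairing function merges these sequences into one.\<close>

lemma packing_dim_countable_UN_le:
  fixes B :: "'i \<Rightarrow> 'a::euclidean_space set"
  assumes "countable I" "I \<noteq> {}" "A \<subseteq> (\<Union>i\<in>I. B i)" "\<And>i. i \<in> I \<Longrightarrow> packing_dim (B i) \<le> q"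
  shows "packing_dim A \<le> q"
proof (rule dense_ge)
  fix z assume z: "q < z"
  have "\<exists>K :: nat \<Rightarrow> 'a set. B i \<subseteq> (\<Union>j. K j) \<and> (\<forall>j. compact (K j)) \<and> (SUP j. upper_box_dim (K j)) < z" if "i \<in> I" for i
  proof -
    have "packing_dim (B i) < z" using assms(4)[OF that] z by (rule le_less_trans)
    then show ?thesis unfolding packing_dim_def Inf_less_iff by blast
  qed
  then have "\<forall>i\<in>I. \<exists>K :: nat \<Rightarrow> 'a set. B i \<subseteq> (\<Union>j. K j) \<and> (\<forall>j. compact (K j)) \<and> (SUP j. upper_box_dim (K j)) < z" by blast
  from bchoice[OF this] obtain K :: "'i \<Rightarrow> nat \<Rightarrow> 'a set" where
    K: "\<forall>i\<in>I. B i \<subseteq> (\<Union>j. K i j) \<and> (\<forall>j. compact (K i j)) \<and> (SUP j. upper_box_dim (K i j)) < z" ..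
  define L where "L k = K (from_nat_into I (fst (prod_decode k))) (snd (prod_decode k))" for k
  have inI: "from_nat_into I n \<in> I" for n by (rule from_nat_into[OF assms(2)])
  have "A \<subseteq> (\<Union>k. L k)"
  proof
    fix x assume "x \<in> A"
    then obtain i where i: "i \<in> I" "x \<in> B i" using assms(3) by blast
    then obtain j where j: "x \<in> K i j" using K by blast
    obtain n where "from_nat_into I n = i" using from_nat_into_surj[OF assms(1) i(1)] by blast
    then have "x \<in> L (prod_encode (n, j))" using j by (simp add: L_def)
    then show "x \<in> (\<Union>k. L k)" by blast
  qed
  moreover have "\<forall>k. compact (L k)" using K inI by (simp add: L_def)
  ultimately have "packing_dim A \<le> (SUP k. upper_box_dim (L k))"
    unfolding packing_dim_def by (intro Inf_lower) blast
  also have "\<dots> \<le> z"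
  proof (rule SUP_least)
    fix k
    have "upper_box_dim (L k) \<le> (SUP j. upper_box_dim (K (from_nat_into I (fst (prod_decode k))) j))"
      unfolding L_def by (rule SUP_upper) simp
    also have "\<dots> < z" using K inI by blast
    finally show "upper_box_dim (L k) \<le> z" by simp
  qed
  finally show "packing_dim A \<le> z" .
qed

section \<open>Borel sets as projections of closed sets\<close>

definition analytic_set :: "'a::topological_space set \<Rightarrow> bool" where
  "analytic_set A \<longleftrightarrow> (\<exists>C :: ('a \<times> (nat \<Rightarrow> nat)) set. closed C \<and> fst ` C = A)"

lemma analytic_set_closed:
  assumes "closed A" shows "analytic_set A"
  unfolding analytic_set_def
proof (intro exI conjI)
  show "closed (A \<times> (UNIV :: (nat \<Rightarrow> nat) set))" using assms by (intro closed_Times) auto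
qed auto

lemma continuous_on_snd_coordinate: "continuous_on UNIV (\<lambda>p::'a::topological_space \<times> (nat \<Rightarrow> nat). snd p k)"
  by (rule continuous_on_product_then_coordinatewise) (intro continuous_intros)

lemma continuous_on_reindex: "continuous_on UNIV (\<lambda>p::'a::topological_space \<times> (nat \<Rightarrow> nat). (fst p, \<lambda>k. snd p (h k)))"
  by (intro continuous_on_Pair continuous_on_fst continuous_on_id
      continuous_on_coordinatewise_then_product continuous_on_snd_coordinate)

text \<open>The first entry of the sequence names the piece and the shifted sequence is the witness
  for it. Discreteness of \<open>nat\<close> makes the resulting condition closed.\<close>

lemma analytic_set_UN:
  assumes "\<And>n::nat. analytic_set (A n)"
  shows "analytic_set (\<Union>n. A n)"
proof -
  obtain D :: "nat \<Rightarrow> ('a \<times> (nat \<Rightarrow> nat)) set" where D: "\<And>n. closed (D n)" "\<And>n. fst ` D n = A n"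
    using assms unfolding analytic_set_def by metis
  define C where "C = {p :: 'a \<times> (nat \<Rightarrow> nat). (fst p, \<lambda>k. snd p (Suc k)) \<in> D (snd p 0)}"
  have "- C = (\<Union>n. ((\<lambda>p. snd p 0) -` {n}) \<inter> ((\<lambda>p. (fst p, \<lambda>k. snd p (Suc k))) -` (- D n)))"
    by (auto simp: C_def)
  moreover have "open ((\<lambda>p::'a \<times> (nat \<Rightarrow> nat). snd p 0) -` {n})" for n
    by (rule open_vimage[OF open_discrete continuous_on_snd_coordinate])
  moreover have "open ((\<lambda>p. (fst p, \<lambda>k. snd p (Suc k))) -` (- D n))" for n
    by (rule open_vimage[OF open_Compl[OF D(1)] continuous_on_reindex])
  ultimately have "open (- C)" by (simp only:) (intro open_UN ballI open_Int)
  then have "closed C" by (simp add: closed_def)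
  moreover have "fst ` C = (\<Union>n. A n)"
  proof
    show "fst ` C \<subseteq> (\<Union>n. A n)"
    proof
      fix x assume "x \<in> fst ` C"
      then obtain \<sigma> where "(x, \<lambda>k. \<sigma> (Suc k)) \<in> D (\<sigma> 0)" by (auto simp: C_def)
      then have "x \<in> fst ` D (\<sigma> 0)" by force
      then show "x \<in> (\<Union>n. A n)" using D(2) by auto
    qed
    show "(\<Union>n. A n) \<subseteq> fst ` C"
    proof
      fix x assume "x \<in> (\<Union>n. A n)"
      then obtain n where "x \<in> fst ` D n" using D(2) by blast
      then obtain \<sigma> where "(x, \<sigma>) \<in> D n" by force
      then have "(x, case_nat n \<sigma>) \<in> C" by (simp add: C_def)
      then show "x \<in> fst ` C" by force
    qed
  qed
  ultimately show ?thesis unfolding analytic_set_def by blast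
qed

text \<open>A single sequence stores witnesses for all the sets at once, the one for
  \<open>A n\<close> sitting at the positions \<open>prod_encode (n, k)\<close>.\<close>

lemma analytic_set_INT:
  assumes "\<And>n::nat. analytic_set (A n)"
  shows "analytic_set (\<Inter>n. A n)"
proof -
  obtain D :: "nat \<Rightarrow> ('a \<times> (nat \<Rightarrow> nat)) set" where D: "\<And>n. closed (D n)" "\<And>n. fst ` D n = A n"
    using assms unfolding analytic_set_def by metis
  define C where "C = (\<Inter>n. (\<lambda>p. (fst p, \<lambda>k. snd p (prod_encode (n, k)))) -` D n)"
  have "closed C" unfolding C_def by (intro closed_INT ballI closed_vimage D(1) continuous_on_reindex)
  moreover have "fst ` C = (\<Inter>n. A n)"
  proof
    show "fst ` C \<subseteq> (\<Inter>n. A n)"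
    proof (rule subsetI, rule INT_I)
      fix x n assume "x \<in> fst ` C"
      then obtain \<sigma> where "(x, \<sigma>) \<in> C" by force
      then have "(x, \<lambda>k. \<sigma> (prod_encode (n, k))) \<in> D n" by (simp add: C_def)
      then have "x \<in> fst ` D n" by force
      then show "x \<in> A n" using D(2) by simp
    qed
    show "(\<Inter>n. A n) \<subseteq> fst ` C"
    proof
      fix x assume x: "x \<in> (\<Inter>n. A n)"
      have "\<exists>\<sigma>. (x, \<sigma>) \<in> D n" for n
      proof -
        have "x \<in> fst ` D n" using x D(2) by blast
        then show ?thesis by force
      qed
      then obtain \<sigma> where \<sigma>: "\<And>n. (x, \<sigma> n) \<in> D n" by metis
      have "(x, \<lambda>m. \<sigma> (fst (prod_decode m)) (snd (prod_decode m))) \<in> C" using \<sigma> by (simp add: C_def)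
      then show "x \<in> fst ` C" by force
    qed
  qed
  ultimately show ?thesis unfolding analytic_set_def by blast
qed

lemma analytic_set_open:
  fixes A :: "'a::euclidean_space set"
  assumes "open A" shows "analytic_set A"
proof (cases "A = {}")
  case False
  obtain \<D> where \<D>: "countable \<D>" "\<And>X. X \<in> \<D> \<Longrightarrow> \<exists>a b. X = cbox a b" "\<Union>\<D> = A"
    using open_countable_Union_open_cbox[OF assms] by metis
  have "\<D> \<noteq> {}" using \<D>(3) False by auto
  then have "A = (\<Union>n. from_nat_into \<D> n)" using range_from_nat_into[OF _ \<D>(1)] \<D>(3) by simp
  moreover have "analytic_set (from_nat_into \<D> n)" for n
    using \<D>(2)[OF from_nat_into[OF \<open>\<D> \<noteq> {}\<close>]] by (metis analytic_set_closed closed_cbox)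
  ultimately show ?thesis using analytic_set_UN[of "from_nat_into \<D>"] by simp
qed (simp add: analytic_set_closed)

lemma analytic_set_borel:
  fixes A :: "'a::euclidean_space set"
  assumes "A \<in> sets borel" shows "analytic_set A"
proof -
  have "A \<in> sigma_sets UNIV {S. open S}" using assms by (simp add: borel_def)
  \<comment> \<open>Analyticity is not preserved by complements, so the induction carries both
    halves; the complement of a union is then handled as an intersection.\<close>
  then have "analytic_set A \<and> analytic_set (- A)"
  proof (induction rule: sigma_sets.induct)
    case (Basic a)
    then show ?case by (simp add: analytic_set_open analytic_set_closed closed_Compl)
  next
    case Empty
    then show ?case by (simp add: analytic_set_closed)
  next
    case (Compl a)
    then show ?case by (simp add: Compl_eq_Diff_UNIV[symmetric])
  next
    case (Union a)
    then show ?case by (auto intro: analytic_set_UN analytic_set_INT)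
  qed
  then show ?thesis ..
qed

section \<open>Baire category and the kernel of large packing dimension\<close>

lemma completely_metrizable_space_Baire_product:
  "completely_metrizable_space (euclidean :: ('a::euclidean_space \<times> (nat \<Rightarrow> nat)) topology)"
proof -
  have "(euclidean :: nat topology) = discrete_topology UNIV" by (simp add: topology_eq open_discrete)
  then have "completely_metrizable_space (euclidean :: nat topology)"
    by (simp add: completely_metrizable_space_discrete_topology)
  then have "completely_metrizable_space (product_topology (\<lambda>_::nat. euclidean :: nat topology) UNIV)"
    unfolding completely_metrizable_space_product_topology by auto
  then have "completely_metrizable_space (euclidean :: (nat \<Rightarrow> nat) topology)"
    by (simp add: euclidean_product_topology)
  then show ?thesis
    unfolding prod_topology_euclidean[symmetric] completely_metrizable_space_prod_topology
    using completely_metrizable_space_euclidean by blast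
qed

lemma Baire_closed_cover:
  fixes C :: "('a::euclidean_space \<times> (nat \<Rightarrow> nat)) set" and T :: "nat \<Rightarrow> _"
  assumes "closed C" "C \<noteq> {}" "C \<subseteq> (\<Union>j. T j)" "\<And>j. closed (T j)"
  shows "\<exists>j U. open U \<and> U \<inter> C \<noteq> {} \<and> U \<inter> C \<subseteq> T j"
proof -
  let ?X = "top_of_set C"
  have "completely_metrizable_space ?X"
    using completely_metrizable_space_Baire_product assms(1)
    by (intro completely_metrizable_space_closedin) auto
  moreover have "\<exists>j. ?X interior_of (C \<inter> T j) \<noteq> {}"
  proof (rule ccontr)
    assume neg: "\<nexists>j. ?X interior_of (C \<inter> T j) \<noteq> {}"
    have "?X interior_of \<Union>(range (\<lambda>j. C \<inter> T j)) = {}"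
      using calculation neg assms(4) by (intro Baire_category_alt) (auto simp: closedin_closed_Int)
    moreover have "\<Union>(range (\<lambda>j. C \<inter> T j)) = C" using assms(3) by auto
    moreover have "?X interior_of C = C" using interior_of_topspace[of ?X] by simp
    ultimately show False using assms(2) by simp
  qed
  then obtain j x where "x \<in> ?X interior_of (C \<inter> T j)" by blast
  then obtain W where "openin ?X W" "x \<in> W" "W \<subseteq> C \<inter> T j" by (auto simp: interior_of_def)
  then obtain U where "open U" "W = C \<inter> U" by (auto simp: openin_open)
  then show ?thesis using \<open>x \<in> W\<close> \<open>W \<subseteq> C \<inter> T j\<close> by (intro exI[of _ j] exI[of _ U]) auto
qed

text \<open>All basic open sets over which \<open>C\<close> has a small projection are removed. They
  are countably many, so countable stability leaves something. If a relatively open nonempty part of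
  the rest still had a small projection, take a basic \<open>W\<close> inside the open set:
  \<open>C \<inter> W\<close> is contained in that part together with the removed pieces, so
  \<open>W\<close> would itself have been removed.\<close>

lemma packing_dim_kernel:
  fixes C :: "('a::euclidean_space \<times> (nat \<Rightarrow> nat)) set"
  assumes "closed C" "q < packing_dim (fst ` C)" "C \<noteq> {}"
  obtains C' where "closed C'" "C' \<subseteq> C" "C' \<noteq> {}"
    "\<And>U. open U \<Longrightarrow> U \<inter> C' \<noteq> {} \<Longrightarrow> q < packing_dim (fst ` (C' \<inter> U))"
proof -
  obtain \<B> :: "('a \<times> (nat \<Rightarrow> nat)) set set" where \<B>: "countable \<B>" "topological_basis \<B>"
    using ex_countable_basis by blast
  define \<N> where "\<N> = {U\<in>\<B>. packing_dim (fst ` (C \<inter> U)) \<le> q}"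
  have \<N>: "countable \<N>" using \<B>(1) by (auto simp: \<N>_def intro: countable_subset)
  have op: "open U" if "U \<in> \<B>" for U using topological_basis_open[OF \<B>(2) that] .
  define C' where "C' = C - \<Union>\<N>"
  have "closed C'" unfolding C'_def using assms(1) op by (intro closed_Diff open_Union) (auto simp: \<N>_def)
  moreover have "C' \<subseteq> C" by (auto simp: C'_def)
  moreover have "C' \<noteq> {}"
  proof
    assume "C' = {}"
    then have C: "C \<subseteq> \<Union>\<N>" by (auto simp: C'_def)
    then have "\<N> \<noteq> {}" using assms(3) by auto
    moreover have "fst ` C \<subseteq> (\<Union>U\<in>\<N>. fst ` (C \<inter> U))" using C by blast
    ultimately have "packing_dim (fst ` C) \<le> q"
      by (rule packing_dim_countable_UN_le[OF \<N>]) (simp add: \<N>_def)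
    then show False using assms(2) by simp
  qed
  moreover have "q < packing_dim (fst ` (C' \<inter> U))" if U: "open U" "U \<inter> C' \<noteq> {}" for U
  proof (rule ccontr)
    assume "\<not> q < packing_dim (fst ` (C' \<inter> U))"
    then have small: "packing_dim (fst ` (C' \<inter> U)) \<le> q" by simp
    obtain z where z: "z \<in> U" "z \<in> C'" using U(2) by blast
    obtain W where W: "W \<in> \<B>" "z \<in> W" "W \<subseteq> U" using topological_basisE[OF \<B>(2) U(1) z(1)] by metis
    have "fst ` (C \<inter> W) \<subseteq> (\<Union>V\<in>insert (C' \<inter> U) \<N>. fst ` (C \<inter> V))"
    proof
      fix x assume "x \<in> fst ` (C \<inter> W)"
      then obtain y where y: "y \<in> C" "y \<in> W" "x = fst y" by blast
      show "x \<in> (\<Union>V\<in>insert (C' \<inter> U) \<N>. fst ` (C \<inter> V))"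
      proof (cases "y \<in> \<Union>\<N>")
        case False
        then have "y \<in> C' \<inter> U" using y W(3) by (auto simp: C'_def)
        then show ?thesis using y by blast
      qed (use y in blast)
    qed
    then have "packing_dim (fst ` (C \<inter> W)) \<le> q"
    proof (rule packing_dim_countable_UN_le[rotated 2])
      show "countable (insert (C' \<inter> U) \<N>)" using \<N> by simp
      fix V assume "V \<in> insert (C' \<inter> U) \<N>"
      moreover have "C \<inter> (C' \<inter> U) = C' \<inter> U" by (auto simp: C'_def)
      ultimately show "packing_dim (fst ` (C \<inter> V)) \<le> q" using small by (auto simp: \<N>_def)
    qed simp
    then have "W \<in> \<N>" using W(1) by (simp add: \<N>_def)
    then show False using z(2) W(2) by (auto simp: C'_def)
  qed
  ultimately show ?thesis by (rule that)
qed

text \<open>Each set \<open>Y U\<close> has packing dimension, hence upper box dimension, above q.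
  For an exceptional V, Baire's theorem puts the projection of some \<open>Y U\<close> inside one
  compact set of upper box dimension below p. The index \<open>U\<close> ranges over a countable
  basis, so the upper box result disposes of all V at once.\<close>

lemma content_packing_exceptional:
  fixes F :: "'a::euclidean_space set" and m :: nat and \<theta> s \<delta> t p q :: real
  assumes m: "m < DIM('a)" and F: "F \<in> sets borel" and \<theta>: "0 < \<theta>" "\<theta> < 1" and s: "s > 0"
    and defect: "assouad_defect \<theta> s F < ereal \<delta>"
    and t: "t = real (m * (DIM('a) - 1 - m)) + s" and pq: "p + \<delta> < q" and q: "ereal q < packing_dim F"
  shows "hausdorff_content t (proj_op ` {V \<in> grassmannian m. packing_dim (orth_proj V ` F) < ereal p}) = 0"
proof (cases "p \<le> 0")
  case True
  have "\<not> packing_dim (orth_proj V ` F) < ereal p" for V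
  proof -
    have "ereal p \<le> 0" using True by simp
    then have "ereal p \<le> packing_dim (orth_proj V ` F)" using packing_dim_nonneg by (rule order_trans)
    then show ?thesis by (simp add: not_less)
  qed
  then have "{V \<in> grassmannian m. packing_dim (orth_proj V ` F) < ereal p} = {}" by simp
  moreover have "t > 0" using t s by (simp add: add_nonneg_pos)
  ultimately show ?thesis
    using hausdorff_content_countable_UN_eq_0[of "{}::nat set" t "\<lambda>_. {}"] by (simp only:) simp
next
  case False
  have t0: "t > 0" using t s by (simp add: add_nonneg_pos)
  have "\<delta> > 0" by (rule assouad_defect_less_imp(1)[OF defect \<theta>(2)])
  \<comment> \<open>Excludes an empty \<open>C\<close>, whose projection has packing dimension at
    most 0; this is why p \<le> 0 is treated separately.\<close>
  then have q0: "q > 0" using False pq by simp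
  have "\<exists>k::nat. ereal q < packing_dim (F \<inter> cball 0 (real k))"
  proof (rule ccontr)
    assume "\<not> ?thesis"
    then have small: "packing_dim (F \<inter> cball 0 (real k)) \<le> ereal q" for k :: nat by (simp add: not_less)
    have "F \<subseteq> (\<Union>k::nat. F \<inter> cball 0 (real k))"
    proof
      fix x assume "x \<in> F"
      moreover obtain k :: nat where "norm x \<le> real k" using real_arch_simple by blast
      ultimately show "x \<in> (\<Union>k::nat. F \<inter> cball 0 (real k))" by auto
    qed
    then have "packing_dim F \<le> ereal q"
      by (rule packing_dim_countable_UN_le[rotated 2]) (simp_all add: small)
    then show False using q by simp
  qed
  then obtain k :: nat where k: "ereal q < packing_dim (F \<inter> cball 0 (real k))" ..
  define A where "A = F \<inter> cball 0 (real k)"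
  have A: "bounded A" "A \<subseteq> F" by (auto simp: A_def bounded_Int)
  have "A \<in> sets borel" unfolding A_def using F by simp
  then obtain C :: "('a \<times> (nat \<Rightarrow> nat)) set" where C: "closed C" "fst ` C = A"
    using analytic_set_borel unfolding analytic_set_def by blast
  have "C \<noteq> {}"
  proof
    assume "C = {}"
    then have "packing_dim A \<le> upper_box_dim A" "A = {}" using C(2) packing_dim_le_upper_box_dim[OF A(1)] by auto
    moreover have "upper_box_dim ({} :: 'a set) \<le> 0"
    proof -
      have "covering_number r ({} :: 'a set) = 0" for r
        using covering_number_le[of "{}" "{}::'a set" r] by simp
      then show ?thesis by (simp add: upper_box_dim_def zero_ereal_def[symmetric] Limsup_const trivial_limit_at_right_real)
    qed
    ultimately have "packing_dim A \<le> 0" by (metis order_trans)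
    then have "ereal q < 0" using k unfolding A_def[symmetric] by (rule less_le_trans[rotated])
    then show False using q0 by simp
  qed
  moreover have "ereal q < packing_dim (fst ` C)" using k C(2) by (simp add: A_def)
  ultimately obtain C' where C': "closed C'" "C' \<subseteq> C" "C' \<noteq> {}"
    "\<And>U. open U \<Longrightarrow> U \<inter> C' \<noteq> {} \<Longrightarrow> ereal q < packing_dim (fst ` (C' \<inter> U))"
    using packing_dim_kernel[OF C(1)] by metis
  obtain \<B> :: "('a \<times> (nat \<Rightarrow> nat)) set set" where \<B>: "countable \<B>" "topological_basis \<B>"
    using ex_countable_basis by blast
  define J where "J = {U\<in>\<B>. U \<inter> C' \<noteq> {}}"
  have J: "countable J" using \<B>(1) by (auto simp: J_def intro: countable_subset)
  define Y where "Y U = fst ` (C' \<inter> U)" for U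
  have YA: "Y U \<subseteq> A" for U using C'(2) C(2) by (auto simp: Y_def)
  have null: "hausdorff_content t (proj_op ` {V \<in> grassmannian m. upper_box_dim (orth_proj V ` Y U) < ereal p}) = 0"
    if "U \<in> J" for U
  proof (rule content_upper_box_exceptional[OF m _ _ \<theta> s _ t pq])
    have U: "open U" "U \<inter> C' \<noteq> {}" using that topological_basis_open[OF \<B>(2)] by (auto simp: J_def)
    show bd: "bounded (Y U)" using YA A(1) bounded_subset by blast
    show "Y U \<noteq> {}" using U(2) by (auto simp: Y_def)
    have "assouad_defect \<theta> s (Y U) \<le> assouad_defect \<theta> s F"
      using YA A(2) \<theta>(2) by (intro assouad_defect_mono) auto
    then show "assouad_defect \<theta> s (Y U) < ereal \<delta>" using defect by (rule le_less_trans)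
    have "ereal q < packing_dim (Y U)" unfolding Y_def by (rule C'(4)[OF U])
    also have "\<dots> \<le> upper_box_dim (Y U)" by (rule packing_dim_le_upper_box_dim[OF bd])
    finally show "ereal q < upper_box_dim (Y U)" .
  qed
  have "proj_op ` {V \<in> grassmannian m. packing_dim (orth_proj V ` F) < ereal p}
     \<subseteq> (\<Union>U\<in>J. proj_op ` {V \<in> grassmannian m. upper_box_dim (orth_proj V ` Y U) < ereal p})"
  proof -
    have "\<exists>U\<in>J. upper_box_dim (orth_proj V ` Y U) < ereal p"
      if V: "V \<in> grassmannian m" "packing_dim (orth_proj V ` F) < ereal p" for V
    proof -
      obtain K :: "nat \<Rightarrow> 'a set" where K: "orth_proj V ` F \<subseteq> (\<Union>j. K j)" "\<And>j. compact (K j)" "(SUP j. upper_box_dim (K j)) < ereal p"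
        using V(2) unfolding packing_dim_def Inf_less_iff by blast
      have lin: "bounded_linear (orth_proj V)" using V(1) by (intro bounded_linear_orth_proj) (simp add: grassmannian_def)
      \<comment> \<open>The compact cover of the projected set is pulled back to the product space,
        where it becomes a countable closed cover of \<open>C'\<close>.\<close>
      have "continuous_on UNIV (\<lambda>z::'a \<times> (nat \<Rightarrow> nat). orth_proj V (fst z))"
        using lin by (intro bounded_linear.continuous_on[OF lin] continuous_intros)
      then have cl: "closed ((\<lambda>z::'a \<times> (nat \<Rightarrow> nat). orth_proj V (fst z)) -` K j)" for j
        by (intro closed_vimage compact_imp_closed K(2))
      have "C' \<subseteq> (\<Union>j. (\<lambda>z. orth_proj V (fst z)) -` K j)"
      proof
        fix z assume "z \<in> C'"
        then have "fst z \<in> F" using C'(2) C(2) A(2) by blast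
        then show "z \<in> (\<Union>j. (\<lambda>z. orth_proj V (fst z)) -` K j)" using K(1) by auto
      qed
      from Baire_closed_cover[OF C'(1,3) this cl]
      obtain j W where W: "open W" "W \<inter> C' \<noteq> {}" "W \<inter> C' \<subseteq> (\<lambda>z. orth_proj V (fst z)) -` K j" by blast
      obtain z where z: "z \<in> W" "z \<in> C'" using W(2) by blast
      obtain U where U: "U \<in> \<B>" "z \<in> U" "U \<subseteq> W" using topological_basisE[OF \<B>(2) W(1) z(1)] by metis
      have "orth_proj V ` Y U \<subseteq> K j" using U(3) W(3) by (auto simp: Y_def)
      then have "upper_box_dim (orth_proj V ` Y U) \<le> upper_box_dim (K j)"
        by (intro upper_box_dim_mono compact_imp_bounded K(2))
      also have "\<dots> \<le> (SUP j. upper_box_dim (K j))" by (rule SUP_upper) simp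
      also have "\<dots> < ereal p" by (rule K(3))
      finally show ?thesis using U z(2) by (intro bexI[of _ U]) (auto simp: J_def)
    qed
    then show ?thesis by blast
  qed
  then have "hausdorff_content t (proj_op ` {V \<in> grassmannian m. packing_dim (orth_proj V ` F) < ereal p})
     \<le> hausdorff_content t (\<Union>U\<in>J. proj_op ` {V \<in> grassmannian m. upper_box_dim (orth_proj V ` Y U) < ereal p})"
    by (rule hausdorff_content_mono)
  also have "\<dots> = 0" by (rule hausdorff_content_countable_UN_eq_0[OF J null t0])
  finally show ?thesis by simp
qed

theorem theorem1p2:
  fixes F :: "(real ^ 'n) set" and m :: nat and s \<theta> :: real
  assumes "1 \<le> m" and "m < CARD('n)"
    and "0 < s" and "s < real m"
    and "0 < \<theta>" and "\<theta> < 1"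
    and "F \<noteq> {}"
  shows "(bounded F \<longrightarrow>
      grassmannian_hausdorff_dim {V \<in> grassmannian m.
          upper_box_dim (orth_proj V ` F) < upper_box_dim F - assouad_defect \<theta> s F}
        \<le> ereal (real m * (real CARD('n) - real m) - (real m - s)) \<and>
      grassmannian_hausdorff_dim {V \<in> grassmannian m.
          lower_box_dim (orth_proj V ` F) < lower_box_dim F - assouad_defect \<theta> s F}
        \<le> ereal (real m * (real CARD('n) - real m) - (real m - s))) \<and>
    (F \<in> sets borel \<longrightarrow>
      grassmannian_hausdorff_dim {V \<in> grassmannian m.
          packing_dim (orth_proj V ` F) < packing_dim F - assouad_defect \<theta> s F}
        \<le> ereal (real m * (real CARD('n) - real m) - (real m - s)))"
proof -
  define t where "t = real m * (real CARD('n) - real m) - (real m - s)"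
  have m: "m < DIM(real ^ 'n)" using assms(2) by simp
  have t: "t = real (m * (DIM(real ^ 'n) - 1 - m)) + s"
  proof -
    have "real (CARD('n) - 1 - m) = real CARD('n) - 1 - real m" using assms(2) by (simp add: of_nat_diff)
    then have "real (m * (CARD('n) - 1 - m)) = real m * (real CARD('n) - 1 - real m)" by (simp only: of_nat_mult)
    moreover have "DIM(real ^ 'n) = CARD('n)" by simp
    ultimately have "real (m * (DIM(real ^ 'n) - 1 - m)) = real m * (real CARD('n) - 1 - real m)" by metis
    then show ?thesis unfolding t_def by (simp only:) (simp add: algebra_simps)
  qed
  then have t0: "t > 0" using assms(3) by (simp add: add_nonneg_pos)
  note levels = content_exceptional_from_levels[OF assouad_defect_nonneg assouad_defect_less_top[OF assms(6)] t0]
  show ?thesis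
    unfolding t_def[symmetric] grassmannian_hausdorff_dim_def
  proof (intro conjI impI)
    assume F: "bounded F"
    show "hausdorff_dim (proj_op ` {V \<in> grassmannian m. upper_box_dim (orth_proj V ` F) < upper_box_dim F - assouad_defect \<theta> s F}) \<le> ereal t"
      by (rule levels) (rule content_upper_box_exceptional[OF m F assms(7,5,6,3) _ t])
    show "hausdorff_dim (proj_op ` {V \<in> grassmannian m. lower_box_dim (orth_proj V ` F) < lower_box_dim F - assouad_defect \<theta> s F}) \<le> ereal t"
      by (rule levels) (rule content_lower_box_exceptional[OF m F assms(7,5,6,3) _ t])
  next
    assume F: "F \<in> sets borel"
    show "hausdorff_dim (proj_op ` {V \<in> grassmannian m. packing_dim (orth_proj V ` F) < packing_dim F - assouad_defect \<theta> s F}) \<le> ereal t"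
      by (rule levels) (rule content_packing_exceptional[OF m F assms(5,6,3) _ t])
  qed
qed

end
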